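(* Let $\ell\ge2$ be a fixed integer and consider first-passage percolation on the $\ell$-spread-out line with i.i.d. nonnegative edge weights distributed as $\omega$, where $\omega$ is not deterministic. Let $H^{(\ell)}(a,b)$ be the minimum number of edges among all geodesics from $a$ to $b$ ($a<b$ integers). Then there is a constant $\mu_{\mathrm{Hop}}\in(0,\infty)$ such that $$\frac1n H^{(\ell)}(0,n)\to\mu_{\mathrm{Hop}}\ \text{ a.s.}\qquad\text{and}\qquad \frac1n\,\mathbb E\,H^{(\ell)}(0,n)\to\mu_{\mathrm{Hop}}.$$ Moreover, $$n^{-1/2}\bigl(H^{(\ell)}(0,n)-n\,\mu_{\mathrm{Hop}}\bigr)\Longrightarrow \mathrm N(0,\sigma^2_{\mathrm{Hop}}),$$ where $$\sigma_{\mathrm{Hop}}^2=\frac1{\mu_{\mathsf P}}\operatorname{Var}\Bigl(\mathsf H_1-\frac{\mu_{\mathsf H}}{\mu_{\mathsf P}}\mathsf P_1\Bigr)>0 .$$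
   Context: Model. The $\ell$-spread-out line is the undirected graph on $\mathbb Z$ with edge set $\mathcal E^{(\ell)}=\{(x,y):x,y\in\mathbb Z,\ 1\le y-x\le\ell\}$. Edges carry i.i.d. nonnegative weights $\omega_{x,y}=\omega_{y,x}$ with the law of $\omega$. The passage time $T(u,v)$ is the minimal total weight of a path from $u$ to $v$; a geodesic is a path attaining $T(u,v)$; $H(u,v)=H^{(\ell)}(u,v)$ is the minimum number of edges among geodesics from $u$ to $v$. Pivots. A nondegenerate $\omega\ge 0$ satisfies exactly one of the following conditions. B.1: there is $a>0$ with $\mathbb P(\omega>2a)>0$ and $\mathbb P(\omega<a)>0$. Fix such an $a$. A vertex $v$ is called a pivot if $\omega_{x,v}<a$, $\omega_{v,y}<a$ and $\omega_{x,y}>2a$ for all $x<v<y$ with $2\le y-x\le \ell$. B.2: there is $c>0$ with $\mathbb P(\omega\in[c,2c])=1$; replacing $c$ by $\inf\operatorname{supp}(\omega)$ and dividing the weights by $c$ when defining pivots, assume $\inf\operatorname{supp}(\omega)=1$, $\sup\operatorname{supp}(\omega)=1+s$, $s\in(0,1]$. Fix an integer $k\ge2$ with $\mathbb P(1\le\omega<1+\frac1{k+1})>0$ and $\mathbb P(\omega>1+\frac2k)>0$. An edge is light if its weight lies in $[1,1+\frac1{k+1})$ and heavy if its weight is $>1+\frac2k$. A vertex $x$ is called a (generalized) pivot if, with $S_x=\{x,x+\ell,\dots,x+(k-1)\ell\}$, every edge with one endpoint in $S_x$ is light, except that nothing is required of the two edges $(x-\ell,x)$ and $(x+(k-1)\ell,x+k\ell)$,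 and every edge $(p,q)$ with $p<z<q$ for some $z\in S_x$ is heavy. Let $0\le\rho_1<\rho_2<\cdots$ be the pivots in $[0,\infty)$ (almost surely infinitely many), and set $\mathsf P_1=\rho_2-\rho_1$, $\mathsf H_1=H(\rho_1,\rho_2)$, $\mu_{\mathsf P}=\mathbb E\,\mathsf P_1$, $\mu_{\mathsf H}=\mathbb E\,\mathsf H_1$. "$\Longrightarrow$" denotes convergence in distribution. *)

theory Defs
  imports "HOL-Probability.Probability"
begin

text \<open>Every undirected edge is represented by its pair (x, y) of endpoints with x < y.
  A weight configuration is a function on such pairs; only its values on edges matter.\<close>

definition edges :: "int \<Rightarrow> (int \<times> int) set" where
  "edges l = {(x, y). 1 \<le> y - x \<and> y - x \<le> l}"

definition edge_weight :: "(int \<times> int \<Rightarrow> real) \<Rightarrow> int \<Rightarrow> int \<Rightarrow> real" where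
  "edge_weight w x y = w (min x y, max x y)"

definition adjacent :: "int \<Rightarrow> int \<Rightarrow> int \<Rightarrow> bool" where
  "adjacent l x y \<longleftrightarrow> (x, y) \<in> edges l \<or> (y, x) \<in> edges l"

text \<open>Paths are vertex sequences. Repeated vertices are allowed: as the weights are nonnegative,
  erasing loops shows that this affects neither passage times nor minimal edge numbers.\<close>

definition is_path :: "int \<Rightarrow> int \<Rightarrow> int \<Rightarrow> int list \<Rightarrow> bool" where
  "is_path l u v p \<longleftrightarrow> p \<noteq> [] \<and> hd p = u \<and> last p = v \<and> successively (adjacent l) p"

fun path_weight :: "(int \<times> int \<Rightarrow> real) \<Rightarrow> int list \<Rightarrow> real" where
  "path_weight w (x # y # p) = edge_weight w x y + path_weight w (y # p)"
| "path_weight w _ = 0"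

definition passage_time :: "int \<Rightarrow> (int \<times> int \<Rightarrow> real) \<Rightarrow> int \<Rightarrow> int \<Rightarrow> real" where
  "passage_time l w u v = (INF p\<in>{p. is_path l u v p}. path_weight w p)"

definition geodesic :: "int \<Rightarrow> (int \<times> int \<Rightarrow> real) \<Rightarrow> int \<Rightarrow> int \<Rightarrow> int list \<Rightarrow> bool" where
  "geodesic l w u v p \<longleftrightarrow> is_path l u v p \<and> path_weight w p = passage_time l w u v"

text \<open>The value is meaningful only if a geodesic exists, which in the model holds almost surely
  for all pairs of vertices.\<close>

definition hops :: "int \<Rightarrow> (int \<times> int \<Rightarrow> real) \<Rightarrow> int \<Rightarrow> int \<Rightarrow> nat" where
  "hops l w u v = (LEAST h. \<exists>p. geodesic l w u v p \<and> h = length p - 1)"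

definition law_support :: "real measure \<Rightarrow> real set" where
  "law_support D = {x. \<forall>U. open U \<and> x \<in> U \<longrightarrow> measure D U > 0}"

definition pivot1 :: "int \<Rightarrow> real \<Rightarrow> (int \<times> int \<Rightarrow> real) \<Rightarrow> int \<Rightarrow> bool" where
  "pivot1 l a w v \<longleftrightarrow>
     (\<forall>x y. x < v \<and> v < y \<and> 2 \<le> y - x \<and> y - x \<le> l \<longrightarrow>
        w (x, v) < a \<and> w (v, y) < a \<and> w (x, y) > 2 * a)"

definition light :: "int \<Rightarrow> real \<Rightarrow> bool" where
  "light k t \<longleftrightarrow> 1 \<le> t \<and> t < 1 + 1 / (real_of_int k + 1)"

definition heavy :: "int \<Rightarrow> real \<Rightarrow> bool" where
  "heavy k t \<longleftrightarrow> t > 1 + 2 / real_of_int k"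

definition pivot_set :: "int \<Rightarrow> int \<Rightarrow> int \<Rightarrow> int set" where
  "pivot_set l k x = (\<lambda>i. x + i * l) ` {0..<k}"

text \<open>Here w stands for the normalised weights. The edges joining consecutive points of
  the pivot set have both endpoints in it; they are required to be light as well.\<close>

definition pivot2 :: "int \<Rightarrow> int \<Rightarrow> (int \<times> int \<Rightarrow> real) \<Rightarrow> int \<Rightarrow> bool" where
  "pivot2 l k w x \<longleftrightarrow>
     (\<forall>(p, q)\<in>edges l - {(x - l, x), (x + (k - 1) * l, x + k * l)}.
        p \<in> pivot_set l k x \<or> q \<in> pivot_set l k x \<longrightarrow> light k (w (p, q))) \<and>
     (\<forall>(p, q)\<in>edges l. (\<exists>z\<in>pivot_set l k x. p < z \<and> z < q) \<longrightarrow> heavy k (w (p, q)))"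

text \<open>The predicates expressing \<open>being a pivot\<close>, one for each admissible choice of
  the auxiliary parameter a (first case) or k (second case) for the edge weight law D.\<close>

inductive pivot_notion ::
  "int \<Rightarrow> real measure \<Rightarrow> ((int \<times> int \<Rightarrow> real) \<Rightarrow> int \<Rightarrow> bool) \<Rightarrow> bool" for l D where
  B1: "a > 0 \<Longrightarrow> measure D {t. t > 2 * a} > 0 \<Longrightarrow> measure D {t. t < a} > 0 \<Longrightarrow>
       pivot_notion l D (pivot1 l a)"
| B2: "\<exists>c>0. measure D {c..2 * c} = 1 \<Longrightarrow> m = Inf (law_support D) \<Longrightarrow> k \<ge> 2 \<Longrightarrow>
       measure D {t. light k (t / m)} > 0 \<Longrightarrow> measure D {t. heavy k (t / m)} > 0 \<Longrightarrow>
       pivot_notion l D (\<lambda>w. pivot2 l k (\<lambda>e. w e / m))"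

text \<open>The i-th pivot in [0, \<open>\<infinity>\<close>), counting from i = 0; almost surely
  there are infinitely many.\<close>

definition nth_pivot ::
  "((int \<times> int \<Rightarrow> real) \<Rightarrow> int \<Rightarrow> bool) \<Rightarrow> (int \<times> int \<Rightarrow> real) \<Rightarrow> nat \<Rightarrow> int" where
  "nth_pivot piv w i = int (enumerate {v. piv w (int v)} i)"

definition pivot_gap :: "((int \<times> int \<Rightarrow> real) \<Rightarrow> int \<Rightarrow> bool) \<Rightarrow> (int \<times> int \<Rightarrow> real) \<Rightarrow> real" where
  "pivot_gap piv w = real_of_int (nth_pivot piv w 1 - nth_pivot piv w 0)"

definition pivot_hops ::
  "int \<Rightarrow> ((int \<times> int \<Rightarrow> real) \<Rightarrow> int \<Rightarrow> bool) \<Rightarrow> (int \<times> int \<Rightarrow> real) \<Rightarrow> real" where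
  "pivot_hops l piv w = real (hops l w (nth_pivot piv w 0) (nth_pivot piv w 1))"

end

theory Submission
  imports Defs
begin

text \<open>Every geodesic joining two points on different sides of a pivot passes through it, and a geodesic
  between two pivots stays between them. Being a pivot is a finite list of requirements, each
  saying that a single edge is light or heavy. If the lists of two pivots u < x do not contradict
  each other, then the requirements of u on edges not lying to the left of x are among those of x,
  and symmetrically. Given a pivot at x, the configurations on its two sides are therefore
  independent, so the pairs (gap, hops) of successive pivots are i.i.d., with geometric tails.

  Let P and H be the gap and the hop number of a block, \<open>\<mu> = E H / E P\<close> and \<open>Y = H - \<mu> P\<close>. Up to an error
  with bounded fourth moment, the hop number between 0 and n minus \<open>\<mu> n\<close> is the sum S of the values of Y
  over the blocks starting before n. Whether a block starts before n depends only on earlier blocks,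
  so S has the moments of a martingale: its fourth moment is of order \<open>n\<^sup>2\<close>, which is
  summable after division by \<open>n\<^sup>4\<close>, and its squared distance in \<open>L\<^sup>2\<close> to the sum over the first
  \<open>n / E P\<close> blocks is Var Y times the mean deviation of the number of blocks, of order \<open>sqrt n\<close>. The
  latter sum obeys the classical central limit theorem.

  If Var Y vanished, the hop number between any two pivots would be \<open>\<mu>\<close> times their distance. Since all
  large distances occur, \<open>\<mu>\<close> would be a positive integer, but some pivots are joined by
  fewer edges than their distance.\<close>

section \<open>Paths of least weight\<close>

text \<open>In case B.2 all weights lie between m and 2m, so a jump over a vertex need not cost more
  than two edges through it, and a single vertex cannot force geodesics through itself. A pivot is
  therefore the foot of a ladder of k points spaced l apart, and the accumulated loss of jumping
  over all of them decides. The thresholds are tuned to this: (k + 1)(1 + 1/(k + 1)) = k + 2 = k(1 +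
  2/k), so k + 1 light edges weigh less than k heavy ones. The price is that ladders of different
  pivots can overlap and share restricted edges, so that a pivot at x constrains both of its sides
  at once; independence across x then rests on comparing the requirements of pivots edge by edge.

  Since a pivot is anchored at a fixed vertex while blocks sit at random positions, every statement
  about the first blocks is decomposed according to the list of their values, which fixes all
  positions. Regeneration is needed at deterministic vertices only, and no stopping times or
  conditional expectations occur. Fourth moments are used because second moments would give the
  non-summable order 1/n in the almost sure limit.\<close>

text \<open>Minimality is stated without the infimum: as there are countably many paths, this makes hop numbers
  measurable on all configurations, also on those with negative weights, where the infimum may be junk.\<close>

definition minpath :: "int \<Rightarrow> (int \<times> int \<Rightarrow> real) \<Rightarrow> int \<Rightarrow> int \<Rightarrow> int list \<Rightarrow> bool" where
  "minpath l w u v p \<longleftrightarrow> is_path l u v p \<and> (\<forall>q. is_path l u v q \<longrightarrow> path_weight w p \<le> path_weight w q)"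

definition mhops :: "int \<Rightarrow> (int \<times> int \<Rightarrow> real) \<Rightarrow> int \<Rightarrow> int \<Rightarrow> nat" where
  "mhops l w u v = (LEAST h. \<exists>p. minpath l w u v p \<and> h = length p - 1)"

section \<open>Weights, concatenation and contraction of paths\<close>

lemma adjacent_commute: "adjacent l x y = adjacent l y x"
  by (auto simp: adjacent_def)

lemma adjacent_iff: "adjacent l x y \<longleftrightarrow> x \<noteq> y \<and> \<bar>x - y\<bar> \<le> l"
  by (auto simp: adjacent_def edges_def)

lemma edge_weight_less: "x < y \<Longrightarrow> edge_weight w x y = w (x, y)"
  by (simp add: edge_weight_def)

lemma adjacent_edge: "adjacent l x y \<Longrightarrow> (min x y, max x y) \<in> edges l"
  by (auto simp: adjacent_def edges_def)

lemma path_weight_append: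
  "path_weight w (p @ x # q) = path_weight w (p @ [x]) + path_weight w (x # q)"
  by (induction p rule: induct_list012) (auto split: list.splits)

lemma path_weight_append_edge:
  "path_weight w (p @ x # y # q) =
     path_weight w (p @ [x]) + edge_weight w x y + path_weight w (y # q)"
  using path_weight_append[of w p x "y # q"] by simp

lemma is_path_append:
  "is_path l u v (p @ x # q) \<longleftrightarrow> is_path l u x (p @ [x]) \<and> is_path l x v (x # q)"
  by (auto simp: is_path_def successively_append_iff hd_append)

lemma is_path_Cons:
  "is_path l u v (x # y # q) \<longleftrightarrow> x = u \<and> adjacent l x y \<and> is_path l y v (y # q)"
  by (auto simp: is_path_def)

lemma is_path_single [simp]: "is_path l u v [x] \<longleftrightarrow> x = u \<and> x = v"
  by (auto simp: is_path_def)

lemma is_path_hd: "is_path l u v p \<Longrightarrow> \<exists>q. p = u # q"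
  by (cases p) (auto simp: is_path_def)

lemma is_path_append_edge:
  "is_path l u v (p @ x # y # q) \<longleftrightarrow>
     is_path l u x (p @ [x]) \<and> adjacent l x y \<and> is_path l y v (y # q)"
  using is_path_append[of l u v p x "y # q"] by (simp add: is_path_Cons)

lemma is_path_concat:
  assumes "is_path l u x p" "is_path l x v (x # q)"
  shows "is_path l u v (p @ q)" "path_weight w (p @ q) = path_weight w p + path_weight w (x # q)"
proof -
  have "p = butlast p @ [x]" using assms(1) by (auto simp: is_path_def)
  then have *: "p @ q = butlast p @ x # q" by (metis append.assoc append_Cons append_Nil)
  show "is_path l u v (p @ q)"
    using assms \<open>p = butlast p @ [x]\<close> by (metis * is_path_append)
  show "path_weight w (p @ q) = path_weight w p + path_weight w (x # q)"
    by (metis * path_weight_append \<open>p = butlast p @ [x]\<close>)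
qed

lemma is_path_edges_ge:
  assumes "\<forall>e\<in>edges l. c \<le> w e" "is_path l u v (p @ x # y # q)"
  shows "c \<le> edge_weight w x y"
  using assms adjacent_edge[of l x y] by (auto simp: is_path_append_edge edge_weight_def)

lemma path_weight_nonneg:
  assumes "\<forall>e\<in>edges l. 0 \<le> w e" "is_path l u v p"
  shows "0 \<le> path_weight w p"
  using assms(2)
proof (induction p arbitrary: u rule: induct_list012)
  case (3 x y zs)
  have "0 \<le> edge_weight w x y" using is_path_edges_ge[of l 0 w u v "[]"] assms(1) 3(3) by auto
  then show ?case using 3 by (auto simp: is_path_Cons)
qed auto

lemma is_path_rev: "is_path l u v (rev p) \<longleftrightarrow> is_path l v u p"
  by (auto simp: is_path_def hd_rev last_rev adjacent_commute cong: successively_cong)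

lemma is_path_exists:
  assumes "l \<ge> 1"
  shows "\<exists>p. is_path l u v p"
proof -
  have *: "\<exists>p. is_path l u (u + int n) p" for u n
  proof (induction n)
    case 0
    show ?case by (intro exI[of _ "[u]"]) auto
  next
    case (Suc n)
    then obtain p where p: "is_path l u (u + int n) p" by auto
    have "is_path l u (u + int (Suc n)) (p @ [u + int (Suc n)])"
      by (rule is_path_concat(1)[OF p]) (use assms in \<open>auto simp: is_path_Cons adjacent_iff\<close>)
    then show ?case by blast
  qed
  show ?thesis
  proof (cases "u \<le> v")
    case True
    then show ?thesis using *[of u "nat (v - u)"] by auto
  next
    case False
    then show ?thesis using *[of v "nat (u - v)"] is_path_rev[of l u v] by auto
  qed
qed

text \<open>Consecutive vertices with the same image are merged; the edge lost has nonnegative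
  weight. The maps in question are the clamps \<open>max x\<close> and \<open>min y\<close>.\<close>

lemma contract_path:
  assumes f: "\<And>a b. adjacent l a b \<Longrightarrow> f a \<noteq> f b \<Longrightarrow>
      adjacent l (f a) (f b) \<and> edge_weight w (f a) (f b) \<le> edge_weight w a b"
    and nn: "\<forall>e\<in>edges l. 0 \<le> w e" and p: "is_path l u v p"
  shows "\<exists>q. is_path l (f u) (f v) q \<and> path_weight w q \<le> path_weight w p \<and>
      length q \<le> length p \<and> set q \<subseteq> f ` set p"
  using p
proof (induction p arbitrary: u rule: induct_list012)
  case 1
  then show ?case by (simp add: is_path_def)
next
  case (2 x)
  then show ?case by (intro exI[of _ "[f u]"]) auto
next
  case (3 x y zs)
  then have xu: "x = u" and ad: "adjacent l u y" and "is_path l y v (y # zs)"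
    by (auto simp: is_path_Cons)
  then obtain q where q: "is_path l (f y) (f v) q" "path_weight w q \<le> path_weight w (y # zs)"
    "length q \<le> length (y # zs)" "set q \<subseteq> f ` set (y # zs)" using 3(2) by blast
  have e0: "0 \<le> edge_weight w u y"
    using nn adjacent_edge[OF ad] by (auto simp: edge_weight_def)
  show ?case
  proof (cases "f u = f y")
    case True
    then show ?thesis using q e0 xu by (intro exI[of _ q]) auto
  next
    case False
    obtain r where r: "q = f y # r" using is_path_hd[OF q(1)] by auto
    show ?thesis using f[OF ad False] q xu by (intro exI[of _ "f u # q"]) (auto simp: r is_path_Cons)
  qed
qed

text \<open>The closed walk cut out has nonnegative weight. Distinctness leaves finitely many
  candidates in a bounded interval and bounds their number of edges.\<close>

lemma loop_erasure:
  assumes nn: "\<forall>e\<in>edges l. 0 \<le> w e" and p: "is_path l u v p"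
  shows "\<exists>q. is_path l u v q \<and> path_weight w q \<le> path_weight w p \<and> length q \<le> length p \<and>
      set q \<subseteq> set p \<and> distinct q"
  using p
proof (induction "length p" arbitrary: p rule: less_induct)
  case less
  show ?case
  proof (cases "distinct p")
    case True
    then show ?thesis using less by (intro exI[of _ p]) auto
  next
    case False
    then obtain xs ys zs y where p: "p = xs @ [y] @ ys @ [y] @ zs"
      using not_distinct_decomp by blast
    have "is_path l u y (xs @ [y])" and b: "is_path l y v (y # ys @ y # zs)"
      using less(2) is_path_append[of l u v xs y "ys @ y # zs"] by (auto simp: p)
    moreover have "is_path l y y (y # ys @ [y])" "is_path l y v (y # zs)"
      using b is_path_append[of l y v "y # ys" y zs] by auto
    ultimately have q: "is_path l u v (xs @ y # zs)" and "0 \<le> path_weight w (y # ys @ [y])"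
      using path_weight_nonneg[OF nn] by (auto simp: is_path_append[of l u v])
    moreover have "path_weight w p =
        path_weight w (xs @ [y]) + path_weight w (y # ys @ [y]) + path_weight w (y # zs)"
      using path_weight_append[of w xs y "ys @ y # zs"] path_weight_append[of w "y # ys" y zs]
      by (simp add: p)
    ultimately have "path_weight w (xs @ y # zs) \<le> path_weight w p"
      by (simp add: path_weight_append[of w xs y zs])
    moreover obtain q where "is_path l u v q" "path_weight w q \<le> path_weight w (xs @ y # zs)"
        "length q \<le> length (xs @ y # zs)" "set q \<subseteq> set (xs @ y # zs)" "distinct q"
      using less(1)[of "xs @ y # zs"] q by (auto simp: p)
    ultimately show ?thesis by (intro exI[of _ q]) (auto simp: p)
  qed
qed

text \<open>Clamping a path to one side of such an x does not increase its weight.\<close>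

definition cutp :: "int \<Rightarrow> (int \<times> int \<Rightarrow> real) \<Rightarrow> int \<Rightarrow> bool" where
  "cutp l w x \<longleftrightarrow> (\<forall>p q. p < x \<and> x < q \<and> q - p \<le> l \<longrightarrow> w (p, x) \<le> w (p, q) \<and> w (x, q) \<le> w (p, q))"

lemma cutpD:
  assumes "cutp l w x" "p \<le> x" "x \<le> q" "q - p \<le> l"
  shows "p \<noteq> x \<Longrightarrow> w (p, x) \<le> w (p, q)" "x \<noteq> q \<Longrightarrow> w (x, q) \<le> w (p, q)"
  using assms by (cases "p = x"; cases "x = q"; auto simp: cutp_def)+

text \<open>Clamping to the right of x and then to the left of y fixes both endpoints, and the
  second clamp does not undo the first because x \<le> y.\<close>

lemma confine_path:
  assumes nn: "\<forall>e\<in>edges l. 0 \<le> w e" and p: "is_path l u v p"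
    and c: "cutp l w x" "cutp l w y" and uv: "x \<le> u" "u \<le> y" "x \<le> v" "v \<le> y"
  shows "\<exists>q. is_path l u v q \<and> path_weight w q \<le> path_weight w p \<and> length q \<le> length p \<and>
      set q \<subseteq> {x..y} \<and> distinct q"
proof -
  have "\<exists>q. is_path l (max x u) (max x v) q \<and> path_weight w q \<le> path_weight w p \<and>
      length q \<le> length p \<and> set q \<subseteq> max x ` set p"
    by (intro contract_path[OF _ nn p])
      (auto simp: adjacent_iff edge_weight_def max_def min_def intro!: cutpD[OF c(1)])
  then obtain q where q: "is_path l u v q" "path_weight w q \<le> path_weight w p"
      "length q \<le> length p" "set q \<subseteq> max x ` set p"
    using uv by (metis max.absorb2)
  have "\<exists>r. is_path l (min y u) (min y v) r \<and> path_weight w r \<le> path_weight w q \<and>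
      length r \<le> length q \<and> set r \<subseteq> min y ` set q"
    by (intro contract_path[OF _ nn q(1)])
      (auto simp: adjacent_iff edge_weight_def max_def min_def intro!: cutpD[OF c(2)])
  then obtain r where r: "is_path l u v r" "path_weight w r \<le> path_weight w q"
      "length r \<le> length q" "set r \<subseteq> min y ` set q"
    using uv by (metis min.absorb2)
  have s: "set r \<subseteq> {x..y}" using r(4) q(4) uv by fastforce
  obtain t where "is_path l u v t" "path_weight w t \<le> path_weight w r" "length t \<le> length r"
      "set t \<subseteq> set r" "distinct t"
    using loop_erasure[OF nn r(1)] by blast
  then show ?thesis using s r q by (intro exI[of _ t]) auto
qed

section \<open>Existence, locality and additivity of hop numbers\<close>

lemma mhops_le: "minpath l w u v p \<Longrightarrow> mhops l w u v \<le> length p - 1"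
  unfolding mhops_def by (rule Least_le) auto

lemma mhops_attained:
  assumes "minpath l w u v p"
  shows "\<exists>q. minpath l w u v q \<and> length q = Suc (mhops l w u v)"
proof -
  have "\<exists>q. minpath l w u v q \<and> mhops l w u v = length q - 1"
    unfolding mhops_def by (rule LeastI_ex) (use assms in auto)
  moreover have "length q \<noteq> 0" if "minpath l w u v q" for q
    using that by (auto simp: minpath_def is_path_def)
  ultimately show ?thesis by (metis Suc_pred' bot_nat_0.not_eq_extremum)
qed

text \<open>Between two cut points every path is dominated by a distinct one inside
  \<open>{x..y}\<close>, and there are finitely many of these.\<close>

lemma minpath_exists:
  assumes l: "l \<ge> 1" and nn: "\<forall>e\<in>edges l. 0 \<le> w e"
    and c: "cutp l w x" "cutp l w y" and uv: "x \<le> u" "u \<le> y" "x \<le> v" "v \<le> y"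
  shows "\<exists>p. minpath l w u v p"
proof -
  define S where "S = {p. is_path l u v p \<and> set p \<subseteq> {x..y} \<and> distinct p}"
  have "finite {p. set p \<subseteq> {x..y} \<and> distinct p}"
    by (rule finite_subset_distinct) auto
  then have fin: "finite S" by (rule rev_finite_subset) (auto simp: S_def)
  have conf: "\<exists>q\<in>S. path_weight w q \<le> path_weight w p" if "is_path l u v p" for p
    using confine_path[OF nn that c uv] by (auto simp: S_def)
  have "S \<noteq> {}" using conf is_path_exists[OF l, of u v] by blast
  then obtain p where "p \<in> S" "\<forall>q\<in>S. path_weight w p \<le> path_weight w q"
    using fin ex_min_if_finite[of "path_weight w ` S"] by (auto simp: not_less)
  then have "minpath l w u v p"
    using conf unfolding minpath_def by (metis (no_types, lifting) S_def mem_Collect_eq order_trans)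
  then show ?thesis by blast
qed

text \<open>Confinement keeps a path minimal and does not lengthen it, so a minimal path with the
  fewest edges remains one.\<close>

lemma confined_minpath:
  assumes l: "l \<ge> 1" and nn: "\<forall>e\<in>edges l. 0 \<le> w e"
    and c: "cutp l w x" "cutp l w y" and uv: "x \<le> u" "u \<le> y" "x \<le> v" "v \<le> y"
  shows "\<exists>p. minpath l w u v p \<and> length p = Suc (mhops l w u v) \<and> set p \<subseteq> {x..y} \<and> distinct p"
proof -
  obtain p where p: "minpath l w u v p" "length p = Suc (mhops l w u v)"
    using minpath_exists[OF assms] mhops_attained by blast
  then obtain q where q: "is_path l u v q" "path_weight w q \<le> path_weight w p"
      "length q \<le> length p" "set q \<subseteq> {x..y}" "distinct q"
    using confine_path[OF nn _ c uv, of p] by (auto simp: minpath_def)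
  have m: "minpath l w u v q" using p q by (auto simp: minpath_def intro: order_trans)
  then have "mhops l w u v \<le> length q - 1" by (rule mhops_le)
  moreover have "length q \<noteq> 0" using q by (auto simp: is_path_def)
  ultimately have "length q = Suc (mhops l w u v)" using p q by linarith
  then show ?thesis using m q by blast
qed

lemma mhops_bound:
  assumes "l \<ge> 1" "\<forall>e\<in>edges l. 0 \<le> w e"
    and "cutp l w x" "cutp l w y" and "x \<le> u" "u \<le> y" "x \<le> v" "v \<le> y"
  shows "int (mhops l w u v) \<le> y - x"
proof -
  obtain p where p: "length p = Suc (mhops l w u v)" "set p \<subseteq> {x..y}" "distinct p"
    using confined_minpath[OF assms] by blast
  have "length p \<le> card {x..y}" using p card_mono[of "{x..y}" "set p"]
    by (simp add: distinct_card)
  then show ?thesis using p by simp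
qed

lemma path_weight_cong:
  assumes "\<And>a b. a \<in> set p \<Longrightarrow> b \<in> set p \<Longrightarrow> adjacent l a b \<Longrightarrow> edge_weight w a b = edge_weight w' a b"
    and "is_path l u v p"
  shows "path_weight w p = path_weight w' p"
  using assms by (induction p arbitrary: u rule: induct_list012) (auto simp: is_path_Cons)

text \<open>The optimum for w' can be taken inside the interval, where both configurations give it
  the same weight, and every competitor for w can be confined to the interval too. This locality
  makes the hop number of a block independent of the weights outside it.\<close>

lemma mhops_cong_le:
  assumes l: "l \<ge> 1" and nn: "\<forall>e\<in>edges l. 0 \<le> w e" "\<forall>e\<in>edges l. 0 \<le> w' e"
    and c: "cutp l w x" "cutp l w y" and c': "cutp l w' x" "cutp l w' y"
    and uv: "x \<le> u" "u \<le> y" "x \<le> v" "v \<le> y"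
    and eq: "\<And>p q. (p, q) \<in> edges l \<Longrightarrow> x \<le> p \<Longrightarrow> q \<le> y \<Longrightarrow> w (p, q) = w' (p, q)"
  shows "mhops l w u v \<le> mhops l w' u v"
proof -
  obtain p where p: "minpath l w' u v p" "length p = Suc (mhops l w' u v)" "set p \<subseteq> {x..y}"
    using confined_minpath[OF l nn(2) c' uv] by blast
  have e: "path_weight w q = path_weight w' q" if "is_path l u v q" "set q \<subseteq> {x..y}" for q
  proof (rule path_weight_cong[OF _ that(1)])
    fix a b assume "a \<in> set q" "b \<in> set q" "adjacent l a b"
    then have "(min a b, max a b) \<in> edges l" "x \<le> min a b" "max a b \<le> y"
      using adjacent_edge that(2) by auto
    then show "edge_weight w a b = edge_weight w' a b" using eq by (auto simp: edge_weight_def)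
  qed
  have "minpath l w u v p" unfolding minpath_def
  proof (intro conjI allI impI)
    show pp: "is_path l u v p" using p by (simp add: minpath_def)
    fix q assume "is_path l u v q"
    then obtain r where r: "is_path l u v r" "path_weight w r \<le> path_weight w q" "set r \<subseteq> {x..y}"
      using confine_path[OF nn(1) _ c uv] by blast
    have "path_weight w p = path_weight w' p" "path_weight w r = path_weight w' r"
      using e r p pp by auto
    moreover have "path_weight w' p \<le> path_weight w' r" using p r by (auto simp: minpath_def)
    ultimately show "path_weight w p \<le> path_weight w q" using r by linarith
  qed
  then show ?thesis using mhops_le p(2) by fastforce
qed

lemma mhops_cong:
  assumes "l \<ge> 1" "\<forall>e\<in>edges l. 0 \<le> w e" "\<forall>e\<in>edges l. 0 \<le> w' e"
    and "cutp l w x" "cutp l w y" and "cutp l w' x" "cutp l w' y"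
    and "x \<le> u" "u \<le> y" "x \<le> v" "v \<le> y"
    and "\<And>p q. (p, q) \<in> edges l \<Longrightarrow> x \<le> p \<Longrightarrow> q \<le> y \<Longrightarrow> w (p, q) = w' (p, q)"
  shows "mhops l w u v = mhops l w' u v"
  using mhops_cong_le[of l w w' x y u v] mhops_cong_le[of l w' w x y u v] assms by fastforce

text \<open>Strictness forces every minimal path through x. If merely some minimal path met x, one
  with fewer edges could avoid it and hop numbers would not add up.\<close>

definition cuts :: "int \<Rightarrow> (int \<times> int \<Rightarrow> real) \<Rightarrow> int \<Rightarrow> int \<Rightarrow> int \<Rightarrow> bool" where
  "cuts l w u x v \<longleftrightarrow> (\<forall>p. is_path l u v p \<and> x \<notin> set p \<longrightarrow>
     (\<exists>q. is_path l u v q \<and> path_weight w q < path_weight w p))"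

text \<open>Cutting a minimal path with fewest edges at x gives minimal pieces, which bounds the sum
  from above; joining such paths for the two pieces gives a minimal path, which bounds it from
  below.\<close>

lemma mhops_add:
  assumes cut: "cuts l w u x v" and ex: "minpath l w u v p0" "minpath l w u x p1" "minpath l w x v p2"
  shows "mhops l w u v = mhops l w u x + mhops l w x v"
proof -
  obtain p where p: "minpath l w u v p" "length p = Suc (mhops l w u v)"
    using mhops_attained[OF ex(1)] by blast
  have "x \<in> set p" using cut p by (force simp: cuts_def minpath_def)
  then obtain a b where ab: "p = a @ x # b" by (meson split_list)
  have pp: "is_path l u x (a @ [x])" "is_path l x v (x # b)"
    using p ab is_path_append[of l u v a x b] by (auto simp: minpath_def)
  obtain q where q: "minpath l w u x q" "length q = Suc (mhops l w u x)"
    using mhops_attained[OF ex(2)] by blast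
  obtain r where r: "minpath l w x v r" "length r = Suc (mhops l w x v)"
    using mhops_attained[OF ex(3)] by blast
  obtain r' where r': "r = x # r'" using r is_path_hd[of l x v r] by (auto simp: minpath_def)
  have wp: "path_weight w p = path_weight w (a @ [x]) + path_weight w (x # b)"
    by (simp add: ab path_weight_append[of w a x b])
  have qr: "is_path l u v (q @ r')" "path_weight w (q @ r') = path_weight w q + path_weight w r"
    using is_path_concat[of l u x q v r'] q r by (auto simp: minpath_def r')
  have le: "path_weight w q \<le> path_weight w (a @ [x])" "path_weight w r \<le> path_weight w (x # b)"
      "path_weight w p \<le> path_weight w (q @ r')"
    using p q r pp qr by (auto simp: minpath_def)
  \<comment> \<open>The pieces of p weigh at least as much as q and r, the joined path at least as
    much as p, and both totals are additive; so equality holds throughout.\<close>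
  have eq: "path_weight w q = path_weight w (a @ [x])" "path_weight w r = path_weight w (x # b)"
      "path_weight w p = path_weight w (q @ r')"
    using le wp qr by linarith+
  have m: "minpath l w u x (a @ [x])" "minpath l w x v (x # b)" "minpath l w u v (q @ r')"
    using p q r pp qr eq by (auto simp: minpath_def)
  have "mhops l w u x \<le> length a" "mhops l w x v \<le> length b" "mhops l w u v \<le> length (q @ r') - 1"
    using mhops_le[OF m(1)] mhops_le[OF m(2)] mhops_le[OF m(3)] by auto
  then show ?thesis using p q r ab r' by auto
qed

lemma mhops_pos:
  assumes "minpath l w u v p" "u \<noteq> v"
  shows "0 < mhops l w u v"
proof -
  obtain q where q: "minpath l w u v q" "length q = Suc (mhops l w u v)"
    using mhops_attained[OF assms(1)] by blast
  have "length q \<noteq> 1" using q(1) assms(2) by (auto simp: minpath_def is_path_def length_Suc_conv)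
  then show ?thesis using q(2) by auto
qed

text \<open>Nonnegative weights bound the path weights below, so that \<open>passage_time\<close> is
  a true infimum and attaining it means being minimal.\<close>

lemma geodesic_iff_minpath:
  assumes "\<forall>e\<in>edges l. 0 \<le> w e"
  shows "geodesic l w u v p \<longleftrightarrow> minpath l w u v p"
proof -
  have b: "bdd_below (path_weight w ` {p. is_path l u v p})"
    using path_weight_nonneg[OF assms] by (intro bdd_belowI[of _ 0]) auto
  show ?thesis
  proof
    assume "geodesic l w u v p"
    then show "minpath l w u v p"
      by (auto simp: geodesic_def minpath_def passage_time_def intro!: cINF_lower2[OF b])
  next
    assume m: "minpath l w u v p"
    then have "(INF p\<in>{p. is_path l u v p}. path_weight w p) = path_weight w p"
      by (intro antisym cINF_lower[OF b] cINF_greatest) (auto simp: minpath_def)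
    then show "geodesic l w u v p" using m by (auto simp: geodesic_def minpath_def passage_time_def)
  qed
qed

lemma hops_eq_mhops: "\<forall>e\<in>edges l. 0 \<le> w e \<Longrightarrow> hops l w u v = mhops l w u v"
  unfolding hops_def mhops_def by (simp add: geodesic_iff_minpath)

section \<open>Translation of configurations and restriction to edges\<close>

definition shift_config :: "int \<Rightarrow> (int \<times> int \<Rightarrow> real) \<Rightarrow> int \<times> int \<Rightarrow> real" where
  "shift_config x w = (\<lambda>(p, q). w (p + x, q + x))"

lemma is_path_shift: "is_path l (u + x) (v + x) (map (\<lambda>z. z + x) p) \<longleftrightarrow> is_path l u v p"
  by (auto simp: is_path_def hd_map last_map successively_map adjacent_iff)

lemma path_weight_shift: "path_weight (shift_config x w) p = path_weight w (map (\<lambda>z. z + x) p)"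
  by (induction p rule: induct_list012)
    (auto simp: shift_config_def edge_weight_def min_def max_def)

lemma minpath_shift:
  "minpath l (shift_config x w) u v p \<longleftrightarrow> minpath l w (u + x) (v + x) (map (\<lambda>z. z + x) p)"
proof -
  have "(\<forall>q. is_path l u v q \<longrightarrow> c \<le> path_weight w (map (\<lambda>z. z + x) q)) \<longleftrightarrow>
     (\<forall>q. is_path l (u + x) (v + x) q \<longrightarrow> c \<le> path_weight w q)" for c
  proof (intro iffI allI impI)
    fix q assume "\<forall>q. is_path l u v q \<longrightarrow> c \<le> path_weight w (map (\<lambda>z. z + x) q)"
      "is_path l (u + x) (v + x) q"
    then show "c \<le> path_weight w q"
      using is_path_shift[of l u x v "map (\<lambda>z. z - x) q"]
      by (auto simp: comp_def dest!: spec[of _ "map (\<lambda>z. z - x) q"])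
  qed (auto simp: is_path_shift)
  then show ?thesis by (simp add: minpath_def path_weight_shift is_path_shift)
qed

lemma mhops_shift: "mhops l (shift_config x w) u v = mhops l w (u + x) (v + x)"
proof -
  have "(\<exists>p. minpath l (shift_config x w) u v p \<and> h = length p - 1) \<longleftrightarrow>
    (\<exists>p. minpath l w (u + x) (v + x) p \<and> h = length p - 1)" for h
  proof
    assume "\<exists>p. minpath l w (u + x) (v + x) p \<and> h = length p - 1"
    then obtain p where "minpath l w (u + x) (v + x) p \<and> h = length p - 1" by blast
    then show "\<exists>p. minpath l (shift_config x w) u v p \<and> h = length p - 1"
      by (intro exI[of _ "map (\<lambda>z. z - x) p"]) (auto simp: minpath_shift comp_def)
  next
    assume "\<exists>p. minpath l (shift_config x w) u v p \<and> h = length p - 1"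
    then obtain p where "minpath l (shift_config x w) u v p \<and> h = length p - 1" by blast
    then show "\<exists>p. minpath l w (u + x) (v + x) p \<and> h = length p - 1"
      by (intro exI[of _ "map (\<lambda>z. z + x) p"]) (auto simp: minpath_shift)
  qed
  then show ?thesis unfolding mhops_def by simp
qed

lemma minpath_cong:
  assumes "\<forall>e\<in>edges l. w e = w' e"
  shows "minpath l w u v p \<longleftrightarrow> minpath l w' u v p"
proof -
  have "path_weight w q = path_weight w' q" if "is_path l u v q" for q
    by (rule path_weight_cong[OF _ that]) (use assms adjacent_edge in \<open>auto simp: edge_weight_def\<close>)
  then show ?thesis by (auto simp: minpath_def)
qed

lemma mhops_cong_edges: "\<forall>e\<in>edges l. w e = w' e \<Longrightarrow> mhops l w u v = mhops l w' u v"
  unfolding mhops_def using minpath_cong[of l w w' u v] by simp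

section \<open>Pivots\<close>

text \<open>The common shape of both kinds of pivots. The restricted edges are given relative to the
  vertex, which makes the notion translation invariant; all of regeneration is proved for this
  shape.\<close>

definition pivot_at ::
  "(int \<times> int) set \<Rightarrow> (int \<times> int) set \<Rightarrow> real set \<Rightarrow> real set \<Rightarrow> (int \<times> int \<Rightarrow> real) \<Rightarrow> int \<Rightarrow> bool" where
  "pivot_at A B Lt Hv w x \<longleftrightarrow>
     (\<forall>(p, q)\<in>A. w (p + x, q + x) \<in> Lt) \<and> (\<forall>(p, q)\<in>B. w (p + x, q + x) \<in> Hv)"

text \<open>m is an almost sure lower bound of the weights: 0 in case B.1, the infimum of the
  support in case B.2, where the comparison of path weights uses it.\<close>

definition good :: "int \<Rightarrow> real \<Rightarrow> (int \<times> int \<Rightarrow> real) \<Rightarrow> bool" where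
  "good l m w \<longleftrightarrow> (\<forall>e\<in>edges l. m \<le> w e)"

text \<open>A and B are the edges required to be light and heavy for a pivot at 0. The assumption \<open>compat\<close> is the
  dichotomy behind regeneration: pivots at 0 and d contradict each other, or each fulfils those
  requirements of the other that reach across it. A pivot x is a cut vertex only for endpoints beyond \<open>x + K\<close>
  or at another pivot.\<close>

locale cut_structure =
  fixes l :: int and A B :: "(int \<times> int) set" and Lt Hv :: "real set" and m :: real and K :: int
  assumes l2: "l \<ge> 2" and finite_A: "finite A" and finite_B: "finite B"
    and A_edges: "A \<subseteq> edges l" and B_edges: "B \<subseteq> edges l" and AB_disjoint: "A \<inter> B = {}"
    and LH_disjoint: "Lt \<inter> Hv = {}" and Lt_meas [measurable]: "Lt \<in> sets borel"
    and Hv_meas [measurable]: "Hv \<in> sets borel" and m_nonneg: "m \<ge> 0" and K_nonneg: "K \<ge> 0"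
    and compat: "\<And>d. d > 0 \<Longrightarrow>
      (\<exists>(p, q)\<in>A. (p - d, q - d) \<in> B) \<or> (\<exists>(p, q)\<in>B. (p - d, q - d) \<in> A) \<or>
      (\<forall>(p, q)\<in>A. q > d \<longrightarrow> (p - d, q - d) \<in> A) \<and> (\<forall>(p, q)\<in>B. q > d \<longrightarrow> (p - d, q - d) \<in> B) \<and>
      (\<forall>(p, q)\<in>A. p + d < 0 \<longrightarrow> (p + d, q + d) \<in> A) \<and> (\<forall>(p, q)\<in>B. p + d < 0 \<longrightarrow> (p + d, q + d) \<in> B)"
    and pivot_cutp: "\<And>w x. good l m w \<Longrightarrow> pivot_at A B Lt Hv w x \<Longrightarrow> cutp l w x"
    and pivot_cuts: "\<And>w u x v. good l m w \<Longrightarrow> pivot_at A B Lt Hv w x \<Longrightarrow> u \<le> x \<Longrightarrow>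
      v \<ge> x + K \<or> v > x \<and> pivot_at A B Lt Hv w v \<Longrightarrow> cuts l w u x v"
    and short_block: "\<exists>v>0. \<exists>A' B'. finite A' \<and> finite B' \<and> A' \<subseteq> edges l \<and> B' \<subseteq> edges l \<and> A' \<inter> B' = {} \<and>
      (\<forall>w. good l m w \<and> (\<forall>e\<in>A'. w e \<in> Lt) \<and> (\<forall>e\<in>B'. w e \<in> Hv) \<longrightarrow>
        pivot_at A B Lt Hv w 0 \<and> pivot_at A B Lt Hv w v \<and> int (mhops l w 0 v) < v)"
begin

abbreviation "piv \<equiv> pivot_at A B Lt Hv"

text \<open>Each of the first two alternatives of \<open>compat\<close> would make some edge light
  for one pivot and heavy for the other, against the disjointness of Lt and Hv.\<close>

lemma no_conflict:
  assumes "piv w u" "piv w x" "u < x"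
  shows "(\<forall>(p, q)\<in>A. q > x - u \<longrightarrow> (p - (x - u), q - (x - u)) \<in> A) \<and>
    (\<forall>(p, q)\<in>B. q > x - u \<longrightarrow> (p - (x - u), q - (x - u)) \<in> B) \<and>
    (\<forall>(p, q)\<in>A. p + (x - u) < 0 \<longrightarrow> (p + (x - u), q + (x - u)) \<in> A) \<and>
    (\<forall>(p, q)\<in>B. p + (x - u) < 0 \<longrightarrow> (p + (x - u), q + (x - u)) \<in> B)"
proof -
  have n1: "\<not> (\<exists>(p, q)\<in>A. (p - (x - u), q - (x - u)) \<in> B)"
  proof
    assume "\<exists>(p, q)\<in>A. (p - (x - u), q - (x - u)) \<in> B"
    then obtain p q where "(p, q) \<in> A" "(p - (x - u), q - (x - u)) \<in> B" by auto
    then have "w (p + u, q + u) \<in> Lt" "w (p - (x - u) + x, q - (x - u) + x) \<in> Hv"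
      using assms by (auto simp: pivot_at_def)
    then show False using LH_disjoint by (auto simp: algebra_simps)
  qed
  have n2: "\<not> (\<exists>(p, q)\<in>B. (p - (x - u), q - (x - u)) \<in> A)"
  proof
    assume "\<exists>(p, q)\<in>B. (p - (x - u), q - (x - u)) \<in> A"
    then obtain p q where "(p, q) \<in> B" "(p - (x - u), q - (x - u)) \<in> A" by auto
    then have "w (p + u, q + u) \<in> Hv" "w (p - (x - u) + x, q - (x - u) + x) \<in> Lt"
      using assms by (auto simp: pivot_at_def)
    then show False using LH_disjoint by (auto simp: algebra_simps)
  qed
  have "0 < x - u" using assms(3) by simp
  from compat[OF this] show ?thesis by (simp only: n1 n2 simp_thms)
qed

text \<open>A requirement of u concerns an edge on which the configurations agree, or it is
  literally a requirement of the pivot x, which w' satisfies.\<close>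

lemma pivot_transfer:
  assumes x: "piv w' x" and u: "piv w u"
    and A: "\<And>p q. (p, q) \<in> A \<Longrightarrow> w (p + u, q + u) = w' (p + u, q + u) \<or> (p + (u - x), q + (u - x)) \<in> A"
    and B: "\<And>p q. (p, q) \<in> B \<Longrightarrow> w (p + u, q + u) = w' (p + u, q + u) \<or> (p + (u - x), q + (u - x)) \<in> B"
  shows "piv w' u"
  unfolding pivot_at_def
proof (intro conjI ballI; clarify)
  fix p q assume "(p, q) \<in> A"
  with A[OF this] u x show "w' (p + u, q + u) \<in> Lt"
    by (force simp: pivot_at_def)
next
  fix p q assume "(p, q) \<in> B"
  with B[OF this] u x show "w' (p + u, q + u) \<in> Hv"
    by (force simp: pivot_at_def)
qed

lemma AB_shift: "(p, q) \<in> A \<union> B \<Longrightarrow> (p + u, q + u) \<in> edges l"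
  using A_edges B_edges by (auto simp: edges_def)

text \<open>Edges ending at or before x carry the same weight in both; an edge ending beyond x that
  u restricts is restricted in the same way by x, by the first two parts of
  \<open>no_conflict\<close>.\<close>

lemma pivot_transfer_left:
  assumes x: "piv w x" "piv w' x" and u: "piv w u" "u < x"
    and eq: "\<And>p q. (p, q) \<in> edges l \<Longrightarrow> q \<le> x \<Longrightarrow> w (p, q) = w' (p, q)"
  shows "piv w' u"
proof (rule pivot_transfer[OF x(2) u(1)])
  note nc = no_conflict[OF u(1) x(1) u(2)]
  have neg: "p + (u - x) = p - (x - u)" for p by simp
  show "w (p + u, q + u) = w' (p + u, q + u) \<or> (p + (u - x), q + (u - x)) \<in> A" if "(p, q) \<in> A" for p q
    using eq[of "p + u" "q + u"] AB_shift[of p q u] nc that unfolding neg by (cases "q + u \<le> x") force+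
  show "w (p + u, q + u) = w' (p + u, q + u) \<or> (p + (u - x), q + (u - x)) \<in> B" if "(p, q) \<in> B" for p q
    using eq[of "p + u" "q + u"] AB_shift[of p q u] nc that unfolding neg by (cases "q + u \<le> x") force+
qed

text \<open>The mirror image: the last two parts of \<open>no_conflict\<close> treat the edges that
  start before x.\<close>

lemma pivot_transfer_right:
  assumes x: "piv w x" "piv w' x" and u: "piv w u" "x < u"
    and eq: "\<And>p q. (p, q) \<in> edges l \<Longrightarrow> x \<le> p \<Longrightarrow> w (p, q) = w' (p, q)"
  shows "piv w' u"
proof (rule pivot_transfer[OF x(2) u(1)])
  note nc = no_conflict[OF x(1) u(1) u(2)]
  show "w (p + u, q + u) = w' (p + u, q + u) \<or> (p + (u - x), q + (u - x)) \<in> A" if "(p, q) \<in> A" for p q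
    using eq[of "p + u" "q + u"] AB_shift[of p q u] nc that by (cases "x \<le> p + u") force+
  show "w (p + u, q + u) = w' (p + u, q + u) \<or> (p + (u - x), q + (u - x)) \<in> B" if "(p, q) \<in> B" for p q
    using eq[of "p + u" "q + u"] AB_shift[of p q u] nc that by (cases "x \<le> p + u") force+
qed

lemma good_nonneg: "good l m w \<Longrightarrow> \<forall>e\<in>edges l. 0 \<le> w e"
  using m_nonneg by (fastforce simp: good_def)

lemma mhops_le_pivots:
  assumes "good l m w" "piv w x" "piv w y" "x \<le> u" "u \<le> y" "x \<le> v" "v \<le> y"
  shows "int (mhops l w u v) \<le> y - x"
  using assms l2 by (intro mhops_bound[of l]) (auto simp: good_nonneg pivot_cutp)

lemma mhops_pivots_pos:
  assumes "good l m w" "piv w x" "piv w y" "x < y"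
  shows "0 < mhops l w x y"
  using minpath_exists[of l w x y x y] mhops_pos[of l w x y] assms l2
  by (auto simp: good_nonneg pivot_cutp)

text \<open>The outer pivots a and b supply the minimal paths whose existence additivity needs; x is
  the cut vertex.\<close>

lemma mhops_split:
  assumes g: "good l m w" and piv: "piv w a" "piv w x" "piv w b" and "a \<le> u" "u \<le> x" "v \<le> b"
    and v: "v \<ge> x \<and> v \<ge> x + K \<or> v > x \<and> piv w v"
  shows "mhops l w u v = mhops l w u x + mhops l w x v"
proof -
  have "cuts l w u x v" by (rule pivot_cuts) (use assms in auto)
  moreover have "\<exists>p. minpath l w u v p" "\<exists>p. minpath l w u x p" "\<exists>p. minpath l w x v p"
    by (rule minpath_exists[of l w a b]; use assms l2 in \<open>auto simp: good_nonneg pivot_cutp\<close>)+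
  ultimately show ?thesis using mhops_add by blast
qed

lemma mhops_same: "mhops l w x x = 0" if "good l m w"
proof -
  have "minpath l w x x [x]"
    using path_weight_nonneg[OF good_nonneg[OF that]] by (auto simp: minpath_def)
  then show ?thesis using mhops_le by fastforce
qed

end

section \<open>Pivots as cut vertices\<close>

lemma path_crossing:
  assumes "is_path l u v p" "u < x" "x < v" "x \<notin> set p"
  shows "\<exists>p1 s t p2. p = p1 @ s # t # p2 \<and> s < x \<and> x < t \<and> t - s \<le> l"
  using assms
proof (induction p arbitrary: u rule: induct_list012)
  case (3 a b zs)
  show ?case
  proof (cases "b < x")
    case True
    then have "\<exists>p1 s t p2. b # zs = p1 @ s # t # p2 \<and> s < x \<and> x < t \<and> t - s \<le> l"
      by (intro 3(2)) (use 3 in \<open>auto simp: is_path_Cons\<close>)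
    then show ?thesis by (metis append_Cons)
  next
    case False
    then show ?thesis using 3 by (intro exI[of _ "[]"]) (auto simp: is_path_Cons adjacent_iff)
  qed
qed (auto simp: is_path_def)

text \<open>The jump over x costs more than 2a, the detour through x over two light edges
  less.\<close>

lemma pivot1_cuts:
  assumes H: "\<And>p q. p < x \<Longrightarrow> x < q \<Longrightarrow> q - p \<le> l \<Longrightarrow> w (p, x) < a \<and> w (x, q) < a \<and> 2 * a < w (p, q)"
    and "u \<le> x" "x < v"
  shows "cuts l w u x v"
  unfolding cuts_def
proof (intro allI impI)
  fix p assume p: "is_path l u v p \<and> x \<notin> set p"
  then have "u \<noteq> x" using is_path_hd by fastforce
  then obtain p1 s t p2 where st: "p = p1 @ s # t # p2" "s < x" "x < t" "t - s \<le> l"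
    using path_crossing[of l u v p x] p assms by auto
  have "is_path l u v (p1 @ s # x # t # p2)"
    using p st by (auto simp: is_path_append_edge is_path_Cons adjacent_iff)
  moreover have "path_weight w (p1 @ s # x # t # p2) < path_weight w p"
    using H[of s t] st
    by (simp add: path_weight_append_edge edge_weight_less)
  ultimately show "\<exists>q. is_path l u v q \<and> path_weight w q < path_weight w p" by blast
qed

text \<open>The points \<open>z 0\<close>, ..., \<open>z (k - 1)\<close> form the ladder of the
  pivot. A path over the whole ladder makes k heavy jumps, against k + 1 light edges for walking
  along it; a path that joins the ladder at \<open>z j\<close> makes j heavy jumps and one further
  edge, against j + 1 light ones. \<open>ineq_through\<close> and \<open>ineq_into\<close> are these
  two comparisons.\<close>

locale pivot2_geometry =
  fixes l k x :: int and w :: "int \<times> int \<Rightarrow> real" and m lt hv :: real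
  assumes l1: "l \<ge> 1" and k2: "k \<ge> 2" and mw: "\<forall>e\<in>edges l. m \<le> w e" and m0: "0 \<le> m"
    and heavy: "\<And>i p q. 0 \<le> i \<Longrightarrow> i < k \<Longrightarrow> p < x + i * l \<Longrightarrow> x + i * l < q \<Longrightarrow> q - p \<le> l \<Longrightarrow> hv < w (p, q)"
    and light_in: "\<And>p. x - l < p \<Longrightarrow> p < x \<Longrightarrow> w (p, x) < lt"
    and light_mid: "\<And>i. 0 \<le> i \<Longrightarrow> i < k - 1 \<Longrightarrow> w (x + i * l, x + (i + 1) * l) < lt"
    and light_out: "\<And>q. x + (k - 1) * l < q \<Longrightarrow> q < x + k * l \<Longrightarrow> w (x + (k - 1) * l, q) < lt"
    and ineq_through: "(real_of_int k + 1) * lt \<le> real_of_int k * hv"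
    and ineq_into: "\<And>j. 1 \<le> j \<Longrightarrow> j < k \<Longrightarrow> (real_of_int j + 1) * lt \<le> real_of_int j * hv + m"
begin

abbreviation "z i \<equiv> x + i * l"

lemma nn: "\<forall>e\<in>edges l. 0 \<le> w e"
  using mw m0 by fastforce

lemma z_mono: "i \<le> j \<Longrightarrow> z i \<le> z j"
  using l1 by (simp add: mult_right_mono)

lemma light_path: "int n < k \<Longrightarrow> \<exists>r. is_path l x (z (int n)) r \<and> path_weight w r \<le> real n * lt"
proof (induction n)
  case 0
  show ?case by (intro exI[of _ "[x]"]) auto
next
  case (Suc n)
  then obtain r where r: "is_path l x (z (int n)) r" "path_weight w r \<le> real n * lt" by auto
  have e: "w (z (int n), z (int n + 1)) < lt" using Suc by (intro light_mid) auto
  have q: "is_path l (z (int n)) (z (int (Suc n))) (z (int n) # [z (int n + 1)])"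
    using l1 by (auto simp: is_path_Cons adjacent_iff algebra_simps)
  have "path_weight w (z (int n) # [z (int n + 1)]) < lt"
    using e l1 by (simp add: edge_weight_def min_def max_def algebra_simps)
  then show ?case using is_path_concat[OF r(1) q] r(2)
    by (intro exI[of _ "r @ [z (int n + 1)]"]) (auto simp: algebra_simps)
qed

text \<open>The jump over \<open>z (j - 1)\<close> ends strictly before \<open>z j\<close>, so that reaching \<open>z j\<close> costs one more edge.\<close>

lemma entering_weight:
  assumes "0 \<le> i" "i + int n < k" "is_path l t (z (i + int n)) p" "t < z i"
    and "\<And>i'. i \<le> i' \<Longrightarrow> i' < i + int n \<Longrightarrow> z i' \<notin> set p"
  shows "real n * hv + m \<le> path_weight w p"
  using assms
proof (induction n arbitrary: i t p)
  case 0
  then obtain q where q: "p = t # q" using is_path_hd by blast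
  have "q \<noteq> []" using q 0 by auto
  then obtain y q' where q': "q = y # q'" by (cases q) auto
  have "m \<le> edge_weight w t y" using is_path_edges_ge[of l m w t "z i" "[]" t y q'] mw 0 q q' by auto
  moreover have "0 \<le> path_weight w (y # q')"
    using path_weight_nonneg[of l w y "z i" "y # q'"] 0 mw m0 q q' by (fastforce simp: is_path_Cons)
  ultimately show ?case by (simp add: q q')
next
  case (Suc n)
  have "z i < z (i + int (Suc n))" using l1 by (simp add: algebra_simps add_pos_nonneg)
  moreover have "z i \<notin> set p" using Suc(6)[of i] by auto
  ultimately obtain p1 s t' p2 where d: "p = p1 @ s # t' # p2" "s < z i" "z i < t'" "t' - s \<le> l"
    using path_crossing[OF Suc(4,5)] by blast
  have ps: "is_path l t s (p1 @ [s])" "is_path l t' (z (i + int (Suc n))) (t' # p2)"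
    using Suc(4) by (auto simp: d is_path_append_edge)
  have "real n * hv + m \<le> path_weight w (t' # p2)"
  proof (rule Suc(1)[of "i + 1"])
    show "is_path l t' (z (i + 1 + int n)) (t' # p2)" using ps(2) by (simp add: algebra_simps)
    show "t' < z (i + 1)" using d by (simp add: algebra_simps)
    show "z i' \<notin> set (t' # p2)" if "i + 1 \<le> i'" "i' < i + 1 + int n" for i'
      using Suc(6)[of i'] that by (auto simp: d)
  qed (use Suc in auto)
  moreover have "hv < edge_weight w s t'"
    using heavy[of i s t'] d Suc(2,3) by (auto simp: edge_weight_def)
  moreover have "0 \<le> path_weight w (p1 @ [s])"
    using path_weight_nonneg[OF nn ps(1)] by simp
  ultimately show ?case by (simp add: d path_weight_append_edge algebra_simps)
qed

text \<open>An edge over \<open>z i\<close> ends before \<open>z (i + 1)\<close> because its length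
  is at most l, so the jumps over different ladder points are different edges. The last jump is
  singled out: the detour leaves the ladder at \<open>z (k - 1)\<close> and goes straight to its end
  t'.\<close>

lemma crossing_weight:
  assumes "0 \<le> i" "i + int n = k - 1" "is_path l t v p" "t < z i" "z (k - 1) < v"
    and "\<And>i'. i \<le> i' \<Longrightarrow> i' < k \<Longrightarrow> z i' \<notin> set p"
  shows "\<exists>p1 s t' p2. p = p1 @ s # t' # p2 \<and> s < z (k - 1) \<and> z (k - 1) < t' \<and> t' - s \<le> l \<and>
    real (Suc n) * hv \<le> path_weight w (p1 @ [s, t'])"
  using assms
proof (induction n arbitrary: i t p)
  case 0
  then have i: "i = k - 1" by simp
  obtain p1 s t' p2 where d: "p = p1 @ s # t' # p2" "s < z i" "z i < t'" "t' - s \<le> l"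
    using path_crossing[OF 0(3,4)] 0(5) 0(6)[of i] i k2 by auto
  have ps: "is_path l t s (p1 @ [s])"
    using 0(3) by (auto simp: d is_path_append_edge)
  have "hv < edge_weight w s t'"
    using heavy[of i s t'] d 0 by (auto simp: edge_weight_def)
  moreover have "0 \<le> path_weight w (p1 @ [s])"
    using path_weight_nonneg[OF nn ps(1)] by simp
  ultimately show ?case using d i
    by (intro exI[of _ p1] exI[of _ s] exI[of _ t'] exI[of _ p2])
      (auto simp: path_weight_append_edge[of w p1 s t' "[]"])
next
  case (Suc n)
  have "z i \<le> z (k - 1)" using Suc(3) by (intro z_mono) auto
  then obtain p1 s t' p2 where d: "p = p1 @ s # t' # p2" "s < z i" "z i < t'" "t' - s \<le> l"
    using path_crossing[OF Suc(4,5)] Suc(3,6) Suc(7)[of i] by auto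
  have ps: "is_path l t s (p1 @ [s])" "is_path l t' v (t' # p2)"
    using Suc(4) by (auto simp: d is_path_append_edge)
  have "\<exists>r1 s' t'' r2. t' # p2 = r1 @ s' # t'' # r2 \<and> s' < z (k - 1) \<and> z (k - 1) < t'' \<and> t'' - s' \<le> l \<and>
    real (Suc n) * hv \<le> path_weight w (r1 @ [s', t''])"
  proof (rule Suc(1)[of "i + 1"])
    show "t' < z (i + 1)" using d by (simp add: algebra_simps)
    show "z i' \<notin> set (t' # p2)" if "i + 1 \<le> i'" "i' < k" for i'
      using Suc(7)[of i'] that by (auto simp: d)
  qed (use Suc ps in auto)
  then obtain r1 s' t'' r2 where r: "t' # p2 = r1 @ s' # t'' # r2" "s' < z (k - 1)" "z (k - 1) < t''"
    "t'' - s' \<le> l" "real (Suc n) * hv \<le> path_weight w (r1 @ [s', t''])" by blast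
  obtain r1' where r1': "r1 @ [s', t''] = t' # r1'" using r(1) by (cases r1) auto
  have "path_weight w ((p1 @ s # r1) @ [s', t'']) =
      path_weight w (p1 @ [s]) + edge_weight w s t' + path_weight w (r1 @ [s', t''])"
    using path_weight_append_edge[of w p1 s t' r1'] by (simp add: r1')
  moreover have "hv < edge_weight w s t'"
    using heavy[of i s t'] d Suc(2,3) by (auto simp: edge_weight_def)
  moreover have "0 \<le> path_weight w (p1 @ [s])"
    using path_weight_nonneg[OF nn ps(1)] by simp
  ultimately have "real (Suc (Suc n)) * hv \<le> path_weight w ((p1 @ s # r1) @ [s', t''])"
    using r(5) by (simp add: algebra_simps)
  moreover have "p = (p1 @ s # r1) @ s' # t'' # r2" using r(1) d(1) by simp
  ultimately show ?case using r by blast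
qed

text \<open>A path avoiding x is rerouted from the start of its jump over x into x and up the
  ladder, until it rejoins the old path at a ladder point or behind the last jump. If v lay strictly
  between two ladder points, a single heavy jump to v could beat the way through x, hence the
  condition on v.\<close>

lemma pivot2_cuts:
  assumes ux: "u \<le> x" and v: "z (k - 1) < v \<or> (\<exists>i\<ge>1. i < k \<and> v = z i)"
  shows "cuts l w u x v"
  unfolding cuts_def
proof (intro allI impI)
  fix p assume p: "is_path l u v p \<and> x \<notin> set p"
  then have "u \<noteq> x" using is_path_hd by fastforce
  then have u: "u < x" using ux by simp
  show "\<exists>q. is_path l u v q \<and> path_weight w q < path_weight w p"
  proof (cases "\<exists>y\<in>set p. \<exists>i\<ge>1. i < k \<and> y = z i")
    case True
    \<comment> \<open>y is the ladder point other than x that the path meets earliest. All of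
      \<open>z 0\<close>, ..., \<open>z (j - 1)\<close> have been jumped over until then, and the
      path is left unchanged from y on.\<close>
    obtain p' y p'' where split: "p = p' @ y # p''" "\<exists>i\<ge>1. i < k \<and> y = z i"
        "\<forall>y'\<in>set p'. \<not> (\<exists>i\<ge>1. i < k \<and> y' = z i)"
      using split_list_first_prop[of p "\<lambda>y. \<exists>i\<ge>1. i < k \<and> y = z i"] True by blast
    obtain j where j: "j \<ge> 1" "j < k" "y = z j" using split(2) by blast
    have pth: "is_path l u y (p' @ [y])" "is_path l y v (y # p'')"
      using p is_path_append[of l u v p' y p''] by (auto simp: split(1))
    have inj: "z i = z i' \<longleftrightarrow> i = i'" for i i' using l1 by auto
    have notin: "z i \<notin> set (p' @ [y])" if i: "0 \<le> i" "i < j" for i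
    proof (cases "i = 0")
      case True
      then show ?thesis using p split(1) by auto
    next
      case False
      then have "1 \<le> i" "i < k" using i j by auto
      then have "z i \<notin> set p'" using split(3) by blast
      then show ?thesis using inj[of i j] i j by simp
    qed
    have "x \<notin> set (p' @ [y])" using notin[of 0] j by auto
    moreover have "x < y" using j l1 by auto
    ultimately obtain p1 s t p2 where d: "p' @ [y] = p1 @ s # t # p2" "s < x" "x < t" "t - s \<le> l"
      using path_crossing[OF pth(1) u] by blast
    have ps: "is_path l u s (p1 @ [s])" "is_path l t y (t # p2)"
      using pth(1) by (auto simp: d is_path_append_edge)
    have pw: "path_weight w (p' @ [y]) =
        path_weight w (p1 @ [s]) + edge_weight w s t + path_weight w (t # p2)"
      unfolding d by (rule path_weight_append_edge)
    have "real (nat (j - 1)) * hv + m \<le> path_weight w (t # p2)"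
    proof (rule entering_weight[of 1])
      show "is_path l t (z (1 + int (nat (j - 1)))) (t # p2)" using ps(2) j by simp
      show "t < z 1" using d by simp
      have sub: "set (t # p2) \<subseteq> set (p' @ [y])" unfolding d by auto
      show "z i' \<notin> set (t # p2)" if "1 \<le> i'" "i' < 1 + int (nat (j - 1))" for i'
        using notin[of i'] that j sub by fastforce
    qed (use j in auto)
    moreover have "hv < edge_weight w s t"
      using heavy[of 0 s t] d k2 by (auto simp: edge_weight_def)
    ultimately have lower: "path_weight w (p' @ [y]) > path_weight w (p1 @ [s]) + (real_of_int j * hv + m)"
      using j(1) by (simp add: pw algebra_simps)
    obtain r where r: "is_path l x y r" "path_weight w r \<le> real_of_int j * lt"
      using light_path[of "nat j"] j by auto
    obtain r' where r': "r = x # r'" using is_path_hd[OF r(1)] by blast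
    have "edge_weight w s x < lt" using light_in[of s] d by (auto simp: edge_weight_def)
    then have upper: "path_weight w (p1 @ s # r) \<le> path_weight w (p1 @ [s]) + (real_of_int j + 1) * lt"
      using r(2) by (simp add: r' path_weight_append_edge algebra_simps)
    have q: "is_path l u y (p1 @ s # r)"
      using ps r d by (auto simp: r' is_path_append_edge adjacent_iff)
    have "is_path l u v ((p1 @ s # r) @ p'')" "path_weight w ((p1 @ s # r) @ p'') =
        path_weight w (p1 @ s # r) + path_weight w (y # p'')"
      using is_path_concat[OF q pth(2)] by auto
    moreover have "path_weight w p = path_weight w (p' @ [y]) + path_weight w (y # p'')"
      by (simp add: split(1) path_weight_append[of w p' y p''])
    ultimately show ?thesis using lower upper ineq_into[OF j(1,2)]
      by (intro exI[of _ "(p1 @ s # r) @ p''"]) linarith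
  next
    case False
    \<comment> \<open>No ladder point is met, so the endpoint v is none either and must lie beyond
      the ladder.\<close>
    have "v \<in> set p" using p by (auto simp: is_path_def)
    then have v': "z (k - 1) < v" using v False by blast
    moreover have "x \<le> z (k - 1)" using l1 k2 by auto
    ultimately have "x < v" by linarith
    then obtain p1 s t p2 where d: "p = p1 @ s # t # p2" "s < x" "x < t" "t - s \<le> l"
      using path_crossing[of l u v p x] p u by blast
    have ps: "is_path l u s (p1 @ [s])" "is_path l t v (t # p2)"
      using p by (auto simp: d is_path_append_edge)
    have "\<exists>r1 s' t' r2. t # p2 = r1 @ s' # t' # r2 \<and> s' < z (k - 1) \<and> z (k - 1) < t' \<and> t' - s' \<le> l \<and>
      real (Suc (nat (k - 2))) * hv \<le> path_weight w (r1 @ [s', t'])"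
    proof (rule crossing_weight[of 1])
      show "t < z 1" using d by simp
      show "z i' \<notin> set (t # p2)" if "1 \<le> i'" "i' < k" for i'
        using False that by (auto simp: d)
    qed (use k2 ps v' in auto)
    then obtain r1 s' t' r2 where r: "t # p2 = r1 @ s' # t' # r2" "s' < z (k - 1)" "z (k - 1) < t'"
      "t' - s' \<le> l" "real (Suc (nat (k - 2))) * hv \<le> path_weight w (r1 @ [s', t'])" by blast
    have "hv < edge_weight w s t"
      using heavy[of 0 s t] d k2 by (auto simp: edge_weight_def)
    moreover have "path_weight w (t # p2) = path_weight w (r1 @ [s', t']) + path_weight w (t' # r2)"
      using path_weight_append[of w "r1 @ [s']" t' r2] by (simp add: r(1))
    moreover have "real (Suc (nat (k - 2))) = real_of_int k - 1" using k2 by simp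
    ultimately have lower: "path_weight w p >
        path_weight w (p1 @ [s]) + real_of_int k * hv + path_weight w (t' # r2)"
      using r(5) by (simp add: d path_weight_append_edge algebra_simps)
    obtain g where g: "is_path l x (z (k - 1)) g" "path_weight w g \<le> (real_of_int k - 1) * lt"
      using light_path[of "nat (k - 1)"] k2 by auto
    obtain g' where g': "g = x # g'" using is_path_hd[OF g(1)] by blast
    have rt: "is_path l t' v (t' # r2)"
      using ps(2) is_path_append_edge[of l t v r1 s' t' r2] by (simp add: r(1))
    have tl: "z (k - 1) < t'" "t' < z k" using r by (auto simp: algebra_simps)
    have e2: "edge_weight w (z (k - 1)) t' < lt"
      using light_out[OF tl] tl by (simp add: edge_weight_less)
    have q2: "is_path l (z (k - 1)) v (z (k - 1) # t' # r2)"
      using rt tl by (auto simp: is_path_Cons adjacent_iff algebra_simps)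
    have e1: "edge_weight w s x < lt" using light_in[of s] d by (auto simp: edge_weight_def)
    have q1: "is_path l u (z (k - 1)) (p1 @ s # g)"
      using ps g d by (auto simp: g' is_path_append_edge adjacent_iff)
    have upper: "path_weight w ((p1 @ s # g) @ t' # r2) \<le>
        path_weight w (p1 @ [s]) + (real_of_int k + 1) * lt + path_weight w (t' # r2)"
      using is_path_concat(2)[OF q1 q2] e1 e2 g(2)
      by (simp add: g' path_weight_append_edge algebra_simps)
    show ?thesis using is_path_concat(1)[OF q1 q2] lower upper ineq_through
      by (intro exI[of _ "(p1 @ s # g) @ t' # r2"]) linarith
  qed
qed

end

section \<open>The requirements of B.1 pivots\<close>

definition light1 :: "int \<Rightarrow> (int \<times> int) set" where
  "light1 l = {(p, q)\<in>edges l. q = 0 \<and> - l < p \<or> p = 0 \<and> q < l}"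

definition heavy1 :: "int \<Rightarrow> (int \<times> int) set" where
  "heavy1 l = {(p, q)\<in>edges l. p < 0 \<and> 0 < q}"

lemma finite_edges_window: "finite {(p, q)\<in>edges l. a \<le> p \<and> q \<le> b}"
  by (rule finite_subset[of _ "{a..b} \<times> {a..b}"]) (auto simp: edges_def)

lemma pivot1D:
  "pivot1 l a w x \<Longrightarrow> p < x \<Longrightarrow> x < q \<Longrightarrow> q - p \<le> l \<Longrightarrow> w (p, x) < a \<and> w (x, q) < a \<and> 2 * a < w (p, q)"
  unfolding pivot1_def by (drule spec[of _ p], drule spec[of _ q]) auto

text \<open>The joint condition on x and y decouples: for one neighbour, the other may be chosen
  next to v, at \<open>v + 1\<close> or \<open>v - 1\<close>. The total length is at most l exactly
  for edges at v shorter than l, so the edges of length l at v are unrestricted.\<close>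

lemma pivot1_iff:
  assumes "l \<ge> 2"
  shows "pivot1 l a w v \<longleftrightarrow> pivot_at (light1 l) (heavy1 l) {..<a} {2 * a<..} w v"
proof
  assume *: "pivot1 l a w v"
  have "w (x, v) < a" if "v - l < x" "x < v" for x
    using *[unfolded pivot1_def, rule_format, of x "v + 1"] that assms by auto
  moreover have "w (v, y) < a" if "y < v + l" "v < y" for y
    using *[unfolded pivot1_def, rule_format, of "v - 1" y] that assms by auto
  moreover have "2 * a < w (x, y)" if "x < v" "v < y" "y - x \<le> l" for x y
    using * that unfolding pivot1_def by auto
  ultimately show "pivot_at (light1 l) (heavy1 l) {..<a} {2 * a<..} w v"
    by (auto simp: pivot_at_def light1_def heavy1_def edges_def)
next
  assume *: "pivot_at (light1 l) (heavy1 l) {..<a} {2 * a<..} w v"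
  show "pivot1 l a w v" unfolding pivot1_def
  proof (intro allI impI)
    fix x y assume xy: "x < v \<and> v < y \<and> 2 \<le> y - x \<and> y - x \<le> l"
    then have "(x - v, 0) \<in> light1 l" "(0, y - v) \<in> light1 l" "(x - v, y - v) \<in> heavy1 l"
      by (auto simp: light1_def heavy1_def edges_def)
    then show "w (x, v) < a \<and> w (v, y) < a \<and> w (x, y) > 2 * a"
      using * by (force simp: pivot_at_def)
  qed
qed

text \<open>At distance d < l - 1 two pivots contradict each other: the edge (0, d + 1) is light for
  the one at 0 and jumps over the one at d. From distance l - 1 on no requirement of either reaches
  beyond the other. K = 0, as a pivot cuts off every endpoint to its right.\<close>

lemma pivot1_structure:
  assumes l: "l \<ge> 2" and a: "a > 0"
  shows "cut_structure l (light1 l) (heavy1 l) {..<a} {2 * a<..} 0 0"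
proof
  show "finite (light1 l)" "finite (heavy1 l)"
    by (rule finite_subset[OF _ finite_edges_window[of l "- l" l]];
        force simp: light1_def heavy1_def edges_def)+
  show "light1 l \<subseteq> edges l" "heavy1 l \<subseteq> edges l" "light1 l \<inter> heavy1 l = {}"
    by (auto simp: light1_def heavy1_def)
  show "{..<a} \<inter> {2 * a<..} = {}" using a by auto
  fix d :: int assume d: "d > 0"
  show "(\<exists>(p, q)\<in>light1 l. (p - d, q - d) \<in> heavy1 l) \<or>
      (\<exists>(p, q)\<in>heavy1 l. (p - d, q - d) \<in> light1 l) \<or>
      (\<forall>(p, q)\<in>light1 l. q > d \<longrightarrow> (p - d, q - d) \<in> light1 l) \<and>
      (\<forall>(p, q)\<in>heavy1 l. q > d \<longrightarrow> (p - d, q - d) \<in> heavy1 l) \<and>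
      (\<forall>(p, q)\<in>light1 l. p + d < 0 \<longrightarrow> (p + d, q + d) \<in> light1 l) \<and>
      (\<forall>(p, q)\<in>heavy1 l. p + d < 0 \<longrightarrow> (p + d, q + d) \<in> heavy1 l)"
  proof (cases "d < l - 1")
    case True
    then have "(0, d + 1) \<in> light1 l" "(0 - d, d + 1 - d) \<in> heavy1 l"
      using d by (auto simp: light1_def heavy1_def edges_def)
    then show ?thesis by blast
  next
    case False
    then show ?thesis by (auto simp: light1_def heavy1_def edges_def)
  qed
next
  fix w :: "int \<times> int \<Rightarrow> real" and x :: int
  assume "pivot_at (light1 l) (heavy1 l) {..<a} {2 * a<..} w x"
  then have "pivot1 l a w x" using pivot1_iff[OF l] by blast
  note H = pivot1D[OF this]
  show "cutp l w x" unfolding cutp_def using H a by force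
  fix u v assume "u \<le> x" "x + 0 \<le> v \<or> x < v \<and> pivot_at (light1 l) (heavy1 l) {..<a} {2 * a<..} w v"
  show "cuts l w u x v"
  proof (cases "v = x")
    case True
    then show ?thesis by (auto simp: cuts_def is_path_def)
  next
    case False
    then show ?thesis using H \<open>u \<le> x\<close> \<open>x + 0 \<le> v \<or> _\<close> by (intro pivot1_cuts) auto
  qed
next
  \<comment> \<open>The short block goes from 0 to l + 1: in a window around it the edges meeting 0
    or l + 1 are light and all others heavy. The path 0, 2, l + 1 has two edges, fewer than l + 1
    \<ge> 3.\<close>
  let ?win = "{(p, q)\<in>edges l. - l \<le> p \<and> q \<le> 2 * l + 1}"
  define A' where "A' = {(p, q)\<in>?win. p = 0 \<or> p = l + 1 \<or> q = 0 \<or> q = l + 1}"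
  define B' where "B' = {(p, q)\<in>?win. \<not> (p = 0 \<or> p = l + 1 \<or> q = 0 \<or> q = l + 1)}"
  have "finite A'" "finite B'" "A' \<subseteq> edges l" "B' \<subseteq> edges l" "A' \<inter> B' = {}"
    by (auto simp: A'_def B'_def intro: rev_finite_subset[OF finite_edges_window[of l "-l" "2 * l + 1"]])
  moreover have "pivot_at (light1 l) (heavy1 l) {..<a} {2 * a<..} w 0 \<and>
      pivot_at (light1 l) (heavy1 l) {..<a} {2 * a<..} w (l + 1) \<and> int (mhops l w 0 (l + 1)) < l + 1"
    if g: "good l 0 w" and w: "\<forall>e\<in>A'. w e \<in> {..<a}" "\<forall>e\<in>B'. w e \<in> {2 * a<..}" for w
  proof -
    have wA: "w (p, q) < a" if "p = 0 \<or> p = l + 1 \<or> q = 0 \<or> q = l + 1" "1 \<le> q - p" "q - p \<le> l"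
        "- l \<le> p" "q \<le> 2 * l + 1" for p q
      using w(1) that by (auto simp: A'_def edges_def)
    have wB: "2 * a < w (p, q)" if "p \<noteq> 0" "p \<noteq> l + 1" "q \<noteq> 0" "q \<noteq> l + 1" "1 \<le> q - p" "q - p \<le> l"
        "- l \<le> p" "q \<le> 2 * l + 1" for p q
      using w(2) that by (auto simp: B'_def edges_def)
    have p0: "pivot1 l a w 0" "pivot1 l a w (l + 1)"
      unfolding pivot1_def by (auto intro!: wA wB)
    have cutp: "cutp l w x" if "pivot1 l a w x" for x
    proof -
      note H = pivot1D[OF that]
      show "cutp l w x" unfolding cutp_def using H a by force
    qed
    have nn: "\<forall>e\<in>edges l. 0 \<le> w e" using g by (simp add: good_def)
    obtain p where p: "minpath l w 0 (l + 1) p" "length p = Suc (mhops l w 0 (l + 1))"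
        "set p \<subseteq> {0..l + 1}" "distinct p"
      using confined_minpath[OF _ nn cutp[OF p0(1)] cutp[OF p0(2)], of 0 "l + 1"] l by auto
    have "mhops l w 0 (l + 1) \<le> 2"
    proof (rule ccontr)
      assume "\<not> mhops l w 0 (l + 1) \<le> 2"
      then have "length p \<ge> 4" using p by simp
      \<comment> \<open>With at least three edges the second one, from x to y, is an inner edge: as
        p is distinct, neither endpoint is 0 or l + 1. Being heavy, it alone outweighs the path
        through 2.\<close>
      then obtain s x y t r where r: "p = s # x # y # t # r"
        by (auto simp: numeral_eq_Suc Suc_le_length_iff)
      have pp: "is_path l 0 (l + 1) p" using p by (simp add: minpath_def)
      have "s = 0" "last (t # r) = l + 1" using pp by (simp_all add: r is_path_def)
      moreover from this(2) have "l + 1 \<in> set (t # r)" by (metis last_in_set list.distinct(1))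
      ultimately have xy: "x \<noteq> 0" "y \<noteq> 0" "x \<noteq> l + 1" "y \<noteq> l + 1" "adjacent l x y" "adjacent l s x"
          "is_path l y (l + 1) (y # t # r)" "0 \<le> x" "0 \<le> y" "x \<le> l + 1" "y \<le> l + 1"
        using p pp by (auto simp: r is_path_Cons)
      have "2 * a < edge_weight w x y"
        unfolding edge_weight_def using xy l by (intro wB) (auto simp: adjacent_iff min_def max_def)
      moreover have "0 \<le> path_weight w (y # t # r)" using path_weight_nonneg[OF nn xy(7)] .
      moreover have "0 \<le> edge_weight w s x"
        using nn adjacent_edge[OF xy(6)] by (auto simp: edge_weight_def)
      ultimately have "2 * a < path_weight w p" by (simp add: r)
      moreover have "is_path l 0 (l + 1) [0, 2, l + 1]" using l by (auto simp: is_path_Cons adjacent_iff)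
      then have "path_weight w p \<le> path_weight w [0, 2, l + 1]" using p by (auto simp: minpath_def)
      moreover have "w (0, 2) < a" "w (2, l + 1) < a" using l by (auto intro!: wA)
      ultimately show False using l by (simp add: edge_weight_def)
    qed
    then show ?thesis using p0 l by (simp add: pivot1_iff)
  qed
  ultimately show "\<exists>v>0. \<exists>A' B'. finite A' \<and> finite B' \<and> A' \<subseteq> edges l \<and> B' \<subseteq> edges l \<and> A' \<inter> B' = {} \<and>
      (\<forall>w. good l 0 w \<and> (\<forall>e\<in>A'. w e \<in> {..<a}) \<and> (\<forall>e\<in>B'. w e \<in> {2 * a<..}) \<longrightarrow>
        pivot_at (light1 l) (heavy1 l) {..<a} {2 * a<..} w 0 \<and>
        pivot_at (light1 l) (heavy1 l) {..<a} {2 * a<..} w v \<and> int (mhops l w 0 v) < v)"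
    using l by (intro exI[of _ "l + 1"] conjI exI[of _ A'] exI[of _ B']) auto
qed (use l in auto)

section \<open>The requirements of B.2 pivots and their relative position\<close>

definition light2 :: "int \<Rightarrow> int \<Rightarrow> (int \<times> int) set" where
  "light2 l k = {(p, q)\<in>edges l - {(- l, 0), ((k - 1) * l, k * l)}. p \<in> pivot_set l k 0 \<or> q \<in> pivot_set l k 0}"

definition heavy2 :: "int \<Rightarrow> int \<Rightarrow> (int \<times> int) set" where
  "heavy2 l k = {(p, q)\<in>edges l. \<exists>z\<in>pivot_set l k 0. p < z \<and> z < q}"

lemma pivot_set_iff: "z \<in> pivot_set l k x \<longleftrightarrow> (\<exists>i. 0 \<le> i \<and> i < k \<and> z = x + i * l)"
  by (auto simp: pivot_set_def)

lemma pivot_set_shift: "z + x \<in> pivot_set l k x \<longleftrightarrow> z \<in> pivot_set l k 0"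
  by (auto simp: pivot_set_iff)

lemma pivot2_iff:
  "pivot2 l k (\<lambda>e. w e / m) x \<longleftrightarrow>
     pivot_at (light2 l k) (heavy2 l k) {t. light k (t / m)} {t. heavy k (t / m)} w x"
proof
  assume *: "pivot2 l k (\<lambda>e. w e / m) x"
  show "pivot_at (light2 l k) (heavy2 l k) {t. light k (t / m)} {t. heavy k (t / m)} w x"
    unfolding pivot_at_def
  proof (intro conjI ballI; clarify)
    fix p q assume pq: "(p, q) \<in> light2 l k"
    then have "(p + x, q + x) \<in> edges l - {(x - l, x), (x + (k - 1) * l, x + k * l)}"
      "p + x \<in> pivot_set l k x \<or> q + x \<in> pivot_set l k x"
      by (auto simp: light2_def edges_def pivot_set_shift)
    then show "light k (w (p + x, q + x) / m)" using * unfolding pivot2_def by blast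
  next
    fix p q assume pq: "(p, q) \<in> heavy2 l k"
    then obtain z where "z \<in> pivot_set l k 0" "p < z" "z < q" "(p, q) \<in> edges l" by (auto simp: heavy2_def)
    then have "(p + x, q + x) \<in> edges l" "\<exists>z\<in>pivot_set l k x. p + x < z \<and> z < q + x"
      by (auto simp: edges_def intro!: bexI[of _ "z + x"] simp: pivot_set_shift)
    then show "heavy k (w (p + x, q + x) / m)" using * unfolding pivot2_def by blast
  qed
next
  assume *: "pivot_at (light2 l k) (heavy2 l k) {t. light k (t / m)} {t. heavy k (t / m)} w x"
  have L: "light k (w (p, q) / m)" if "(p, q) \<in> edges l" "p \<in> pivot_set l k x \<or> q \<in> pivot_set l k x"
      "(p, q) \<notin> {(x - l, x), (x + (k - 1) * l, x + k * l)}" for p q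
  proof -
    from that have "(p - x, q - x) \<in> light2 l k"
      using pivot_set_shift[of "p - x" x l k] pivot_set_shift[of "q - x" x l k]
      by (auto simp: light2_def edges_def)
    then show "light k (w (p, q) / m)" using * by (force simp: pivot_at_def)
  qed
  have H: "heavy k (w (p, q) / m)" if "(p, q) \<in> edges l" "z \<in> pivot_set l k x" "p < z" "z < q" for p q z
  proof -
    from that have "(p - x, q - x) \<in> heavy2 l k"
      using pivot_set_shift[of "z - x" x l k] by (auto simp: heavy2_def edges_def intro!: bexI[of _ "z - x"])
    then show "heavy k (w (p, q) / m)" using * by (force simp: pivot_at_def)
  qed
  show "pivot2 l k (\<lambda>e. w e / m) x" unfolding pivot2_def using L H by blast
qed

text \<open>Write d = j * l + r. If r is not 0 and j < k, an edge from the ladder point j * l jumps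
  over d, the foot of the other ladder, and would be both light and heavy. For j < k - 1 it is the
  edge of length l; for j = k - 1 that edge is exempt and the shorter one to d + 1 takes its place,
  which is why d = k * l - 1 survives.\<close>

lemma pivot2_distance:
  fixes l k d :: int
  assumes l: "l \<ge> 2" and k: "k \<ge> 2" and d: "d > 0"
    and nc: "\<not> (\<exists>(p, q)\<in>light2 l k. (p - d, q - d) \<in> heavy2 l k)"
  shows "(\<exists>j. 1 \<le> j \<and> j < k \<and> d = j * l) \<or> k * l - 1 \<le> d"
proof (rule ccontr)
  assume neg: "\<not> ?thesis"
  define j r where "j = d div l" and "r = d mod l"
  have dj: "d = j * l + r" "0 \<le> r" "r < l" "0 \<le> j"
    using l d by (auto simp: j_def r_def pos_imp_zdiv_nonneg_iff)
  have "j * l < k * l" using dj neg d by linarith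
  then have jk: "j < k" using l by (simp add: mult_less_cancel_right)
  have r: "r \<noteq> 0"
  proof
    assume "r = 0"
    then have "d = j * l" "1 \<le> j" using dj d by (auto simp: zero_less_mult_iff)
    then show False using neg jk by blast
  qed
  have z0: "0 \<in> pivot_set l k 0" using k by (auto simp: pivot_set_iff intro!: exI[of _ 0])
  have zj: "j * l \<in> pivot_set l k 0" using dj jk by (auto simp: pivot_set_iff)
  show False
  proof (cases "j = k - 1")
    case False
    then have "j * l \<noteq> (k - 1) * l" using l by simp
    moreover have "j * l \<noteq> - l" using dj l by (smt (verit) mult_nonneg_nonneg)
    ultimately have "(j * l, j * l + l) \<in> light2 l k" using zj l by (auto simp: light2_def edges_def)
    moreover have "(j * l - d, j * l + l - d) \<in> heavy2 l k"
      using z0 dj r l by (auto simp: heavy2_def edges_def intro!: bexI[of _ 0])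
    ultimately show False using nc by blast
  next
    case True
    then have "d < (k - 1) * l + l - 1" using neg by (simp add: algebra_simps)
    then have rl: "r < l - 1" using dj True by simp
    moreover have "j * l \<noteq> - l" using dj l by (smt (verit) mult_nonneg_nonneg)
    ultimately have "(j * l, d + 1) \<in> light2 l k"
      using zj dj True by (auto simp: light2_def edges_def algebra_simps)
    moreover have "(j * l - d, d + 1 - d) \<in> heavy2 l k"
      using z0 dj r rl by (auto simp: heavy2_def edges_def intro!: bexI[of _ 0])
    ultimately show False using nc by blast
  qed
qed

text \<open>If d is a multiple of l, the ladders overlap, and a requirement reaching beyond d comes
  from a ladder point at or above d, which is common to both. If d \<ge> k * l - 1, the only edge at
  the first ladder reaching beyond d could be the exempt one. To the left of 0 nothing of the other
  pivot reaches, as d \<ge> l.\<close>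

lemma pivot2_compat:
  fixes l k d :: int
  assumes l: "l \<ge> 2" and k: "k \<ge> 2" and d: "(\<exists>j. 1 \<le> j \<and> j < k \<and> d = j * l) \<or> k * l - 1 \<le> d"
  shows "(\<forall>(p, q)\<in>light2 l k. q > d \<longrightarrow> (p - d, q - d) \<in> light2 l k) \<and>
      (\<forall>(p, q)\<in>heavy2 l k. q > d \<longrightarrow> (p - d, q - d) \<in> heavy2 l k) \<and>
      (\<forall>(p, q)\<in>light2 l k. p + d < 0 \<longrightarrow> (p + d, q + d) \<in> light2 l k) \<and>
      (\<forall>(p, q)\<in>heavy2 l k. p + d < 0 \<longrightarrow> (p + d, q + d) \<in> heavy2 l k)"
proof -
  have lk: "2 * l \<le> k * l" using k l by simp
  have ld: "l \<le> d"
    using d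
  proof
    assume "\<exists>j. 1 \<le> j \<and> j < k \<and> d = j * l"
    then obtain j where j: "1 \<le> j" "d = j * l" by blast
    then have "1 * l \<le> j * l" using l by (intro mult_right_mono) auto
    then show ?thesis using j by simp
  next
    assume "k * l - 1 \<le> d"
    then show ?thesis using lk l by linarith
  qed
  have Sb: "0 \<le> z \<and> z \<le> (k - 1) * l" if "z \<in> pivot_set l k 0" for z
    using that l by (auto simp: pivot_set_iff intro!: mult_right_mono)
  have kl: "(k - 1) * l = k * l - l" by (simp add: algebra_simps)
  have A: "(p - d, q - d) \<in> light2 l k" if pq: "(p, q) \<in> light2 l k" "q > d" for p q
  proof -
    have e: "1 \<le> q - p" "q - p \<le> l" "(p, q) \<noteq> ((k - 1) * l, k * l)"
        "p \<in> pivot_set l k 0 \<or> q \<in> pivot_set l k 0"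
      using pq by (auto simp: light2_def edges_def)
    from d show ?thesis
    proof
      assume "\<exists>j. 1 \<le> j \<and> j < k \<and> d = j * l"
      then obtain j where j: "1 \<le> j" "j < k" "d = j * l" by blast
      have "p - d \<in> pivot_set l k 0 \<or> q - d \<in> pivot_set l k 0"
        using e(4)
      proof
        assume "p \<in> pivot_set l k 0"
        then obtain i where i: "0 \<le> i" "i < k" "p = i * l" by (auto simp: pivot_set_iff)
        have "j * l < (i + 1) * l" using e pq(2) i j by (simp add: algebra_simps)
        then have "j \<le> i" using l by (simp add: mult_less_cancel_right)
        then show ?thesis using i j
          by (intro disjI1) (auto simp: pivot_set_iff algebra_simps intro!: exI[of _ "i - j"])
      next
        assume "q \<in> pivot_set l k 0"
        then obtain i where i: "0 \<le> i" "i < k" "q = i * l" by (auto simp: pivot_set_iff)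
        have "j * l < i * l" using pq(2) i j by simp
        then have "j \<le> i" using l by (simp add: mult_less_cancel_right)
        then show ?thesis using i j
          by (intro disjI2) (auto simp: pivot_set_iff algebra_simps intro!: exI[of _ "i - j"])
      qed
      \<comment> \<open>The exemption moves with the pivot: shifted back, the edge must not become
        the exempt one. The other exempt edge ends at 0 and is excluded by q > d.\<close>
      moreover have "(p - d, q - d) \<noteq> ((k - 1) * l, k * l)"
      proof
        assume "(p - d, q - d) = ((k - 1) * l, k * l)"
        then have "p > (k - 1) * l" "q > (k - 1) * l" using ld l by (auto simp: algebra_simps)
        then show False using e(4) Sb by fastforce
      qed
      ultimately show ?thesis using e pq(2) by (auto simp: light2_def edges_def)
    next
      assume dk: "k * l - 1 \<le> d"
      then have "q \<notin> pivot_set l k 0" using pq(2) Sb[of q] kl l by auto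
      then have "p \<le> (k - 1) * l" using e(4) Sb by auto
      then have "p = (k - 1) * l" "q = k * l" using e(2) pq(2) dk kl by auto
      then show ?thesis using e(3) by simp
    qed
  qed
  have B: "(p - d, q - d) \<in> heavy2 l k" if pq: "(p, q) \<in> heavy2 l k" "q > d" for p q
  proof -
    obtain i where i: "0 \<le> i" "i < k" "p < i * l" "i * l < q" and e: "1 \<le> q - p" "q - p \<le> l"
      using pq by (auto simp: heavy2_def edges_def pivot_set_iff)
    from d show ?thesis
    proof
      assume "\<exists>j. 1 \<le> j \<and> j < k \<and> d = j * l"
      then obtain j where j: "1 \<le> j" "j < k" "d = j * l" by blast
      have "j * l < (i + 1) * l" using e pq(2) i j by (simp add: algebra_simps)
      then have "j \<le> i" using l by (simp add: mult_less_cancel_right)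
      then have "(i - j) * l \<in> pivot_set l k 0"
        unfolding pivot_set_iff using i j by (intro exI[of _ "i - j"]) auto
      then show ?thesis using i j e
        by (auto simp: heavy2_def edges_def algebra_simps intro!: bexI[of _ "(i - j) * l"])
    next
      assume dk: "k * l - 1 \<le> d"
      have "i * l \<le> (k - 1) * l" using i l by (intro mult_right_mono) auto
      then show ?thesis using e i dk pq(2) kl by linarith
    qed
  qed
  have C: False if "(p, q) \<in> light2 l k" "p + d < 0" for p q
    using that Sb[of p] Sb[of q] ld by (auto simp: light2_def edges_def)
  have D: False if "(p, q) \<in> heavy2 l k" "p + d < 0" for p q
    using that Sb ld by (fastforce simp: heavy2_def edges_def)
  show ?thesis using A B C D by blast
qed

text \<open>Multiples of l are at least l apart. Since ladder points are multiples of l, this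
  separates light from heavy requirements, also for two pivots at distance l.\<close>

lemma endpoint_not_jumped:
  fixes l :: int
  assumes "l \<ge> 1" "(p, q) \<in> edges l" "l dvd p \<or> l dvd q" "p < z" "z < q" "l dvd z"
  shows False
proof -
  from assms(3) show False
  proof
    assume "l dvd p"
    then have "l dvd z - p" using assms by auto
    then have "l \<le> z - p" using assms by (intro zdvd_imp_le) auto
    then show False using assms by (auto simp: edges_def)
  next
    assume "l dvd q"
    then have "l dvd q - z" using assms by auto
    then have "l \<le> q - z" using assms by (intro zdvd_imp_le) auto
    then show False using assms by (auto simp: edges_def)
  qed
qed

text \<open>K = k * l lies beyond the last ladder point (k - 1) * l. An endpoint that is itself a
  pivot lies beyond the ladder or on it, by \<open>pivot2_distance\<close>, so it is cut off
  too.\<close>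

lemma pivot2_structure:
  assumes l: "l \<ge> 2" and k: "k \<ge> 2" and m: "m > 0"
  shows "cut_structure l (light2 l k) (heavy2 l k) {t. light k (t / m)} {t. heavy k (t / m)} m (k * l)"
proof -
  define lt hv where "lt = m * (1 + 1 / (real_of_int k + 1))" and "hv = m * (1 + 2 / real_of_int k)"
  have Lt: "{t. light k (t / m)} = {m..<lt}" and Hv: "{t. heavy k (t / m)} = {hv<..}"
    using m by (auto simp: light_def heavy_def lt_def hv_def pos_le_divide_eq pos_divide_less_eq
        pos_less_divide_eq algebra_simps)
  have "(1 + 1 / (real_of_int k + 1)) \<le> 1 + 2 / real_of_int k" using k by (simp add: field_simps)
  then have lthv: "lt \<le> hv" using m by (simp add: lt_def hv_def)
  \<comment> \<open>Any two edges weigh at least 2 * m, so a light edge is a minimal path between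
    its ends.\<close>
  have ltm: "lt \<le> 2 * m" using m k by (simp add: lt_def field_simps)
  \<comment> \<open>Both sides equal m * (k + 2).\<close>
  have ineq1: "(real_of_int k + 1) * lt \<le> real_of_int k * hv"
    using k by (simp add: lt_def hv_def field_simps)
  have ineq2: "(real_of_int j + 1) * lt \<le> real_of_int j * hv + m" if j: "1 \<le> j" for j
  proof -
    \<comment> \<open>j + 1 \<le> 2 * j because j \<ge> 1, and k \<le> k + 1.\<close>
    have "(real_of_int j + 1) / (real_of_int k + 1) \<le> (2 * real_of_int j) / real_of_int k"
      using j k by (intro frac_le) auto
    then have "m * ((real_of_int j + 1) / (real_of_int k + 1)) \<le> m * ((2 * real_of_int j) / real_of_int k)"
      using m by (intro mult_left_mono) auto
    then show ?thesis by (simp add: lt_def hv_def algebra_simps add_divide_distrib)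
  qed
  let ?piv = "pivot_at (light2 l k) (heavy2 l k) {m..<lt} {hv<..}"
  have Sb: "0 \<le> z \<and> z \<le> (k - 1) * l" if "z \<in> pivot_set l k 0" for z
    using that l by (auto simp: pivot_set_iff intro!: mult_right_mono)
  have kl: "(k - 1) * l = k * l - l" by (simp add: algebra_simps)
  have z0: "0 \<in> pivot_set l k 0" using k by (auto simp: pivot_set_iff intro!: exI[of _ 0])
  have zk: "(k - 1) * l \<in> pivot_set l k 0" using k by (auto simp: pivot_set_iff intro!: exI[of _ "k - 1"])
  have k1: "l \<le> (k - 1) * l" using k l by simp
  have Sdvd: "l dvd z" if "z \<in> pivot_set l k 0" for z using that by (auto simp: pivot_set_iff)
  have lightD: "l dvd p \<or> l dvd q" "(p, q) \<in> edges l" if "(p, q) \<in> light2 l k" for p q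
    using that Sdvd by (auto simp: light2_def)
  have heavyD: "\<exists>z. l dvd z \<and> p < z \<and> z < q" if "(p, q) \<in> heavy2 l k" for p q
    using that Sdvd by (auto simp: heavy2_def)
  have disj: False if pq: "(p, q) \<in> light2 l k" "(p - d, q - d) \<in> heavy2 l k" "l dvd d" for p q d
  proof -
    obtain z where "l dvd z" "p - d < z" "z < q - d" using heavyD[OF pq(2)] by auto
    then show False using endpoint_not_jumped[of l p q "z + d"] lightD[OF pq(1)] pq(3) l by auto
  qed
  have fin: "finite (light2 l k)" "finite (heavy2 l k)"
  proof -
    have "- l \<le> p \<and> q \<le> k * l" if "(p, q) \<in> light2 l k" for p q
      using that Sb[of p] Sb[of q] kl l by (auto simp: light2_def edges_def)
    then show "finite (light2 l k)"
      by (intro finite_subset[OF _ finite_edges_window[of l "- l" "k * l"]]) (auto simp: light2_def)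
    have "- l \<le> p \<and> q \<le> k * l" if "(p, q) \<in> heavy2 l k" for p q
      using that Sb kl l by (fastforce simp: heavy2_def edges_def)
    then show "finite (heavy2 l k)"
      by (intro finite_subset[OF _ finite_edges_window[of l "- l" "k * l"]]) (auto simp: heavy2_def)
  qed
  have wL: "w (p + x, q + x) < lt" if "?piv w x" "(p, q) \<in> light2 l k" for w x p q
    using that by (auto simp: pivot_at_def)
  have wH: "hv < w (p + x, q + x)" if "?piv w x" "(p, q) \<in> heavy2 l k" for w x p q
    using that by (auto simp: pivot_at_def)
  have geo: "pivot2_geometry l k x w m lt hv" if g: "good l m w" and pv: "?piv w x" for w x
  proof
    show "l \<ge> 1" "k \<ge> 2" "\<forall>e\<in>edges l. m \<le> w e" "0 \<le> m" using l k m g by (auto simp: good_def)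
    fix i p q assume i: "0 \<le> i" "i < k" "p < x + i * l" "x + i * l < q" "q - p \<le> l"
    then have "(p - x, q - x) \<in> heavy2 l k"
      by (auto simp: heavy2_def edges_def pivot_set_iff intro!: bexI[of _ "i * l"])
    then show "hv < w (p, q)" using wH[OF pv] by fastforce
  next
    fix p assume "x - l < p" "p < x"
    then have "(p - x, 0) \<in> light2 l k" using z0 k1 l by (auto simp: light2_def edges_def)
    then show "w (p, x) < lt" using wL[OF pv] by fastforce
  next
    fix i assume i: "0 \<le> i" "i < k - 1"
    have "i * l \<in> pivot_set l k 0" using i by (auto simp: pivot_set_iff)
    moreover have "i * l \<noteq> (k - 1) * l" "i * l \<noteq> - l" using i l by (auto, smt (verit) mult_nonneg_nonneg)
    ultimately have "(i * l, i * l + l) \<in> light2 l k" using l by (auto simp: light2_def edges_def)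
    then show "w (x + i * l, x + (i + 1) * l) < lt" using wL[OF pv] by (fastforce simp: algebra_simps)
  next
    fix q assume q: "x + (k - 1) * l < q" "q < x + k * l"
    then have "((k - 1) * l, q - x) \<in> light2 l k" using zk k1 kl l
      by (auto simp: light2_def edges_def)
    then show "w (x + (k - 1) * l, q) < lt" using wL[OF pv] by (fastforce simp: algebra_simps)
  next
    show "(real_of_int k + 1) * lt \<le> real_of_int k * hv" by (rule ineq1)
    fix j assume "1 \<le> j" "j < k"
    then show "(real_of_int j + 1) * lt \<le> real_of_int j * hv + m" by (intro ineq2)
  qed
  show ?thesis unfolding Lt Hv
  proof
    show "finite (light2 l k)" "finite (heavy2 l k)" by (rule fin)+
    show "light2 l k \<subseteq> edges l" "heavy2 l k \<subseteq> edges l"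
      by (auto simp: light2_def heavy2_def)
    show "light2 l k \<inter> heavy2 l k = {}" using disj[of _ _ 0] by auto
    show "{m..<lt} \<inter> {hv<..} = {}" using lthv by auto
    show "0 \<le> k * l" using k l by simp
    fix d :: int assume d: "d > 0"
    show "(\<exists>(p, q)\<in>light2 l k. (p - d, q - d) \<in> heavy2 l k) \<or>
      (\<exists>(p, q)\<in>heavy2 l k. (p - d, q - d) \<in> light2 l k) \<or>
      (\<forall>(p, q)\<in>light2 l k. q > d \<longrightarrow> (p - d, q - d) \<in> light2 l k) \<and>
      (\<forall>(p, q)\<in>heavy2 l k. q > d \<longrightarrow> (p - d, q - d) \<in> heavy2 l k) \<and>
      (\<forall>(p, q)\<in>light2 l k. p + d < 0 \<longrightarrow> (p + d, q + d) \<in> light2 l k) \<and>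
      (\<forall>(p, q)\<in>heavy2 l k. p + d < 0 \<longrightarrow> (p + d, q + d) \<in> heavy2 l k)"
    proof (cases "\<exists>(p, q)\<in>light2 l k. (p - d, q - d) \<in> heavy2 l k")
      case True
      then show ?thesis by (rule disjI1)
    next
      case False
      show ?thesis by (intro disjI2 pivot2_compat[OF l k pivot2_distance[OF l k d False]])
    qed
  next
    fix w x assume g: "good l m w" and pv: "?piv w x"
    interpret pivot2_geometry l k x w m lt hv by (rule geo[OF g pv])
    show "cutp l w x" unfolding cutp_def
    proof (intro allI impI)
      fix p q assume pq: "p < x \<and> x < q \<and> q - p \<le> l"
      have "(0, q - x) \<in> light2 l k" using pq z0 k1 l by (auto simp: light2_def edges_def)
      then have "w (x, q) < lt" using wL[OF pv] by fastforce
      moreover have "w (p, x) < lt" using light_in[of p] pq by auto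
      moreover have "hv < w (p, q)" using heavy[of 0 p q] pq k by auto
      ultimately show "w (p, x) \<le> w (p, q) \<and> w (x, q) \<le> w (p, q)" using lthv by linarith
    qed
    fix u v assume u: "u \<le> x" and v: "x + k * l \<le> v \<or> x < v \<and> ?piv w v"
    from v have "x + (k - 1) * l < v \<or> (\<exists>i\<ge>1. i < k \<and> v = x + i * l)"
    proof
      assume "x + k * l \<le> v"
      then show ?thesis using kl l by auto
    next
      assume v: "x < v \<and> ?piv w v"
      have "\<not> (\<exists>(p, q)\<in>light2 l k. (p - (v - x), q - (v - x)) \<in> heavy2 l k)"
      proof
        assume "\<exists>(p, q)\<in>light2 l k. (p - (v - x), q - (v - x)) \<in> heavy2 l k"
        then obtain p q where "(p, q) \<in> light2 l k" "(p - (v - x), q - (v - x)) \<in> heavy2 l k" by auto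
        then have "w (p + x, q + x) < lt" "hv < w (p - (v - x) + v, q - (v - x) + v)"
          using wL[OF pv] wH[of w v] v by blast+
        then show False using lthv by (simp add: algebra_simps)
      qed
      then have "(\<exists>j. 1 \<le> j \<and> j < k \<and> v - x = j * l) \<or> k * l - 1 \<le> v - x"
        using pivot2_distance[OF l k, of "v - x"] v by auto
      then show ?thesis using kl l by (auto simp: algebra_simps)
    qed
    then show "cuts l w u x v" by (rule pivot2_cuts[OF u])
  next
    \<comment> \<open>The short block has length l, with overlapping pivots at 0 and l. Their
      requirements do not clash by divisibility, and the light edge from 0 to l gives one hop for
      the distance l \<ge> 2.\<close>
    define A' where "A' = light2 l k \<union> (\<lambda>(p, q). (p + l, q + l)) ` light2 l k"
    define B' where "B' = heavy2 l k \<union> (\<lambda>(p, q). (p + l, q + l)) ` heavy2 l k"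
    have "A' \<inter> B' = {}"
      using disj[of _ _ 0] disj[of _ _ l] disj[of _ _ "- l"] unfolding A'_def B'_def
      by (auto simp: image_iff) (metis add_diff_cancel_right' dvd_refl diff_add_cancel)+
    moreover have "?piv w 0 \<and> ?piv w l \<and> int (mhops l w 0 l) < l"
      if g: "good l m w" and wA: "\<forall>e\<in>A'. w e \<in> {m..<lt}" and wB: "\<forall>e\<in>B'. w e \<in> {hv<..}" for w
    proof -
      have pv: "?piv w 0" "?piv w l" using wA wB by (fastforce simp: A'_def B'_def pivot_at_def)+
      interpret pivot2_geometry l k 0 w m lt hv by (rule geo[OF g pv(1)])
      have e: "w (0, l) < lt" using light_mid[of 0] k by auto
      have "minpath l w 0 l [0, l]" unfolding minpath_def
      proof (intro conjI allI impI)
        show "is_path l 0 l [0, l]" using l by (auto simp: is_path_Cons adjacent_iff)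
        fix q assume q: "is_path l 0 l q"
        then obtain y r where r: "q = 0 # y # r" using l by (cases q; cases "tl q") (auto simp: is_path_def)
        show "path_weight w [0, l] \<le> path_weight w q"
        proof (cases r)
          case Nil
          then show ?thesis using q by (auto simp: r is_path_def)
        next
          case (Cons s t)
          have "m \<le> edge_weight w 0 y" using is_path_edges_ge[of l m w 0 l "[]" 0 y r] q mw by (auto simp: r)
          moreover have "m \<le> edge_weight w y s"
            using is_path_edges_ge[of l m w 0 l "[0]" y s t] q mw by (auto simp: r Cons)
          moreover have "0 \<le> path_weight w (s # t)"
            using path_weight_nonneg[of l w s l "s # t"] q mw m0 by (fastforce simp: r Cons is_path_Cons)
          ultimately show ?thesis using e ltm l by (simp add: r Cons edge_weight_less)
        qed
      qed
      then have "mhops l w 0 l \<le> 1" using mhops_le by fastforce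
      then show ?thesis using pv l by auto
    qed
    moreover have "finite A'" "finite B'" using fin by (auto simp: A'_def B'_def)
    moreover have "A' \<subseteq> edges l" "B' \<subseteq> edges l"
      by (auto simp: A'_def B'_def light2_def heavy2_def edges_def)
    ultimately show "\<exists>v>0. \<exists>A' B'. finite A' \<and> finite B' \<and> A' \<subseteq> edges l \<and> B' \<subseteq> edges l \<and> A' \<inter> B' = {} \<and>
        (\<forall>w. good l m w \<and> (\<forall>e\<in>A'. w e \<in> {m..<lt}) \<and> (\<forall>e\<in>B'. w e \<in> {hv<..}) \<longrightarrow>
          ?piv w 0 \<and> ?piv w v \<and> int (mhops l w 0 v) < v)"
      using l by (intro exI[of _ l] conjI exI[of _ A'] exI[of _ B']) auto
  qed (use l m in auto)
qed

section \<open>Weighted sums of i.i.d. variables\<close>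

lemma (in prob_space) integrable_power_le4:
  fixes f :: "'a \<Rightarrow> real"
  assumes [measurable]: "f \<in> borel_measurable M" and int: "integrable M (\<lambda>x. f x ^ 4)" and "k \<le> 4"
  shows "integrable M (\<lambda>x. f x ^ k)" "integrable M (\<lambda>x. \<bar>f x\<bar> ^ k)"
proof -
  have b: "\<bar>t\<bar> ^ k \<le> 1 + t ^ 4" for t :: real
  proof (cases "\<bar>t\<bar> \<le> 1")
    case True
    then have "\<bar>t\<bar> ^ k \<le> 1" by (intro power_le_one) auto
    then show ?thesis by (smt (verit) zero_le_even_power' even_numeral zero_le_power_eq_numeral)
  next
    case False
    then have "\<bar>t\<bar> ^ k \<le> \<bar>t\<bar> ^ 4" using assms by (intro power_increasing) auto
    then show ?thesis by simp
  qed
  show "integrable M (\<lambda>x. f x ^ k)" "integrable M (\<lambda>x. \<bar>f x\<bar> ^ k)"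
    by (rule Bochner_Integration.integrable_bound[of M "\<lambda>x. 1 + f x ^ 4"];
        use int b in \<open>force simp: power_abs intro!: AE_I2\<close>)+
qed

lemma power4_add_le: "(a + b) ^ 4 \<le> 8 * a ^ 4 + 8 * b ^ 4" for a b :: real
proof -
  have "(a + b) ^ 4 + (a - b) ^ 4 + 6 * (a\<^sup>2 - b\<^sup>2)\<^sup>2 = 8 * a ^ 4 + 8 * b ^ 4"
    by (simp add: power2_eq_square power4_eq_xxxx algebra_simps)
  moreover have "0 \<le> (a - b) ^ 4" "0 \<le> (a\<^sup>2 - b\<^sup>2)\<^sup>2" by simp_all
  ultimately show ?thesis by linarith
qed

lemma (in prob_space) expectation_abs_le_sqrt:
  fixes f :: "'a \<Rightarrow> real"
  assumes [measurable]: "f \<in> borel_measurable M" and int: "integrable M (\<lambda>x. (f x)\<^sup>2)"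
  shows "integrable M (\<lambda>x. \<bar>f x\<bar>)" "expectation (\<lambda>x. \<bar>f x\<bar>) \<le> sqrt (expectation (\<lambda>x. (f x)\<^sup>2))"
proof -
  have i: "integrable M f" by (rule square_integrable_imp_integrable[OF _ int]) simp
  then show i': "integrable M (\<lambda>x. \<bar>f x\<bar>)" by simp
  have "0 \<le> variance (\<lambda>x. \<bar>f x\<bar>)" by simp
  also have "\<dots> = expectation (\<lambda>x. \<bar>f x\<bar>\<^sup>2) - (expectation (\<lambda>x. \<bar>f x\<bar>))\<^sup>2"
    using i' int by (intro variance_eq) auto
  finally show "expectation (\<lambda>x. \<bar>f x\<bar>) \<le> sqrt (expectation (\<lambda>x. (f x)\<^sup>2))"
    by (intro real_le_rsqrt) simp
qed

text \<open>On a countable range the joint law and the product of the marginals are determined by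
  their atoms.\<close>

lemma (in prob_space) indep_var_discrete:
  fixes V X :: "'a \<Rightarrow> 'b::countable"
  assumes [measurable]: "V \<in> measurable M (count_space UNIV)" "X \<in> measurable M (count_space UNIV)"
    and eq: "\<And>v x. prob {w\<in>space M. V w = v \<and> X w = x} =
      prob {w\<in>space M. V w = v} * prob {w\<in>space M. X w = x}"
  shows "indep_var (count_space UNIV) V (count_space UNIV) X"
  unfolding indep_var_distribution_eq
proof (intro conjI assms(1,2))
  let ?c = "count_space UNIV"
  interpret V: prob_space "distr M ?c V" by (rule prob_space_distr) simp
  interpret X: prob_space "distr M ?c X" by (rule prob_space_distr) simp
  have s: "sets (?c \<Otimes>\<^sub>M ?c) = sets (count_space (UNIV :: ('b \<times> 'b) set))"
    by (subst pair_measure_countable) auto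
  have s1: "sets (distr M ?c V \<Otimes>\<^sub>M distr M ?c X) = UNIV"
    using s sets_pair_measure_cong[OF sets_distr[of M ?c V] sets_distr[of M ?c X]] by simp
  show "distr M ?c V \<Otimes>\<^sub>M distr M ?c X = distr M (?c \<Otimes>\<^sub>M ?c) (\<lambda>x. (V x, X x))"
  proof (rule measure_eqI_countable[of _ UNIV])
    show "sets (distr M ?c V \<Otimes>\<^sub>M distr M ?c X) = Pow UNIV" using s1 by simp
    show "sets (distr M (?c \<Otimes>\<^sub>M ?c) (\<lambda>x. (V x, X x))) = Pow UNIV" using s by simp
    fix a :: "'b \<times> 'b"
    obtain v x where a: "a = (v, x)" by force
    have "emeasure (distr M ?c V \<Otimes>\<^sub>M distr M ?c X) {a} =
        emeasure (distr M ?c V) {v} * emeasure (distr M ?c X) {x}"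
      using X.emeasure_pair_measure_Times[of "{v}" "distr M ?c V" "{x}"] by (simp add: a)
    also have "\<dots> = ennreal (prob {w\<in>space M. V w = v} * prob {w\<in>space M. X w = x})"
      by (simp add: emeasure_distr emeasure_eq_measure ennreal_mult'' vimage_def Int_def conj_commute)
    also have "\<dots> = emeasure (distr M (?c \<Otimes>\<^sub>M ?c) (\<lambda>x. (V x, X x))) {a}"
      by (subst emeasure_distr) (auto simp: a s emeasure_eq_measure eq[symmetric] intro!: arg_cong[where f=prob])
    finally show "emeasure (distr M ?c V \<Otimes>\<^sub>M distr M ?c X) {a} =
        emeasure (distr M (?c \<Otimes>\<^sub>M ?c) (\<lambda>x. (V x, X x))) {a}" .
  qed simp
qed

text \<open>Independence is assumed in the form in which regeneration yields it, between the history
  and the next variable. \<open>X 0\<close> may have a law of its own; it will be the delay before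
  the first pivot.\<close>

locale discrete_sequence = prob_space M for M :: "'a measure" +
  fixes X :: "nat \<Rightarrow> 'a \<Rightarrow> 'b::countable"
  assumes X_rv [measurable]: "\<And>i. X i \<in> measurable M (count_space UNIV)"
    and X_step: "\<And>n v z. prob {w\<in>space M. map (\<lambda>i. X i w) [0..<n] = v \<and> X n w = z} =
      prob {w\<in>space M. map (\<lambda>i. X i w) [0..<n] = v} * prob {w\<in>space M. X n w = z}"
    and X_ident: "\<And>n z. prob {w\<in>space M. X (Suc n) w = z} = prob {w\<in>space M. X 1 w = z}"
begin

definition hist :: "nat \<Rightarrow> 'a \<Rightarrow> 'b list" where
  "hist n w = map (\<lambda>i. X i w) [0..<n]"

lemma hist_rv [measurable]: "hist n \<in> measurable M (count_space UNIV)"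
proof (induction n)
  case 0
  show ?case by (simp add: hist_def[abs_def])
next
  case (Suc n)
  have "(\<lambda>w. hist n w @ [X n w]) \<in> measurable M (count_space UNIV)"
    by (rule measurable_compose_countable[OF measurable_compose_countable[OF _ X_rv] Suc]) simp
  then show ?case by (simp add: hist_def[abs_def])
qed

text \<open>The library relates only independent variables with the same range type, hence the sum type.\<close>

abbreviation histL :: "nat \<Rightarrow> 'a \<Rightarrow> 'b list + 'b" where "histL n \<equiv> \<lambda>w. Inl (hist n w)"
abbreviation XR :: "nat \<Rightarrow> 'a \<Rightarrow> 'b list + 'b" where "XR n \<equiv> \<lambda>w. Inr (X n w)"

lemma indep_hist:
  "indep_var (count_space UNIV) (histL n) (count_space UNIV) (XR n)"
proof (rule indep_var_discrete)
  fix v x :: "'b list + 'b"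
  show "prob {w\<in>space M. histL n w = v \<and> XR n w = x} =
      prob {w\<in>space M. histL n w = v} * prob {w\<in>space M. XR n w = x}"
    by (cases v; cases x) (use X_step in \<open>simp_all add: hist_def\<close>)
qed measurable

lemma X_distr: "distr M (count_space UNIV) (X (Suc n)) = distr M (count_space UNIV) (X 1)"
  by (rule measure_eqI_countable[of _ UNIV])
    (use X_ident in \<open>simp_all add: emeasure_distr emeasure_eq_measure vimage_def Int_def conj_commute\<close>)

lemma X_integrable_iff:
  fixes g :: "'b \<Rightarrow> real"
  shows "integrable M (\<lambda>w. g (X (Suc n) w)) \<longleftrightarrow> integrable M (\<lambda>w. g (X 1 w))"
  using arg_cong[OF X_distr[of n], of "\<lambda>m. integrable m g"] by (simp add: integrable_distr_eq)

lemma X_expectation: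
  fixes g :: "'b \<Rightarrow> real"
  shows "expectation (\<lambda>w. g (X (Suc n) w)) = expectation (\<lambda>w. g (X 1 w))"
  using arg_cong[OF X_distr[of n], of "\<lambda>m. integral\<^sup>L m g"] by (simp add: integral_distr)

text \<open>The substitute for conditional expectation: a centred function of the next variable is
  orthogonal to every integrable function of the past.\<close>

lemma hist_product:
  fixes f :: "'b list \<Rightarrow> real" and g :: "'b \<Rightarrow> real"
  assumes "integrable M (\<lambda>w. f (hist n w))" "integrable M (\<lambda>w. g (X n w))"
  shows "integrable M (\<lambda>w. f (hist n w) * g (X n w))"
    and "expectation (\<lambda>w. f (hist n w) * g (X n w)) =
      expectation (\<lambda>w. f (hist n w)) * expectation (\<lambda>w. g (X n w))"
proof -
  have "indep_var borel ((f \<circ> projl) \<circ> (histL n)) borel ((g \<circ> projr) \<circ> (XR n))"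
    by (rule indep_var_compose[OF indep_hist]) simp_all
  then have i: "indep_var borel (\<lambda>w. f (hist n w)) borel (\<lambda>w. g (X n w))" by (simp add: comp_def)
  show "integrable M (\<lambda>w. f (hist n w) * g (X n w))"
    "expectation (\<lambda>w. f (hist n w) * g (X n w)) =
      expectation (\<lambda>w. f (hist n w)) * expectation (\<lambda>w. g (X n w))"
    using indep_var_integrable[OF i assms] indep_var_lebesgue_integral[OF i assms] by auto
qed

lemma hist_Suc: "hist (Suc n) w = hist n w @ [X n w]"
  by (simp add: hist_def)

lemma X_indep_finite: "prob {w\<in>space M. \<forall>i<n. X i w \<in> A i} = (\<Prod>i<n. prob {w\<in>space M. X i w \<in> A i})"
proof (induction n)
  case 0
  then show ?case by (simp add: prob_space)
next
  case (Suc n)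
  have "{w\<in>space M. \<forall>i<Suc n. X i w \<in> A i} =
      (\<lambda>w. (histL n w, XR n w)) -` (Inl ` {v. \<forall>i<n. v ! i \<in> A i} \<times> Inr ` A n) \<inter> space M"
    by (auto simp: hist_def less_Suc_eq)
  also have "prob \<dots> = prob ((histL n) -` Inl ` {v. \<forall>i<n. v ! i \<in> A i} \<inter> space M) *
      prob ((XR n) -` Inr ` A n \<inter> space M)"
    by (rule indep_varD[OF indep_hist]) auto
  also have "(histL n) -` Inl ` {v. \<forall>i<n. v ! i \<in> A i} \<inter> space M = {w\<in>space M. \<forall>i<n. X i w \<in> A i}"
    by (auto simp: hist_def)
  also have "(XR n) -` Inr ` A n \<inter> space M = {w\<in>space M. X n w \<in> A n}" by auto
  finally show ?case using Suc by simp
qed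

lemma X_indep_vars: "indep_vars (\<lambda>_. count_space UNIV) X UNIV"
  unfolding indep_vars_def2
proof (intro conjI ballI indep_setsI X_rv)
  fix i show "{X i -` A \<inter> space M |A. A \<in> sets (count_space UNIV)} \<subseteq> events" by auto
next
  fix B :: "nat \<Rightarrow> 'a set" and J :: "nat set"
  assume J: "J \<noteq> {}" "finite J" and "\<forall>j\<in>J. B j \<in> {X j -` A \<inter> space M |A. A \<in> sets (count_space UNIV)}"
  then have "\<forall>j\<in>J. \<exists>A. B j = X j -` A \<inter> space M" by auto
  then obtain A where A: "\<And>j. j \<in> J \<Longrightarrow> B j = X j -` A j \<inter> space M" by metis
  \<comment> \<open>Indices outside J are given the trivial condition, which reduces J to an initial
    segment.\<close>
  define A' where "A' j = (if j \<in> J then A j else UNIV)" for j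
  obtain n where n: "J \<subseteq> {..<n}" using finite_nat_iff_bounded J by blast
  have e: "prob {w\<in>space M. X i w \<in> A' i} = (if i \<in> J then prob (B i) else 1)" for i
    by (auto simp: A'_def A prob_space intro!: arg_cong[where f=prob])
  have "(\<Inter>j\<in>J. B j) = {w\<in>space M. \<forall>i<n. X i w \<in> A' i}"
    using J(1) n by (auto simp: A A'_def split: if_splits)
  then have "prob (\<Inter>j\<in>J. B j) = (\<Prod>i<n. if i \<in> J then prob (B i) else 1)"
    using X_indep_finite[of n A'] by (simp only: e)
  also have "\<dots> = (\<Prod>j\<in>J. prob (B j))" using n by (simp add: prod.If_cases Int_absorb1)
  finally show "prob (\<Inter>j\<in>J. B j) = (\<Prod>j\<in>J. prob (B j))" .
qed

end

locale weighted_sum = discrete_sequence +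
  fixes g :: "'b \<Rightarrow> real"
  assumes g4: "integrable M (\<lambda>w. g (X 1 w) ^ 4)" and g_mean: "expectation (\<lambda>w. g (X 1 w)) = 0"
begin

definition s2 :: real where "s2 = expectation (\<lambda>w. (g (X 1 w))\<^sup>2)"
definition s4 :: real where "s4 = expectation (\<lambda>w. g (X 1 w) ^ 4)"

text \<open>A martingale transform: the coefficient of \<open>g (X (Suc i))\<close> is a function of
  \<open>X 0\<close>, ..., \<open>X i\<close>.\<close>

definition wsum :: "(nat \<Rightarrow> 'b list \<Rightarrow> real) \<Rightarrow> nat \<Rightarrow> 'a \<Rightarrow> real" where
  "wsum c n w = (\<Sum>i<n. c i (hist (Suc i) w) * g (X (Suc i) w))"

lemma wsum_hist: "wsum c n w = (\<Sum>i<n. c i (take (Suc i) (hist (Suc n) w)) * g (hist (Suc n) w ! Suc i))"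
  unfolding wsum_def by (intro sum.cong refl) (auto simp: hist_def take_map simp del: upt_Suc)

lemma s2_nonneg: "0 \<le> s2" and s4_nonneg: "0 \<le> s4"
  by (simp_all add: s2_def s4_def)

lemma g_power_integrable: "k \<le> 4 \<Longrightarrow> integrable M (\<lambda>w. g (X (Suc n) w) ^ k)"
  using X_integrable_iff[of "\<lambda>x. g x ^ k" n] integrable_power_le4(1)[OF _ g4, of k] by simp

text \<open>When the power of the sum is expanded in the newest increment, the term linear in it
  vanishes by \<open>hist_product\<close>, as g is centred. This leaves orthogonality for the second
  moment, and for the fourth a growth per step that is linear in n.\<close>

lemma wsum_moments:
  assumes c: "\<And>i v. \<bar>c i v\<bar> \<le> 1"
  shows wsum_integrable4: "integrable M (\<lambda>w. wsum c n w ^ 4)"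
    and wsum_second: "expectation (\<lambda>w. (wsum c n w)\<^sup>2) = s2 * (\<Sum>i<n. expectation (\<lambda>w. (c i (hist (Suc i) w))\<^sup>2))"
    and wsum_fourth: "expectation (\<lambda>w. wsum c n w ^ 4) \<le> (8 * s2\<^sup>2 + 3 * s4) * (real n)\<^sup>2"
proof -
  have m [measurable]: "wsum c n \<in> borel_measurable M" for n
    unfolding wsum_def[abs_def] by measurable
  have c_int: "integrable M (\<lambda>w. (c i (hist j w)) ^ k)" for i j k
    by (rule integrable_const_bound[of _ 1]) (auto simp: power_abs intro!: AE_I2 power_le_one c)
  have Ec1: "expectation (\<lambda>w. (c i (hist j w))\<^sup>2) \<le> 1" for i j
    using integral_mono[OF c_int[of i j 2], of "\<lambda>_. 1"] c by (simp add: prob_space abs_square_le_1)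
  have c4: "c i v ^ 4 \<le> 1" for i v
  proof -
    have "\<bar>c i v\<bar> ^ 4 \<le> 1" by (intro power_le_one c) simp
    then show ?thesis by simp
  qed
  define y where "y n w = c n (hist (Suc n) w) * g (X (Suc n) w)" for n w
  have step: "wsum c (Suc n) w = wsum c n w + y n w" for n w
    by (simp add: wsum_def y_def)
  have y_meas [measurable]: "y n \<in> borel_measurable M" for n
    unfolding y_def[abs_def] by measurable
  have yk: "integrable M (\<lambda>w. y n w ^ k)" "expectation (\<lambda>w. y n w ^ k) =
      expectation (\<lambda>w. (c n (hist (Suc n) w)) ^ k) * expectation (\<lambda>w. g (X 1 w) ^ k)" if "k \<le> 4" for n k
    using hist_product[of "\<lambda>v. c n v ^ k" "Suc n" "\<lambda>x. g x ^ k", OF c_int g_power_integrable[OF that]]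
      X_expectation[of "\<lambda>x. g x ^ k" n]
    by (simp_all add: y_def power_mult_distrib)
  have mixed: "integrable M (\<lambda>w. wsum c n w ^ j * y n w ^ k)"
      "expectation (\<lambda>w. wsum c n w ^ j * y n w ^ k) =
        expectation (\<lambda>w. wsum c n w ^ j * c n (hist (Suc n) w) ^ k) * expectation (\<lambda>w. g (X 1 w) ^ k)"
    if "k \<le> 4" and int: "integrable M (\<lambda>w. wsum c n w ^ j)" for n j k
  proof -
    let ?f = "\<lambda>v. (\<Sum>i<n. c i (take (Suc i) v) * g (v ! Suc i)) ^ j * c n v ^ k"
    have f: "?f (hist (Suc n) w) = wsum c n w ^ j * c n (hist (Suc n) w) ^ k" for w
      by (simp only: wsum_hist)
    have "integrable M (\<lambda>w. wsum c n w ^ j * c n (hist (Suc n) w) ^ k)"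
    proof (rule Bochner_Integration.integrable_bound[OF int])
      show "AE w in M. norm (wsum c n w ^ j * c n (hist (Suc n) w) ^ k) \<le> norm (wsum c n w ^ j)"
        using c by (auto intro!: AE_I2 mult_left_le simp: abs_mult power_abs intro: power_le_one)
    qed measurable
    then have i: "integrable M (\<lambda>w. ?f (hist (Suc n) w))" by (simp only: f)
    have "wsum c n w ^ j * y n w ^ k = ?f (hist (Suc n) w) * g (X (Suc n) w) ^ k" for w
      unfolding f by (simp add: y_def power_mult_distrib)
    then show "integrable M (\<lambda>w. wsum c n w ^ j * y n w ^ k)"
      "expectation (\<lambda>w. wsum c n w ^ j * y n w ^ k) =
        expectation (\<lambda>w. wsum c n w ^ j * c n (hist (Suc n) w) ^ k) * expectation (\<lambda>w. g (X 1 w) ^ k)"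
      using hist_product[OF i g_power_integrable[OF \<open>k \<le> 4\<close>]] X_expectation[of "\<lambda>x. g x ^ k" n]
      by (simp_all only: f)
  qed
  have int4: "integrable M (\<lambda>w. wsum c n w ^ 4)" for n
  proof (induction n)
    case 0
    then show ?case by (simp add: wsum_def)
  next
    case (Suc n)
    show ?case
    proof (rule Bochner_Integration.integrable_bound)
      show "integrable M (\<lambda>w. 8 * wsum c n w ^ 4 + 8 * y n w ^ 4)"
        using Suc.IH yk(1)[of 4 n] by simp
      show "AE w in M. norm (wsum c (Suc n) w ^ 4) \<le> norm (8 * wsum c n w ^ 4 + 8 * y n w ^ 4)"
      proof (rule AE_I2)
        fix w
        show "norm (wsum c (Suc n) w ^ 4) \<le> norm (8 * wsum c n w ^ 4 + 8 * y n w ^ 4)"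
          using power4_add_le[of "wsum c n w" "y n w"] by (simp add: step)
      qed
    qed measurable
  qed
  show "integrable M (\<lambda>w. wsum c n w ^ 4)" by (rule int4)
  have intk: "integrable M (\<lambda>w. wsum c n w ^ k)" if "k \<le> 4" for n k
    by (rule integrable_power_le4(1)[OF _ int4 that]) simp
  have second: "expectation (\<lambda>w. (wsum c n w)\<^sup>2) = s2 * (\<Sum>i<n. expectation (\<lambda>w. (c i (hist (Suc i) w))\<^sup>2))" for n
  proof (induction n)
    case 0
    then show ?case by (simp add: wsum_def)
  next
    case (Suc n)
    have "expectation (\<lambda>w. (wsum c (Suc n) w)\<^sup>2) =
        expectation (\<lambda>w. (wsum c n w)\<^sup>2 + 2 * (wsum c n w ^ 1 * y n w ^ 1) + (y n w)\<^sup>2)"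
      by (simp add: step power2_eq_square algebra_simps)
    also have "\<dots> = expectation (\<lambda>w. (wsum c n w)\<^sup>2) + 2 * expectation (\<lambda>w. wsum c n w ^ 1 * y n w ^ 1)
        + expectation (\<lambda>w. (y n w)\<^sup>2)"
      using intk[of 2 n] mixed(1)[of 1 n 1] intk[of 1 n] yk(1)[of 2 n]
      by (subst Bochner_Integration.integral_add; simp)+
    also have "expectation (\<lambda>w. wsum c n w ^ 1 * y n w ^ 1) = 0"
      using mixed(2)[of 1 n 1] intk[of 1 n] g_mean by simp
    finally show ?case using Suc yk(2)[of 2 n] by (simp add: s2_def algebra_simps)
  qed
  then show "expectation (\<lambda>w. (wsum c n w)\<^sup>2) = s2 * (\<Sum>i<n. expectation (\<lambda>w. (c i (hist (Suc i) w))\<^sup>2))" .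
  have second_le: "expectation (\<lambda>w. (wsum c n w)\<^sup>2) \<le> s2 * real n" for n
  proof -
    have "(\<Sum>i<n. expectation (\<lambda>w. (c i (hist (Suc i) w))\<^sup>2)) \<le> (\<Sum>i<n. 1)"
      by (intro sum_mono Ec1)
    then show ?thesis using s2_nonneg by (simp add: second mult_left_mono)
  qed
  show "expectation (\<lambda>w. wsum c n w ^ 4) \<le> (8 * s2\<^sup>2 + 3 * s4) * (real n)\<^sup>2"
  proof (induction n)
    case 0
    then show ?case by (simp add: wsum_def)
  next
    case (Suc n)
    \<comment> \<open>The right side exceeds the left by 2 * (b * (a - b))^2. The mixed term with
      b^3 is absorbed, so that only second and fourth moments of the increment remain.\<close>
    have pt: "(a + b) ^ 4 \<le> a ^ 4 + 4 * (a ^ 3 * b ^ 1) + 8 * (a ^ 2 * b ^ 2) + 3 * b ^ 4" for a b :: real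
    proof -
      have "a ^ 4 + 4 * (a ^ 3 * b ^ 1) + 8 * (a ^ 2 * b ^ 2) + 3 * b ^ 4 - (a + b) ^ 4 = 2 * (b * (a - b))\<^sup>2"
        by (simp add: power2_eq_square power4_eq_xxxx power3_eq_cube algebra_simps)
      then show ?thesis by (smt (verit) zero_le_power2)
    qed
    have i: "integrable M (\<lambda>w. wsum c n w ^ 3 * y n w ^ 1)" "integrable M (\<lambda>w. wsum c n w ^ 2 * y n w ^ 2)"
        "integrable M (\<lambda>w. y n w ^ 4)" "integrable M (\<lambda>w. wsum c n w ^ 4)"
      by (intro mixed(1) intk yk(1); simp)+
    have "expectation (\<lambda>w. wsum c (Suc n) w ^ 4) \<le> expectation (\<lambda>w. wsum c n w ^ 4 +
        4 * (wsum c n w ^ 3 * y n w ^ 1) + 8 * (wsum c n w ^ 2 * y n w ^ 2) + 3 * y n w ^ 4)"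
      using i by (intro integral_mono int4 Bochner_Integration.integrable_add integrable_mult_right)
        (auto simp: step pt[simplified])
    also have "\<dots> = expectation (\<lambda>w. wsum c n w ^ 4) + 4 * expectation (\<lambda>w. wsum c n w ^ 3 * y n w ^ 1)
        + 8 * expectation (\<lambda>w. wsum c n w ^ 2 * y n w ^ 2) + 3 * expectation (\<lambda>w. y n w ^ 4)"
      using i by (subst Bochner_Integration.integral_add; simp)+
    also have "expectation (\<lambda>w. wsum c n w ^ 3 * y n w ^ 1) = 0"
      using mixed(2)[of 1 n 3] intk[of 3 n] g_mean by simp
    also have "expectation (\<lambda>w. wsum c n w ^ 2 * y n w ^ 2) \<le> s2 * real n * s2"
    proof -
      have "expectation (\<lambda>w. wsum c n w ^ 2 * c n (hist (Suc n) w) ^ 2) \<le> expectation (\<lambda>w. wsum c n w ^ 2)"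
      proof (rule integral_mono')
        show "integrable M (\<lambda>w. wsum c n w ^ 2)" by (rule intk) simp
        show "wsum c n w ^ 2 * c n (hist (Suc n) w) ^ 2 \<le> wsum c n w ^ 2" for w
          using c[of n "hist (Suc n) w"] by (intro mult_left_le) (auto simp: abs_square_le_1)
      qed simp
      also have "\<dots> \<le> s2 * real n" by (rule second_le)
      finally have le: "expectation (\<lambda>w. wsum c n w ^ 2 * c n (hist (Suc n) w) ^ 2) \<le> s2 * real n" .
      have "expectation (\<lambda>w. wsum c n w ^ 2 * y n w ^ 2) =
          expectation (\<lambda>w. wsum c n w ^ 2 * c n (hist (Suc n) w) ^ 2) * s2"
        unfolding s2_def by (rule mixed(2)) (simp_all add: intk)
      with le show ?thesis using s2_nonneg by (simp add: mult_right_mono)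
    qed
    also have "expectation (\<lambda>w. y n w ^ 4) \<le> s4"
    proof -
      have "expectation (\<lambda>w. (c n (hist (Suc n) w)) ^ 4) \<le> 1"
        using integral_mono[OF c_int[of n "Suc n" 4], of "\<lambda>_. 1"] c4 by (simp add: prob_space)
      moreover have "expectation (\<lambda>w. y n w ^ 4) = expectation (\<lambda>w. (c n (hist (Suc n) w)) ^ 4) * s4"
        unfolding s4_def by (rule yk(2)) simp
      moreover have "0 \<le> expectation (\<lambda>w. (c n (hist (Suc n) w)) ^ 4)" by simp
      ultimately show ?thesis using s4_nonneg mult_left_le_one_le[of s4] by simp
    qed
    finally have "expectation (\<lambda>w. wsum c (Suc n) w ^ 4) \<le>
        expectation (\<lambda>w. wsum c n w ^ 4) + 8 * (s2 * real n * s2) + 3 * s4" by simp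
    also have "\<dots> \<le> (8 * s2\<^sup>2 + 3 * s4) * (real n)\<^sup>2 + 8 * (s2 * real n * s2) + 3 * s4" using Suc by simp
    also have "\<dots> \<le> (8 * s2\<^sup>2 + 3 * s4) * (real (Suc n))\<^sup>2"
    proof -
      have "0 \<le> s2\<^sup>2 * real n" "0 \<le> s4 * real n" "0 \<le> s2\<^sup>2" using s4_nonneg by auto
      then show ?thesis by (simp add: power2_eq_square algebra_simps)
    qed
    finally show ?case .
  qed
qed


definition psum :: "nat \<Rightarrow> 'a \<Rightarrow> real" where
  "psum n w = (\<Sum>i<n. g (X (Suc i) w))"

lemma psum_rv [measurable]: "psum n \<in> borel_measurable M"
  unfolding psum_def[abs_def] by measurable

lemma psum_second: "integrable M (\<lambda>w. (psum n w)\<^sup>2)" "expectation (\<lambda>w. (psum n w)\<^sup>2) = s2 * real n"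
proof -
  have w: "wsum (\<lambda>_ _. 1) n w = psum n w" for w by (simp add: wsum_def psum_def)
  have "integrable M (\<lambda>w. psum n w ^ 4)"
    using wsum_integrable4[of "\<lambda>_ _. 1" n] by (simp add: w)
  then show "integrable M (\<lambda>w. (psum n w)\<^sup>2)" by (rule integrable_power_le4(1)[OF psum_rv]) simp
  show "expectation (\<lambda>w. (psum n w)\<^sup>2) = s2 * real n"
    using wsum_second[of "\<lambda>_ _. 1" n] by (simp add: w prob_space)
qed

lemma psum_clt:
  assumes "s2 > 0"
  shows "weak_conv_m (\<lambda>n. distr M borel (\<lambda>w. psum n w / sqrt (real n * s2))) std_normal_distribution"
proof -
  let ?Y = "\<lambda>i w. g (X (Suc i) w)"
  have "indep_vars (\<lambda>_. borel) ?Y UNIV"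
  proof -
    have ind: "indep_sets (\<lambda>i. {X i -` A \<inter> space M |A. A \<in> sets (count_space UNIV)}) UNIV"
      using X_indep_vars unfolding indep_vars_def2 by simp
    have "indep_vars (\<lambda>_. count_space UNIV) (\<lambda>i. X (Suc i)) UNIV"
      unfolding indep_vars_def2
    proof (intro conjI ballI indep_setsI X_rv)
      fix i show "{X (Suc i) -` A \<inter> space M |A. A \<in> sets (count_space UNIV)} \<subseteq> events" by auto
    next
      fix B :: "nat \<Rightarrow> 'a set" and J :: "nat set"
      assume J: "J \<noteq> {}" "finite J"
        and B: "\<forall>j\<in>J. B j \<in> {X (Suc j) -` A \<inter> space M |A. A \<in> sets (count_space UNIV)}"
      \<comment> \<open>Independence of the whole sequence on a shifted index set; the shift drops
        \<open>X 0\<close>, whose law may differ.\<close>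
      have "prob (\<Inter>i\<in>Suc ` J. B (i - 1)) = (\<Prod>i\<in>Suc ` J. prob (B (i - 1)))"
        by (rule indep_setsD[OF ind]) (use J B in auto)
      then show "prob (\<Inter>j\<in>J. B j) = (\<Prod>j\<in>J. prob (B j))"
        by (simp add: prod.reindex)
    qed
    then show ?thesis by (rule indep_vars_compose2) simp
  qed
  moreover have mean: "expectation (?Y n) = 0" for n using X_expectation[of g n] g_mean by simp
  moreover have "integrable M (\<lambda>w. (?Y n w)\<^sup>2)" for n using g_power_integrable[of 2 n] by simp
  moreover have "variance (?Y n) = (sqrt s2)\<^sup>2" for n
    using X_expectation[of "\<lambda>x. (g x)\<^sup>2" n] s2_nonneg mean by simp (simp add: s2_def)
  moreover have "distr M borel (?Y n) = distr (distr M (count_space UNIV) (X 1)) borel g" for n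
    by (subst X_distr[of n, symmetric], subst distr_distr) (auto simp: comp_def)
  ultimately have "weak_conv_m (\<lambda>n. distr M borel (\<lambda>w. (\<Sum>i<n. ?Y i w) / sqrt (real n * (sqrt s2)\<^sup>2)))
      std_normal_distribution"
    using assms by (intro central_limit_theorem_zero_mean) auto
  then show ?thesis using s2_nonneg by (simp add: psum_def)
qed

end

section \<open>Stability of the central limit theorem under errors small in L1\<close>

lemma iexp_diff_le: "cmod (iexp a - iexp b) \<le> \<bar>a - b\<bar>"
proof -
  have "iexp a - iexp b = iexp b * (iexp (a - b) - 1)"
    by (simp add: algebra_simps flip: exp_add)
  then have "cmod (iexp a - iexp b) = cmod (iexp (a - b) - 1)" by (simp add: norm_mult)
  also have "\<dots> \<le> \<bar>a - b\<bar>" using iexp_approx1[of "a - b" 0] by simp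
  finally show ?thesis .
qed

text \<open>Takes the part of Slutsky's theorem: variables close in L1 have close characteristic
  functions, as the exponential is 1-Lipschitz on the imaginary axis.\<close>

lemma (in prob_space) char_distance:
  assumes [measurable]: "f \<in> borel_measurable M" "g \<in> borel_measurable M"
    and int: "integrable M (\<lambda>w. \<bar>f w - g w\<bar>)"
  shows "cmod (char (distr M borel f) t - char (distr M borel g) t) \<le> \<bar>t\<bar> * expectation (\<lambda>w. \<bar>f w - g w\<bar>)"
proof -
  have i: "integrable M (\<lambda>w. iexp (t * f w))" "integrable M (\<lambda>w. iexp (t * g w))"
    by (auto intro!: integrable_iexp)
  have "char (distr M borel f) t - char (distr M borel g) t =
      (CLINT w|M. iexp (t * f w) - iexp (t * g w))"
    using i by (simp add: char_def integral_distr)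
  also have "cmod \<dots> \<le> (\<integral>w. cmod (iexp (t * f w) - iexp (t * g w)) \<partial>M)"
    by (rule integral_norm_bound)
  also have "\<dots> \<le> (\<integral>w. \<bar>t\<bar> * \<bar>f w - g w\<bar> \<partial>M)"
  proof (rule integral_mono)
    show "integrable M (\<lambda>w. cmod (iexp (t * f w) - iexp (t * g w)))"
      using i by (intro integrable_norm Bochner_Integration.integrable_diff)
    show "cmod (iexp (t * f w) - iexp (t * g w)) \<le> \<bar>t\<bar> * \<bar>f w - g w\<bar>" for w
      using iexp_diff_le[of "t * f w" "t * g w"] by (simp add: right_diff_distrib[symmetric] abs_mult)
  qed (use int in simp)
  also have "\<dots> = \<bar>t\<bar> * expectation (\<lambda>w. \<bar>f w - g w\<bar>)" by simp
  finally show ?thesis .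
qed

text \<open>As an image of the standard normal law, the limit has a characteristic function obtained
  by scaling the argument.\<close>

lemma normal_density_scale:
  assumes "c > 0"
  shows "density lborel (\<lambda>t. ennreal (normal_density 0 c t)) = distr std_normal_distribution borel (\<lambda>x. c * x)"
proof -
  interpret N: real_distribution std_normal_distribution by (rule real_dist_normal_dist)
  have d: "distr std_normal_distribution lborel (\<lambda>x. x) = std_normal_distribution"
    by (subst distr_id2) auto
  have "distributed std_normal_distribution lborel (\<lambda>x. x) std_normal_density"
    using d by (auto simp: distributed_def)
  then have "distributed std_normal_distribution lborel (\<lambda>x. (c * x - 0) / c) std_normal_density"
    using assms by simp
  then have "distributed std_normal_distribution lborel (\<lambda>x. c * x) (normal_density 0 c)"
    using N.normal_standard_normal_convert[of c "\<lambda>x. c * x" 0] assms by simp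
  then have "distr std_normal_distribution lborel (\<lambda>x. c * x) = density lborel (normal_density 0 c)"
    by (rule distributed_distr_eq_density)
  moreover have "distr std_normal_distribution lborel (\<lambda>x. c * x) = distr std_normal_distribution borel (\<lambda>x. c * x)"
    by (rule distr_cong) auto
  ultimately show ?thesis by simp
qed

context weighted_sum
begin

text \<open>Q n is compared with c times the standardised sum of m n terms, where c = sqrt (r * s2).
  The L1 error has two parts: the one assumed small, and the one from normalising by sqrt n instead
  of by the number of terms.\<close>

lemma perturbed_clt:
  assumes s2: "s2 > 0" and r: "r > 0" and m: "(\<lambda>n. real (m n) / real n) \<longlonglongrightarrow> r"
    and Q [measurable]: "\<And>n. Q n \<in> borel_measurable M"
    and int: "\<And>n. integrable M (\<lambda>w. \<bar>Q n w - psum (m n) w / sqrt (real n)\<bar>)"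
    and lim: "(\<lambda>n. expectation (\<lambda>w. \<bar>Q n w - psum (m n) w / sqrt (real n)\<bar>)) \<longlonglongrightarrow> 0"
  shows "weak_conv_m (\<lambda>n. distr M borel (Q n))
    (density lborel (\<lambda>t. ennreal (normal_density 0 (sqrt (r * s2)) t)))"
proof -
  define c where "c = sqrt (r * s2)"
  have c: "c > 0" using r s2 by (simp add: c_def)
  interpret N: real_distribution std_normal_distribution by (rule real_dist_normal_dist)
  define Z where "Z n w = psum n w / sqrt (real n * s2)" for n w
  have [measurable]: "Z n \<in> borel_measurable M" for n unfolding Z_def[abs_def] by measurable
  have m_top: "filterlim m at_top sequentially"
  proof -
    have "filterlim (\<lambda>n. real (m n) / real n * real n) at_top sequentially"
      by (rule filterlim_tendsto_pos_mult_at_top[OF m r filterlim_real_sequentially])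
    moreover have "\<forall>\<^sub>F n in sequentially. real (m n) / real n * real n = real (m n)"
      using eventually_gt_at_top[of 0] by eventually_elim simp
    ultimately have "filterlim (\<lambda>n. real (m n)) at_top sequentially"
      using filterlim_cong[OF refl refl] by fast
    then show ?thesis by (simp add: filterlim_sequentially_iff_filterlim_real)
  qed
  have charZ: "(\<lambda>n. char (distr M borel (Z n)) t) \<longlonglongrightarrow> char std_normal_distribution t" for t
    unfolding Z_def[abs_def]
    by (rule levy_continuity1[OF _ real_dist_normal_dist psum_clt[OF s2]])
      (simp add: real_distribution_distr)
  have Eabs: "integrable M (\<lambda>w. \<bar>psum n w\<bar>)" "expectation (\<lambda>w. \<bar>psum n w\<bar>) \<le> sqrt (s2 * real n)" for n
    using expectation_abs_le_sqrt[OF psum_rv psum_second(1), of n] by (simp_all add: psum_second)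
  \<comment> \<open>d n is the normalisation error: the L1 norm of \<open>psum (m n)\<close> is at
    most sqrt (s2 * m n), which cancels the denominator in \<open>pt\<close>.\<close>
  define d where "d n = \<bar>sqrt (real (m n) / real n * s2) - c\<bar>" for n
  have pt: "\<bar>psum (m n) w / sqrt (real n) - c * Z (m n) w\<bar> =
      (d n / sqrt (real (m n) * s2)) * \<bar>psum (m n) w\<bar>" for n w
  proof (cases "m n = 0")
    case True
    then show ?thesis by (simp add: psum_def Z_def)
  next
    case False
    have "psum (m n) w / sqrt (real n) - c * Z (m n) w =
        (sqrt (real (m n) / real n * s2) - c) / sqrt (real (m n) * s2) * psum (m n) w"
      using False s2 by (cases "n = 0") (simp_all add: Z_def real_sqrt_mult real_sqrt_divide field_simps)
    then show ?thesis using s2 by (simp add: d_def abs_mult)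
  qed
  have dlim: "d \<longlonglongrightarrow> 0"
  proof -
    have "(\<lambda>n. \<bar>sqrt (real (m n) / real n * s2) - c\<bar>) \<longlonglongrightarrow> \<bar>sqrt (r * s2) - c\<bar>"
      by (intro tendsto_intros m)
    then show ?thesis by (simp add: d_def[abs_def] c_def)
  qed
  have i2: "integrable M (\<lambda>w. \<bar>psum (m n) w / sqrt (real n) - c * Z (m n) w\<bar>)" for n
    unfolding pt using Eabs(1) by simp
  have e2: "expectation (\<lambda>w. \<bar>psum (m n) w / sqrt (real n) - c * Z (m n) w\<bar>) \<le> d n" for n
  proof -
    have "expectation (\<lambda>w. \<bar>psum (m n) w / sqrt (real n) - c * Z (m n) w\<bar>) =
        (d n / sqrt (real (m n) * s2)) * expectation (\<lambda>w. \<bar>psum (m n) w\<bar>)"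
      unfolding pt by simp
    also have "\<dots> \<le> (d n / sqrt (real (m n) * s2)) * sqrt (s2 * real (m n))"
      using s2 by (intro mult_left_mono Eabs(2)) (auto simp: d_def)
    also have "\<dots> \<le> d n" using s2 by (simp add: d_def mult.commute)
    finally show ?thesis .
  qed
  have tri: "\<bar>Q n w - c * Z (m n) w\<bar> \<le> \<bar>Q n w - psum (m n) w / sqrt (real n)\<bar> +
      \<bar>psum (m n) w / sqrt (real n) - c * Z (m n) w\<bar>" for n w by linarith
  have i3: "integrable M (\<lambda>w. \<bar>Q n w - c * Z (m n) w\<bar>)" for n
    by (rule Bochner_Integration.integrable_bound[OF Bochner_Integration.integrable_add[OF int i2]])
      (use tri in \<open>auto intro!: AE_I2\<close>)
  have e3: "expectation (\<lambda>w. \<bar>Q n w - c * Z (m n) w\<bar>) \<le>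
      expectation (\<lambda>w. \<bar>Q n w - psum (m n) w / sqrt (real n)\<bar>) + d n" for n
  proof -
    have "expectation (\<lambda>w. \<bar>Q n w - c * Z (m n) w\<bar>) \<le>
       expectation (\<lambda>w. \<bar>Q n w - psum (m n) w / sqrt (real n)\<bar> +
         \<bar>psum (m n) w / sqrt (real n) - c * Z (m n) w\<bar>)"
      by (intro integral_mono i3 Bochner_Integration.integrable_add int i2 tri)
    then show ?thesis using e2[of n] by (simp add: Bochner_Integration.integral_add[OF int i2])
  qed
  have "(\<lambda>n. char (distr M borel (Q n)) t) \<longlonglongrightarrow> char (distr std_normal_distribution borel (\<lambda>x. c * x)) t" for t
  proof -
    have cZ: "char (distr M borel (\<lambda>w. c * Z n w)) t = char (distr M borel (Z n)) (c * t)" for n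
      by (simp add: char_def integral_distr mult_ac)
    have cN: "char (distr std_normal_distribution borel (\<lambda>x. c * x)) t = char std_normal_distribution (c * t)"
      by (simp add: char_def integral_distr mult_ac)
    have "(\<lambda>n. char (distr M borel (Q n)) t - char (distr M borel (\<lambda>w. c * Z (m n) w)) t) \<longlonglongrightarrow> 0"
    proof (rule Lim_null_comparison)
      show "\<forall>\<^sub>F n in sequentially. norm (char (distr M borel (Q n)) t - char (distr M borel (\<lambda>w. c * Z (m n) w)) t)
          \<le> \<bar>t\<bar> * (expectation (\<lambda>w. \<bar>Q n w - psum (m n) w / sqrt (real n)\<bar>) + d n)"
      proof (intro always_eventually allI)
        fix n
        have "norm (char (distr M borel (Q n)) t - char (distr M borel (\<lambda>w. c * Z (m n) w)) t)
            \<le> \<bar>t\<bar> * expectation (\<lambda>w. \<bar>Q n w - c * Z (m n) w\<bar>)"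
          by (rule char_distance) (use i3 in auto)
        also have "\<dots> \<le> \<bar>t\<bar> * (expectation (\<lambda>w. \<bar>Q n w - psum (m n) w / sqrt (real n)\<bar>) + d n)"
          by (intro mult_left_mono e3) simp
        finally show "norm (char (distr M borel (Q n)) t - char (distr M borel (\<lambda>w. c * Z (m n) w)) t)
          \<le> \<bar>t\<bar> * (expectation (\<lambda>w. \<bar>Q n w - psum (m n) w / sqrt (real n)\<bar>) + d n)" .
      qed
      show "(\<lambda>n. \<bar>t\<bar> * (expectation (\<lambda>w. \<bar>Q n w - psum (m n) w / sqrt (real n)\<bar>) + d n)) \<longlonglongrightarrow> 0"
        using tendsto_mult_left[OF tendsto_add[OF lim dlim], of "\<bar>t\<bar>"] by simp
    qed
    moreover have "(\<lambda>n. char (distr M borel (\<lambda>w. c * Z (m n) w)) t) \<longlonglongrightarrow> char std_normal_distribution (c * t)"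
      unfolding cZ using filterlim_compose[OF charZ m_top] by simp
    ultimately show ?thesis unfolding cN using tendsto_add by fastforce
  qed
  then have "weak_conv_m (\<lambda>n. distr M borel (Q n)) (distr std_normal_distribution borel (\<lambda>x. c * x))"
    by (intro levy_continuity real_distribution_distr N.real_distribution_distr) auto
  then show ?thesis using normal_density_scale[OF c] by (simp add: c_def)
qed

end

section \<open>Renewal reward processes\<close>

lemma abs_le_one_plus_power4: "\<bar>t\<bar> \<le> 1 + t ^ 4" for t :: real
proof (cases "\<bar>t\<bar> \<le> 1")
  case True
  moreover have "0 \<le> t ^ 4" by simp
  ultimately show ?thesis by linarith
next
  case False
  then have "\<bar>t\<bar> ^ 1 \<le> \<bar>t\<bar> ^ 4" by (intro power_increasing) auto
  then show ?thesis by simp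
qed

text \<open>The expected sum of the fourth powers is finite, so the sum is finite almost surely and
  its terms tend to 0.\<close>

lemma (in prob_space) summable_fourth_AE:
  fixes f :: "nat \<Rightarrow> 'a \<Rightarrow> real"
  assumes [measurable]: "\<And>n. f n \<in> borel_measurable M"
    and int: "\<And>n. integrable M (\<lambda>w. f n w ^ 4)"
    and sum: "summable (\<lambda>n. expectation (\<lambda>w. f n w ^ 4))"
  shows "AE w in M. (\<lambda>n. f n w) \<longlonglongrightarrow> 0"
proof -
  have "(\<integral>\<^sup>+w. (\<Sum>n. ennreal (f n w ^ 4)) \<partial>M) = (\<Sum>n. \<integral>\<^sup>+w. ennreal (f n w ^ 4) \<partial>M)"
    by (rule nn_integral_suminf) measurable
  also have "\<dots> = (\<Sum>n. ennreal (expectation (\<lambda>w. f n w ^ 4)))"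
    using int by (intro suminf_cong nn_integral_eq_integral) auto
  also have "\<dots> < \<infinity>" using sum by (subst suminf_ennreal2) auto
  finally have "AE w in M. (\<Sum>n. ennreal (f n w ^ 4)) \<noteq> \<infinity>"
    by (intro nn_integral_PInf_AE) auto
  then show ?thesis
  proof eventually_elim
    case (elim w)
    then have "summable (\<lambda>n. f n w ^ 4)" by (intro summable_suminf_not_top) auto
    then have "(\<lambda>n. f n w ^ 4) \<longlonglongrightarrow> 0" by (rule summable_LIMSEQ_zero)
    then have "(\<lambda>n. root 4 (f n w ^ 4)) \<longlonglongrightarrow> root 4 0" by (rule tendsto_real_root)
    then have "(\<lambda>n. \<bar>root 4 (f n w ^ 4)\<bar>) \<longlonglongrightarrow> 0" by (intro tendsto_rabs_zero) simp
    then have "(\<lambda>n. \<bar>f n w\<bar>) \<longlonglongrightarrow> 0" by (simp only: root_abs_power[OF zero_less_numeral])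
    then show ?case by (rule tendsto_rabs_zero_cancel)
  qed
qed

text \<open>Block Suc i counts for n if it starts before n, a condition on
  \<open>hist (Suc i)\<close>; the random number of blocks thus becomes a family of predictable 0-1
  coefficients. R n collects the boundary effects at 0 and n.\<close>

locale renewal_reward = discrete_sequence M X for M :: "'a measure" and X :: "nat \<Rightarrow> 'a \<Rightarrow> nat \<times> nat" +
  fixes H R :: "nat \<Rightarrow> 'a \<Rightarrow> real" and C :: real
  assumes gap4: "integrable M (\<lambda>w. real (fst (X 1 w)) ^ 4)"
    and reward4: "integrable M (\<lambda>w. real (snd (X 1 w)) ^ 4)"
    and gap_mean: "expectation (\<lambda>w. real (fst (X 1 w))) \<ge> 1"
    and H_rv [measurable]: "\<And>n. H n \<in> borel_measurable M" and R_rv [measurable]: "\<And>n. R n \<in> borel_measurable M"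
    and R4: "\<And>n. integrable M (\<lambda>w. R n w ^ 4)" "\<And>n. expectation (\<lambda>w. R n w ^ 4) \<le> C"
    and H_approx: "\<And>n. AE w in M. \<bar>H n w - (\<Sum>i<n. of_bool (sum_list (map fst (hist (Suc i) w)) < n) * real (snd (X (Suc i) w)))\<bar> \<le> R n w"
    and N_approx: "\<And>n. AE w in M. \<bar>real n - (\<Sum>i<n. of_bool (sum_list (map fst (hist (Suc i) w)) < n) * real (fst (X (Suc i) w)))\<bar> \<le> R n w"
begin

definition EP :: real where "EP = expectation (\<lambda>w. real (fst (X 1 w)))"
definition EH :: real where "EH = expectation (\<lambda>w. real (snd (X 1 w)))"
definition \<mu> :: real where "\<mu> = EH / EP"
definition g :: "nat \<times> nat \<Rightarrow> real" where "g z = real (snd z) - \<mu> * real (fst z)"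
definition gP :: "nat \<times> nat \<Rightarrow> real" where "gP z = real (fst z) - EP"
text \<open>If v consists of the blocks 0 to i, the sum is the starting point of the block after them.\<close>

definition act :: "nat \<Rightarrow> nat \<Rightarrow> (nat \<times> nat) list \<Rightarrow> real" where
  "act n i v = of_bool (sum_list (map fst v) < n)"
definition N :: "nat \<Rightarrow> 'a \<Rightarrow> real" where "N n w = (\<Sum>i<n. act n i (hist (Suc i) w))"

lemma EP1: "EP \<ge> 1" using gap_mean by (simp add: EP_def)

lemma fst_int: "integrable M (\<lambda>w. real (fst (X 1 w)))" and snd_int: "integrable M (\<lambda>w. real (snd (X 1 w)))"
  using integrable_power_le4(1)[OF _ gap4, of 1] integrable_power_le4(1)[OF _ reward4, of 1] by simp_all

lemma mu_nonneg: "0 \<le> \<mu>"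
  using EP1 by (simp add: EH_def \<mu>_def)

lemma affine4:
  assumes f: "integrable M (\<lambda>w. f w ^ 4)" "integrable M (\<lambda>w. h w ^ 4)"
    and [measurable]: "f \<in> borel_measurable M" "h \<in> borel_measurable M"
  shows "integrable M (\<lambda>w. (f w + h w :: real) ^ 4)"
  by (rule Bochner_Integration.integrable_bound[of M "\<lambda>w. 8 * f w ^ 4 + 8 * h w ^ 4"])
    (use f power4_add_le in \<open>auto intro!: AE_I2 simp: abs_of_nonneg\<close>)

sublocale G: weighted_sum M X g
proof
  have "integrable M (\<lambda>w. (real (snd (X 1 w)) + (- \<mu>) * real (fst (X 1 w))) ^ 4)"
    by (rule affine4) (use reward4 gap4 in \<open>auto simp: power_mult_distrib\<close>)
  then show "integrable M (\<lambda>w. g (X 1 w) ^ 4)" by (simp add: g_def)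
  show "expectation (\<lambda>w. g (X 1 w)) = 0"
    using fst_int snd_int EP1 by (simp add: g_def EP_def[symmetric] EH_def[symmetric] \<mu>_def)
      (simp add: EP_def EH_def)
qed

sublocale P: weighted_sum M X gP
proof
  have "integrable M (\<lambda>w. (real (fst (X 1 w)) + (- EP)) ^ 4)"
    by (rule affine4) (use gap4 in auto)
  then show "integrable M (\<lambda>w. gP (X 1 w) ^ 4)" by (simp add: gP_def)
  show "expectation (\<lambda>w. gP (X 1 w)) = 0"
    using fst_int by (simp add: gP_def prob_space) (simp add: EP_def)
qed

abbreviation "sig2 \<equiv> G.s2"

lemma act_bound: "\<bar>act n i v\<bar> \<le> 1" by (simp add: act_def)

lemma C_nonneg: "0 \<le> C"
  using R4(2)[of 0] by (rule order_trans[rotated]) simp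

lemma R1: "integrable M (\<lambda>w. \<bar>R n w\<bar>)" "expectation (\<lambda>w. \<bar>R n w\<bar>) \<le> 1 + C"
proof -
  show i: "integrable M (\<lambda>w. \<bar>R n w\<bar>)" using integrable_power_le4(2)[OF R_rv R4(1), of 1] by simp
  have "expectation (\<lambda>w. \<bar>R n w\<bar>) \<le> expectation (\<lambda>w. 1 + R n w ^ 4)"
    by (intro integral_mono i Bochner_Integration.integrable_add R4 abs_le_one_plus_power4) simp
  also have "\<dots> = 1 + expectation (\<lambda>w. R n w ^ 4)" using R4(1) by (simp add: prob_space)
  finally show "expectation (\<lambda>w. \<bar>R n w\<bar>) \<le> 1 + C" using R4(2)[of n] by simp
qed

text \<open>\<mu> times the estimate for n is subtracted from the estimate for H; the two sums merge
  into one over \<open>g\<close>, and the errors add up to 1 + \<mu> times R.\<close>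

lemma H_decomp: "AE w in M. \<bar>H n w - \<mu> * real n - G.wsum (act n) n w\<bar> \<le> (1 + \<mu>) * R n w"
  using H_approx[of n] N_approx[of n]
proof eventually_elim
  case (elim w)
  let ?S = "\<Sum>i<n. act n i (hist (Suc i) w) * real (snd (X (Suc i) w))"
  let ?P = "\<Sum>i<n. act n i (hist (Suc i) w) * real (fst (X (Suc i) w))"
  have w: "G.wsum (act n) n w = ?S - \<mu> * ?P"
    by (simp add: G.wsum_def g_def right_diff_distrib sum_subtractf sum_distrib_left mult_ac)
  have e: "\<bar>H n w - ?S\<bar> \<le> R n w" "\<bar>real n - ?P\<bar> \<le> R n w" using elim by (simp_all only: act_def)
  have "\<mu> * \<bar>real n - ?P\<bar> \<le> \<mu> * R n w" using e(2) mu_nonneg by (intro mult_left_mono)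
  moreover have "H n w - \<mu> * real n - G.wsum (act n) n w = (H n w - ?S) - \<mu> * (real n - ?P)"
    unfolding w by (simp add: algebra_simps)
  moreover have "\<bar>(H n w - ?S) - \<mu> * (real n - ?P)\<bar> \<le> \<bar>H n w - ?S\<bar> + \<mu> * \<bar>real n - ?P\<bar>"
    using abs_triangle_ineq4[of "H n w - ?S" "\<mu> * (real n - ?P)"] mu_nonneg
    by (simp only: abs_mult abs_of_nonneg)
  ultimately show ?case using e(1) unfolding distrib_right mult_1 by linarith
qed

text \<open>The same with \<open>gP\<close>: EP times the number of blocks differs from n by a
  martingale term and the boundary error.\<close>

lemma N_decomp: "AE w in M. \<bar>EP * N n w - real n\<bar> \<le> \<bar>P.wsum (act n) n w\<bar> + R n w"
  using N_approx[of n]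
proof eventually_elim
  case (elim w)
  have "P.wsum (act n) n w = (\<Sum>i<n. act n i (hist (Suc i) w) * real (fst (X (Suc i) w))) - EP * N n w"
    by (simp add: P.wsum_def gP_def N_def right_diff_distrib sum_subtractf sum_distrib_left mult_ac)
  then show ?case using elim by (simp add: act_def)
qed

lemma wsum_rv [measurable]: "G.wsum c n \<in> borel_measurable M" "P.wsum c n \<in> borel_measurable M"
  unfolding G.wsum_def[abs_def] P.wsum_def[abs_def] by measurable

lemma N_rv [measurable]: "N n \<in> borel_measurable M"
  unfolding N_def[abs_def] by measurable

lemma fourth_moment:
  shows "integrable M (\<lambda>w. (H n w - \<mu> * real n) ^ 4)"
    and "\<exists>K. \<forall>n\<ge>1. expectation (\<lambda>w. (H n w - \<mu> * real n) ^ 4) \<le> K * (real n)\<^sup>2"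
proof -
  define K0 where "K0 = 8 * sig2\<^sup>2 + 3 * G.s4"
  have iG: "integrable M (\<lambda>w. G.wsum (act n) n w ^ 4)" "expectation (\<lambda>w. G.wsum (act n) n w ^ 4) \<le> K0 * (real n)\<^sup>2" for n
    unfolding K0_def by (rule G.wsum_integrable4 G.wsum_fourth; rule act_bound)+
  have bd: "AE w in M. (H n w - \<mu> * real n) ^ 4 \<le> 8 * G.wsum (act n) n w ^ 4 + 8 * (1 + \<mu>) ^ 4 * R n w ^ 4" for n
    using H_decomp[of n]
  proof eventually_elim
    case (elim w)
    let ?d = "H n w - \<mu> * real n - G.wsum (act n) n w"
    have "\<bar>?d\<bar> ^ 4 \<le> ((1 + \<mu>) * R n w) ^ 4" using elim by (intro power_mono) auto
    then have "?d ^ 4 \<le> (1 + \<mu>) ^ 4 * R n w ^ 4" by (simp add: power_mult_distrib)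
    then show ?case using power4_add_le[of "G.wsum (act n) n w" ?d] by simp
  qed
  have ib: "integrable M (\<lambda>w. 8 * G.wsum (act n) n w ^ 4 + 8 * (1 + \<mu>) ^ 4 * R n w ^ 4)" for n
    using iG(1) R4(1) by simp
  show i: "integrable M (\<lambda>w. (H n w - \<mu> * real n) ^ 4)" for n
    by (rule Bochner_Integration.integrable_bound[OF ib[of n]]) (use bd[of n] in auto)
  have "expectation (\<lambda>w. (H n w - \<mu> * real n) ^ 4) \<le> (8 * K0 + 8 * (1 + \<mu>) ^ 4 * C) * (real n)\<^sup>2" if n: "n \<ge> 1" for n
  proof -
    have "expectation (\<lambda>w. (H n w - \<mu> * real n) ^ 4) \<le>
        expectation (\<lambda>w. 8 * G.wsum (act n) n w ^ 4 + 8 * (1 + \<mu>) ^ 4 * R n w ^ 4)"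
      by (rule integral_mono_AE[OF i ib bd])
    also have "\<dots> = 8 * expectation (\<lambda>w. G.wsum (act n) n w ^ 4) + 8 * (1 + \<mu>) ^ 4 * expectation (\<lambda>w. R n w ^ 4)"
      using iG(1) R4(1) by simp
    also have "\<dots> \<le> 8 * (K0 * (real n)\<^sup>2) + 8 * (1 + \<mu>) ^ 4 * C"
      using iG(2)[of n] R4(2)[of n] mu_nonneg by (intro add_mono mult_left_mono) auto
    also have "8 * (1 + \<mu>) ^ 4 * C \<le> 8 * (1 + \<mu>) ^ 4 * C * (real n)\<^sup>2"
      using n mu_nonneg C_nonneg mult_left_mono[of 1 "(real n)\<^sup>2" "8 * (1 + \<mu>) ^ 4 * C"] by simp
    finally show ?thesis by (simp add: algebra_simps)
  qed
  then show "\<exists>K. \<forall>n\<ge>1. expectation (\<lambda>w. (H n w - \<mu> * real n) ^ 4) \<le> K * (real n)\<^sup>2" by blast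
qed

lemma H_integrable: "integrable M (H n)"
proof -
  have "integrable M (\<lambda>w. (H n w - \<mu> * real n) ^ 1)"
    by (rule integrable_power_le4(1)[OF _ fourth_moment(1)]) auto
  then have "integrable M (\<lambda>w. (H n w - \<mu> * real n) + \<mu> * real n)"
    by (intro Bochner_Integration.integrable_add) auto
  then show ?thesis by simp
qed

lemma LLN_AE: "AE w in M. (\<lambda>n. H n w / real n) \<longlonglongrightarrow> \<mu>"
proof -
  obtain K where K: "\<And>n. n \<ge> 1 \<Longrightarrow> expectation (\<lambda>w. (H n w - \<mu> * real n) ^ 4) \<le> K * (real n)\<^sup>2"
    using fourth_moment(2) by blast
  define f where "f n w = (H n w - \<mu> * real n) / real n" for n w
  have f4: "f n w ^ 4 = (H n w - \<mu> * real n) ^ 4 / real n ^ 4" for n w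
    by (simp add: f_def power_divide)
  have b: "expectation (\<lambda>w. f n w ^ 4) \<le> K * inverse ((real n)\<^sup>2)" if "n \<ge> 1" for n
  proof -
    have "expectation (\<lambda>w. f n w ^ 4) = expectation (\<lambda>w. (H n w - \<mu> * real n) ^ 4) / real n ^ 4"
      by (simp add: f4)
    also have "\<dots> \<le> K * (real n)\<^sup>2 / real n ^ 4" using K[OF that] by (intro divide_right_mono) auto
    also have "\<dots> = K * inverse ((real n)\<^sup>2)" using that by (simp add: field_simps power2_eq_square power4_eq_xxxx)
    finally show ?thesis .
  qed
  have "AE w in M. (\<lambda>n. f n w) \<longlonglongrightarrow> 0"
  proof (rule summable_fourth_AE)
    show "f n \<in> borel_measurable M" for n unfolding f_def[abs_def] by measurable
    show "integrable M (\<lambda>w. f n w ^ 4)" for n unfolding f4 using fourth_moment(1)[of n] by simp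
    show "summable (\<lambda>n. expectation (\<lambda>w. f n w ^ 4))"
    proof (rule summable_comparison_test'[of "\<lambda>n. K * inverse ((real n)\<^sup>2)" 1])
      show "summable (\<lambda>n. K * inverse ((real n)\<^sup>2))"
        by (intro summable_mult inverse_power_summable) simp
      show "norm (expectation (\<lambda>w. f n w ^ 4)) \<le> K * inverse ((real n)\<^sup>2)" if "n \<ge> 1" for n
        using b[OF that] by simp
    qed
  qed
  then show ?thesis
  proof eventually_elim
    case (elim w)
    then have "(\<lambda>n. f n w + \<mu>) \<longlonglongrightarrow> 0 + \<mu>" by (intro tendsto_add tendsto_const)
    moreover have "\<forall>\<^sub>F n in sequentially. f n w + \<mu> = H n w / real n"
      using eventually_gt_at_top[of 0] by eventually_elim (simp add: f_def field_simps)
    ultimately show ?case using tendsto_cong by fastforce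
  qed
qed

lemma LLN_mean: "(\<lambda>n. expectation (H n) / real n) \<longlonglongrightarrow> \<mu>"
proof -
  obtain K where K: "\<And>n. n \<ge> 1 \<Longrightarrow> expectation (\<lambda>w. (H n w - \<mu> * real n) ^ 4) \<le> K * (real n)\<^sup>2"
    using fourth_moment(2) by blast
  have b: "\<bar>expectation (H n) / real n - \<mu>\<bar> \<le> (1 + K) / sqrt (real n)" if n: "n \<ge> 1" for n
  proof -
    let ?d = "\<lambda>w. H n w - \<mu> * real n"
    \<comment> \<open>The inequality |t| \<le> 1 + t^4 at the scale t = d / sqrt n turns the fourth
      moment bound into an L1 error of order sqrt n.\<close>
    have pt: "\<bar>?d w\<bar> \<le> sqrt (real n) * (1 + ?d w ^ 4 / (real n)\<^sup>2)" for w
    proof -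
      define t where "t = ?d w / sqrt (real n)"
      have "\<bar>t\<bar> \<le> 1 + t ^ 4" by (rule abs_le_one_plus_power4)
      moreover have "t ^ 4 = ?d w ^ 4 / (real n)\<^sup>2"
      proof -
        have "sqrt (real n) ^ 4 = (real n)\<^sup>2" using power_mult[of "sqrt (real n)" 2 2] by simp
        then show ?thesis using n by (simp add: t_def power_divide)
      qed
      moreover have "\<bar>?d w\<bar> = sqrt (real n) * \<bar>t\<bar>" using n by (simp add: t_def)
      ultimately show ?thesis by (simp add: mult_left_mono)
    qed
    have "\<bar>expectation (H n) - \<mu> * real n\<bar> = \<bar>expectation ?d\<bar>"
      using H_integrable by (simp add: prob_space)
    also have "\<dots> \<le> expectation (\<lambda>w. \<bar>?d w\<bar>)" by (rule integral_abs_bound)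
    also have "\<dots> \<le> expectation (\<lambda>w. sqrt (real n) * (1 + ?d w ^ 4 / (real n)\<^sup>2))"
      using H_integrable fourth_moment(1)[of n] by (intro integral_mono pt) auto
    also have "\<dots> = sqrt (real n) * (1 + expectation (\<lambda>w. ?d w ^ 4) / (real n)\<^sup>2)"
      using fourth_moment(1)[of n] by (simp add: prob_space)
    also have "\<dots> \<le> sqrt (real n) * (1 + K)"
      using K[OF n] n by (intro mult_left_mono add_left_mono) (auto simp: field_simps)
    finally have "\<bar>expectation (H n) - \<mu> * real n\<bar> / real n \<le> sqrt (real n) * (1 + K) / real n"
      by (intro divide_right_mono) auto
    moreover have "\<bar>expectation (H n) / real n - \<mu>\<bar> = \<bar>expectation (H n) - \<mu> * real n\<bar> / real n"
    proof -
      have "expectation (H n) / real n - \<mu> = (expectation (H n) - \<mu> * real n) / real n"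
        using n by (simp add: field_simps)
      then show ?thesis by simp
    qed
    moreover have "sqrt (real n) * (1 + K) / real n = (1 + K) / sqrt (real n)"
    proof -
      have "sqrt (real n) * (1 + K) / (sqrt (real n) * sqrt (real n)) = (1 + K) / sqrt (real n)"
        by (rule mult_divide_mult_cancel_left) (use n in simp)
      then show ?thesis by simp
    qed
    ultimately show ?thesis by simp
  qed
  have "(\<lambda>n. expectation (H n) / real n - \<mu>) \<longlonglongrightarrow> 0"
  proof (rule Lim_null_comparison)
    show "\<forall>\<^sub>F n in sequentially. norm (expectation (H n) / real n - \<mu>) \<le> (1 + K) / sqrt (real n)"
      using b by (intro eventually_sequentiallyI[of 1]) simp
    show "(\<lambda>n. (1 + K) / sqrt (real n)) \<longlonglongrightarrow> 0"
      by (intro tendsto_divide_0[OF tendsto_const] filterlim_at_top_imp_at_infinity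
          filterlim_compose[OF sqrt_at_top filterlim_real_sequentially])
  qed
  then show ?thesis by (simp add: LIM_zero_iff)
qed

section \<open>Comparison with a deterministic number of blocks\<close>

definition mean_index :: "nat \<Rightarrow> nat" where "mean_index n = nat \<lfloor>real n / EP\<rfloor>"

text \<open>EP \<ge> 1 keeps the index at most n, so \<open>psum (mean_index n)\<close> is a
  weighted sum over the same range i < n.\<close>

lemma mean_index: "real (mean_index n) \<le> real n / EP" "real n / EP \<le> real (mean_index n) + 1" "mean_index n \<le> n"
proof -
  have nn: "0 \<le> real n / EP" using EP1 by simp
  have le: "real n / EP \<le> real n" using EP1 by (simp add: divide_le_eq mult_le_cancel_left1)
  show a: "real (mean_index n) \<le> real n / EP" "real n / EP \<le> real (mean_index n) + 1"
    using nn unfolding mean_index_def by linarith+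
  then show "mean_index n \<le> n" using le by linarith
qed

text \<open>Starting points do not decrease along the history, so the blocks starting before n form
  an initial segment, of length N.\<close>

lemma N_initial: "\<exists>k\<le>n. (\<forall>i<n. act n i (hist (Suc i) w) = of_bool (i < k)) \<and> N n w = real k"
proof -
  have mono: "sum_list (map fst (hist (Suc i) w)) \<le> sum_list (map fst (hist (Suc j) w))" if "i \<le> j" for i j
    using that by (induction j rule: dec_induct) (auto simp: hist_Suc[of "Suc _"])
  define S where "S = {i. i < n \<and> sum_list (map fst (hist (Suc i) w)) < n}"
  have "S = {..<card S}"
  proof (cases "S = {}")
    case False
    have fin: "finite S" by (auto simp: S_def)
    have "S = {..Max S}"
    proof (intro equalityI subsetI)
      fix i assume "i \<in> {..Max S}"
      moreover have "Max S \<in> S" using fin False by simp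
      ultimately show "i \<in> S" using mono[of i "Max S"] by (auto simp: S_def)
    qed (use fin in auto)
    then show ?thesis by (metis card_atMost lessThan_Suc_atMost)
  qed simp
  then have S: "i \<in> S \<longleftrightarrow> i < card S" for i by blast
  have kn: "card S \<le> n" using card_mono[of "{..<n}" S] by (auto simp: S_def)
  have a: "act n i (hist (Suc i) w) = of_bool (i < card S)" if "i < n" for i
    using S[of i] that by (auto simp: act_def S_def)
  then have "N n w = (\<Sum>i<n. of_bool (i < card S))" unfolding N_def by (intro sum.cong) auto
  also have "\<dots> = (\<Sum>i<card S. 1)" using kn by (intro sum.mono_neutral_cong_right) auto
  finally show ?thesis using a kn by (intro exI[of _ "card S"]) auto
qed

text \<open>A form of Wald's second identity. The difference is a weighted sum with coefficients
  \<open>act\<close> minus the indicator of i < \<open>mean_index n\<close>, which lie in {-1, 0, 1}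
  and are nonzero exactly for the indices between the two counts.\<close>

lemma random_index_L2: "expectation (\<lambda>w. (G.wsum (act n) n w - G.psum (mean_index n) w)\<^sup>2) =
      sig2 * expectation (\<lambda>w. \<bar>N n w - real (mean_index n)\<bar>)"
    "integrable M (\<lambda>w. (G.wsum (act n) n w - G.psum (mean_index n) w)\<^sup>2)"
proof -
  define c where "c i v = act n i v - of_bool (i < mean_index n)" for i v
  have cb: "\<bar>c i v\<bar> \<le> 1" for i v by (auto simp: c_def act_def)
  have "G.psum (mean_index n) w = (\<Sum>i<n. of_bool (i < mean_index n) * g (X (Suc i) w))" for w
    unfolding G.psum_def using mean_index(3)[of n] by (intro sum.mono_neutral_cong_left) auto
  then have w: "G.wsum c n w = G.wsum (act n) n w - G.psum (mean_index n) w" for w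
    by (simp add: G.wsum_def c_def left_diff_distrib sum_subtractf)
  have pt: "(\<Sum>i<n. (c i (hist (Suc i) w))\<^sup>2) = \<bar>N n w - real (mean_index n)\<bar>" for w
  proof -
    obtain k where k: "k \<le> n" "\<forall>i<n. act n i (hist (Suc i) w) = of_bool (i < k)" "N n w = real k"
      using N_initial by blast
    have "(\<Sum>i<n. (c i (hist (Suc i) w))\<^sup>2) = (\<Sum>i<n. of_bool (min k (mean_index n) \<le> i \<and> i < max k (mean_index n)))"
      using k(2) by (intro sum.cong) (auto simp: c_def min_def max_def)
    also have "\<dots> = (\<Sum>i\<in>{min k (mean_index n)..<max k (mean_index n)}. 1)"
      using k(1) mean_index(3)[of n] by (intro sum.mono_neutral_cong_right) auto
    also have "\<dots> = \<bar>N n w - real (mean_index n)\<bar>" by (simp add: k(3) min_def max_def)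
    finally show ?thesis .
  qed
  have ci: "integrable M (\<lambda>w. (c i (hist (Suc i) w))\<^sup>2)" for i
    by (rule integrable_const_bound[of _ 1]) (use cb in \<open>auto intro!: AE_I2 simp: abs_square_le_1\<close>)
  have "expectation (\<lambda>w. (G.wsum c n w)\<^sup>2) = sig2 * (\<Sum>i<n. expectation (\<lambda>w. (c i (hist (Suc i) w))\<^sup>2))"
    by (rule G.wsum_second[OF cb])
  also have "(\<Sum>i<n. expectation (\<lambda>w. (c i (hist (Suc i) w))\<^sup>2)) = expectation (\<lambda>w. \<bar>N n w - real (mean_index n)\<bar>)"
    using ci by (simp add: Bochner_Integration.integral_sum[symmetric] pt)
  finally show "expectation (\<lambda>w. (G.wsum (act n) n w - G.psum (mean_index n) w)\<^sup>2) =
      sig2 * expectation (\<lambda>w. \<bar>N n w - real (mean_index n)\<bar>)" by (simp add: w)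
  have "integrable M (\<lambda>w. G.wsum c n w ^ 2)"
    by (rule integrable_power_le4(1)[OF wsum_rv(1) G.wsum_integrable4[OF cb]]) simp
  then show "integrable M (\<lambda>w. (G.wsum (act n) n w - G.psum (mean_index n) w)\<^sup>2)" by (simp add: w)
qed

text \<open>\<open>N_decomp\<close> is divided by EP \<ge> 1. In 2 + C, 1 is for the rounding in
  \<open>mean_index\<close> and 1 + C for the boundary error by \<open>R1\<close>.\<close>

lemma N_concentration: "expectation (\<lambda>w. \<bar>N n w - real (mean_index n)\<bar>) \<le> sqrt (P.s2 * real n) + 2 + C"
proof -
  have sq: "integrable M (\<lambda>w. (P.wsum (act n) n w)\<^sup>2)"
    by (rule integrable_power_le4(1)[OF wsum_rv(2) P.wsum_integrable4[OF act_bound]]) simp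
  have ai: "integrable M (\<lambda>w. (act n i (hist (Suc i) w))\<^sup>2)" for i
    by (rule integrable_const_bound[of _ 1]) (auto intro!: AE_I2 simp: act_def)
  have "expectation (\<lambda>w. (P.wsum (act n) n w)\<^sup>2) \<le> P.s2 * real n"
  proof -
    have "(\<Sum>i<n. expectation (\<lambda>w. (act n i (hist (Suc i) w))\<^sup>2)) \<le> (\<Sum>i<n. 1)"
    proof (intro sum_mono)
      fix i show "expectation (\<lambda>w. (act n i (hist (Suc i) w))\<^sup>2) \<le> 1"
        using integral_mono[OF ai[of i], of "\<lambda>_. 1"] by (simp add: prob_space act_def)
    qed
    then show ?thesis using P.s2_nonneg by (simp add: P.wsum_second[OF act_bound] mult_left_mono)
  qed
  then have w1: "expectation (\<lambda>w. \<bar>P.wsum (act n) n w\<bar>) \<le> sqrt (P.s2 * real n)"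
    using expectation_abs_le_sqrt(2)[OF wsum_rv(2) sq] by (meson order_trans real_sqrt_le_mono)
  have wi: "integrable M (\<lambda>w. \<bar>P.wsum (act n) n w\<bar>)"
    by (rule expectation_abs_le_sqrt(1)[OF wsum_rv(2) sq])
  have bd: "AE w in M. \<bar>N n w - real (mean_index n)\<bar> \<le> \<bar>P.wsum (act n) n w\<bar> + \<bar>R n w\<bar> + 1"
    using N_decomp[of n]
  proof eventually_elim
    case (elim w)
    have "\<bar>N n w - real n / EP\<bar> = \<bar>EP * N n w - real n\<bar> / EP"
    proof -
      have "N n w - real n / EP = (EP * N n w - real n) / EP" using EP1 by (simp add: field_simps)
      then show ?thesis using EP1 by simp
    qed
    also have "\<dots> \<le> \<bar>EP * N n w - real n\<bar>" using EP1 by (simp add: divide_le_eq mult_le_cancel_left1)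
    finally show ?case using elim mean_index(1,2)[of n] by linarith
  qed
  have bi: "integrable M (\<lambda>w. \<bar>P.wsum (act n) n w\<bar> + \<bar>R n w\<bar> + 1)" using wi R1 by simp
  have "integrable M (\<lambda>w. \<bar>N n w - real (mean_index n)\<bar>)"
    by (rule Bochner_Integration.integrable_bound[OF bi]) (use bd in auto)
  then have "expectation (\<lambda>w. \<bar>N n w - real (mean_index n)\<bar>) \<le> expectation (\<lambda>w. \<bar>P.wsum (act n) n w\<bar> + \<bar>R n w\<bar> + 1)"
    by (rule integral_mono_AE[OF _ bi bd])
  also have "\<dots> = expectation (\<lambda>w. \<bar>P.wsum (act n) n w\<bar>) + expectation (\<lambda>w. \<bar>R n w\<bar>) + 1"
    using wi R1(1) by (simp add: prob_space)
  finally show ?thesis using w1 R1(2)[of n] by linarith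
qed

text \<open>By the two preceding estimates the L1 cost of replacing the random number of blocks by
  \<open>mean_index n\<close> is at most of order n^(1/4), negligible against sqrt n.\<close>

lemma CLT:
  assumes "sig2 > 0"
  shows "weak_conv_m (\<lambda>n. distr M borel (\<lambda>w. (H n w - real n * \<mu>) / sqrt (real n)))
    (density lborel (\<lambda>t. ennreal (normal_density 0 (sqrt (1 / EP * sig2)) t)))"
proof (rule G.perturbed_clt[of "1 / EP" mean_index])
  show "sig2 > 0" "1 / EP > 0" using assms EP1 by auto
  show "(\<lambda>n. real (mean_index n) / real n) \<longlonglongrightarrow> 1 / EP"
  proof (rule tendsto_sandwich)
    show "\<forall>\<^sub>F n in sequentially. real (mean_index n) / real n \<le> 1 / EP"
      using eventually_gt_at_top[of 0]
    proof eventually_elim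
      case (elim n)
      then show ?case using mean_index(1)[of n] EP1 by (simp add: field_simps)
    qed
    show "\<forall>\<^sub>F n in sequentially. 1 / EP - 1 / real n \<le> real (mean_index n) / real n"
      using eventually_gt_at_top[of 0]
    proof eventually_elim
      case (elim n)
      have "(real n / EP - 1) / real n \<le> real (mean_index n) / real n"
        using mean_index(2)[of n] by (intro divide_right_mono) auto
      then show ?case using elim by (simp add: diff_divide_distrib)
    qed
    show "(\<lambda>n. 1 / EP - 1 / real n) \<longlonglongrightarrow> 1 / EP"
      using tendsto_diff[OF tendsto_const lim_1_over_n] by simp
  qed simp
  let ?Q = "\<lambda>n w. (H n w - real n * \<mu>) / sqrt (real n)"
  let ?D = "\<lambda>n w. G.wsum (act n) n w - G.psum (mean_index n) w"
  show "?Q n \<in> borel_measurable M" for n by measurable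
  have Di: "integrable M (\<lambda>w. \<bar>?D n w\<bar>)"
    "expectation (\<lambda>w. \<bar>?D n w\<bar>) \<le> sqrt (sig2 * (sqrt (P.s2 * real n) + 2 + C))" for n
  proof -
    show "integrable M (\<lambda>w. \<bar>?D n w\<bar>)"
      by (rule expectation_abs_le_sqrt(1)[OF _ random_index_L2(2)]) simp
    have "expectation (\<lambda>w. \<bar>?D n w\<bar>) \<le> sqrt (expectation (\<lambda>w. (?D n w)\<^sup>2))"
      by (rule expectation_abs_le_sqrt(2)[OF _ random_index_L2(2)]) simp
    also have "\<dots> \<le> sqrt (sig2 * (sqrt (P.s2 * real n) + 2 + C))"
      unfolding random_index_L2(1) by (intro real_sqrt_le_mono mult_left_mono N_concentration G.s2_nonneg)
    finally show "expectation (\<lambda>w. \<bar>?D n w\<bar>) \<le> sqrt (sig2 * (sqrt (P.s2 * real n) + 2 + C))" .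
  qed
  have bd: "AE w in M. \<bar>?Q n w - G.psum (mean_index n) w / sqrt (real n)\<bar> \<le>
      (\<bar>?D n w\<bar> + (1 + \<mu>) * \<bar>R n w\<bar>) / sqrt (real n)" for n
    using H_decomp[of n]
  proof eventually_elim
    case (elim w)
    have "(1 + \<mu>) * R n w \<le> (1 + \<mu>) * \<bar>R n w\<bar>" using mu_nonneg by (intro mult_left_mono) auto
    then have "\<bar>H n w - real n * \<mu> - G.psum (mean_index n) w\<bar> \<le> \<bar>?D n w\<bar> + (1 + \<mu>) * \<bar>R n w\<bar>"
      using elim by (simp add: mult.commute[of "real n" \<mu>])
    then have "\<bar>H n w - real n * \<mu> - G.psum (mean_index n) w\<bar> / sqrt (real n) \<le>
        (\<bar>?D n w\<bar> + (1 + \<mu>) * \<bar>R n w\<bar>) / sqrt (real n)" by (intro divide_right_mono) auto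
    then show ?case by (simp add: diff_divide_distrib[symmetric])
  qed
  have bi: "integrable M (\<lambda>w. (\<bar>?D n w\<bar> + (1 + \<mu>) * \<bar>R n w\<bar>) / sqrt (real n))" for n
    using Di(1) R1(1) by simp
  show int: "integrable M (\<lambda>w. \<bar>?Q n w - G.psum (mean_index n) w / sqrt (real n)\<bar>)" for n
  proof (rule Bochner_Integration.integrable_bound[OF bi[of n]])
    show "AE w in M. norm \<bar>?Q n w - G.psum (mean_index n) w / sqrt (real n)\<bar> \<le>
        norm ((\<bar>?D n w\<bar> + (1 + \<mu>) * \<bar>R n w\<bar>) / sqrt (real n))"
      using bd[of n] by eventually_elim (simp only: real_norm_def abs_idempotent abs_ge_self[THEN order_trans[rotated]])
  qed measurable
  have le: "expectation (\<lambda>w. \<bar>?Q n w - G.psum (mean_index n) w / sqrt (real n)\<bar>) \<le>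
      (sqrt (sig2 * (sqrt (P.s2 * real n) + 2 + C)) + (1 + \<mu>) * (1 + C)) / sqrt (real n)" for n
  proof -
    have "expectation (\<lambda>w. \<bar>?Q n w - G.psum (mean_index n) w / sqrt (real n)\<bar>) \<le>
        expectation (\<lambda>w. (\<bar>?D n w\<bar> + (1 + \<mu>) * \<bar>R n w\<bar>) / sqrt (real n))"
      by (rule integral_mono_AE[OF int bi bd])
    also have "\<dots> = (expectation (\<lambda>w. \<bar>?D n w\<bar>) + (1 + \<mu>) * expectation (\<lambda>w. \<bar>R n w\<bar>)) / sqrt (real n)"
      using Di(1) R1(1) by simp
    also have "\<dots> \<le> (sqrt (sig2 * (sqrt (P.s2 * real n) + 2 + C)) + (1 + \<mu>) * (1 + C)) / sqrt (real n)"
      using mu_nonneg by (intro divide_right_mono add_mono Di(2) mult_left_mono R1(2)) auto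
    finally show ?thesis .
  qed
  show "(\<lambda>n. expectation (\<lambda>w. \<bar>?Q n w - G.psum (mean_index n) w / sqrt (real n)\<bar>)) \<longlonglongrightarrow> 0"
  proof (rule tendsto_sandwich[OF _ _ tendsto_const])
    show "\<forall>\<^sub>F n in sequentially. expectation (\<lambda>w. \<bar>?Q n w - G.psum (mean_index n) w / sqrt (real n)\<bar>) \<le>
      (sqrt (sig2 * (sqrt (P.s2 * real n) + 2 + C)) + (1 + \<mu>) * (1 + C)) / sqrt (real n)"
      using le by (intro always_eventually) auto
    have "((\<lambda>x. (sqrt (sig2 * (sqrt (P.s2 * x) + 2 + C)) + (1 + \<mu>) * (1 + C)) / sqrt x) \<longlongrightarrow> 0) at_top"
    proof -
      have inv: "((\<lambda>x::real. inverse (sqrt x)) \<longlongrightarrow> 0) at_top"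
        by (rule tendsto_inverse_0_at_top[OF sqrt_at_top])
      \<comment> \<open>Written in the variable 1 / sqrt x, the bound is a continuous function that
        vanishes at 0.\<close>
      have "((\<lambda>x. sqrt (sig2 * (sqrt P.s2 * inverse (sqrt x) + (2 + C) * (inverse (sqrt x))\<^sup>2)) +
          ((1 + \<mu>) * (1 + C)) * inverse (sqrt x)) \<longlongrightarrow> sqrt (sig2 * (sqrt P.s2 * 0 + (2 + C) * 0\<^sup>2)) +
          ((1 + \<mu>) * (1 + C)) * 0) at_top"
        by (intro tendsto_intros inv)
      moreover have "\<forall>\<^sub>F x in at_top. sqrt (sig2 * (sqrt P.s2 * inverse (sqrt x) + (2 + C) * (inverse (sqrt x))\<^sup>2)) +
          ((1 + \<mu>) * (1 + C)) * inverse (sqrt x) =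
          (sqrt (sig2 * (sqrt (P.s2 * x) + 2 + C)) + (1 + \<mu>) * (1 + C)) / sqrt x"
        using eventually_gt_at_top[of "0::real"]
      proof eventually_elim
        case (elim x)
        have e: "sig2 * (sqrt P.s2 * inverse (sqrt x) + (2 + C) * (inverse (sqrt x))\<^sup>2) =
            sig2 * (sqrt (P.s2 * x) + 2 + C) / x"
          using elim by (simp add: real_sqrt_mult field_simps)
        show ?case unfolding e by (simp only: real_sqrt_divide divide_inverse[of _ "sqrt x"] distrib_right[of _ _ "inverse (sqrt x)"])
      qed
      ultimately show ?thesis using tendsto_cong by fastforce
    qed
    then show "(\<lambda>n. (sqrt (sig2 * (sqrt (P.s2 * real n) + 2 + C)) + (1 + \<mu>) * (1 + C)) / sqrt (real n)) \<longlonglongrightarrow> 0"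
      by (rule filterlim_compose[OF _ filterlim_real_sequentially])
  qed simp
qed

end

section \<open>Regeneration at a pivot\<close>

locale percolation = cut_structure l A B Lt Hv m K + D: prob_space D
  for l :: int and A B :: "(int \<times> int) set" and Lt Hv :: "real set" and m :: real and K :: int
    and D :: "real measure" +
  assumes sets_D [measurable_cong]: "sets D = sets borel"
    and Lt_pos: "measure D Lt > 0" and Hv_pos: "measure D Hv > 0" and D_ge: "AE t in D. m \<le> t"
begin

text \<open>The canonical space of configurations. All probability is done here; the given weights
  are mapped to it at the end.\<close>

definition N :: "(int \<times> int \<Rightarrow> real) measure" where "N = (\<Pi>\<^sub>M e\<in>edges l. D)"

sublocale PP: product_prob_space "\<lambda>_. D" "edges l" ..

sublocale N: prob_space N
  unfolding N_def by (rule PP.P.prob_space_axioms)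

lemma space_D: "space D = UNIV"
  using sets_eq_imp_space_eq[OF sets_D] by simp

lemma space_N: "space N = extensional (edges l)"
  by (auto simp: N_def space_PiM space_D PiE_def)

lemma coord_rv [measurable]: "e \<in> edges l \<Longrightarrow> (\<lambda>w. w e) \<in> borel_measurable N"
proof -
  assume "e \<in> edges l"
  then have "(\<lambda>w. w e) \<in> measurable N D" unfolding N_def by (rule measurable_component_singleton)
  then show ?thesis using measurable_cong_sets[OF refl sets_D, of N] by simp
qed

lemma coord_indep: "N.indep_vars (\<lambda>_. D) (\<lambda>e w. w e) (edges l)"
proof -
  have "(0, 1) \<in> edges l" using l2 by (simp add: edges_def)
  then have ne: "edges l \<noteq> {}" by blast
  have "distr N N (\<lambda>w. \<lambda>e\<in>edges l. w e) = distr N N (\<lambda>w. w)"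
    by (rule distr_cong) (auto simp: space_N extensional_restrict)
  also have "\<dots> = N" by (rule distr_id)
  also have "N = (\<Pi>\<^sub>M e\<in>edges l. distr N D (\<lambda>w. w e))"
    unfolding N_def by (intro PiM_cong refl PP.PiM_component[symmetric])
  finally have "distr N N (\<lambda>w. \<lambda>e\<in>edges l. w e) = (\<Pi>\<^sub>M e\<in>edges l. distr N D (\<lambda>w. w e))" .
  then have "distr N (\<Pi>\<^sub>M e\<in>edges l. D) (\<lambda>w. \<lambda>e\<in>edges l. w e) = (\<Pi>\<^sub>M e\<in>edges l. distr N D (\<lambda>w. w e))"
    by (simp only: N_def)
  then show ?thesis
    by (subst N.indep_vars_iff_distr_eq_PiM'[OF ne]) (auto simp: N_def)
qed

text \<open>Stands for measurability with respect to the weights in I, without forming the generated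
  sigma-algebra.\<close>

definition dep :: "(int \<times> int) set \<Rightarrow> ((int \<times> int \<Rightarrow> real) \<Rightarrow> bool) \<Rightarrow> bool" where
  "dep I F \<longleftrightarrow> (\<forall>w\<in>space N. \<forall>w'\<in>space N. (\<forall>e\<in>I \<inter> edges l. w e = w' e) \<longrightarrow> (F w \<longleftrightarrow> F w'))"

lemma dep_mono: "dep I F \<Longrightarrow> I \<subseteq> J \<Longrightarrow> dep J F"
  unfolding dep_def by blast

lemma dep_conj: "dep I F \<Longrightarrow> dep I G \<Longrightarrow> dep I (\<lambda>w. F w \<and> G w)"
  unfolding dep_def by blast

lemma dep_not: "dep I F \<Longrightarrow> dep I (\<lambda>w. \<not> F w)"
  unfolding dep_def by blast

lemma dep_all: "(\<And>i. i \<in> S \<Longrightarrow> dep I (F i)) \<Longrightarrow> dep I (\<lambda>w. \<forall>i\<in>S. F i w)"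
  unfolding dep_def by blast

text \<open>An event depending on I is a function of the restriction to I: the other coordinates are
  filled from a fixed configuration c. Restrictions to disjoint sets of coordinates are
  independent.\<close>

lemma dep_indep:
  assumes IJ: "I \<inter> J = {}" and dep: "dep I F" "dep J G"
    and F [measurable]: "Measurable.pred N F" and G [measurable]: "Measurable.pred N G"
  shows "N.prob {w\<in>space N. F w \<and> G w} = N.prob {w\<in>space N. F w} * N.prob {w\<in>space N. G w}"
proof -
  obtain c where c: "c \<in> space N" using N.not_empty by blast
  define ext where "ext I' v = (\<lambda>e\<in>edges l. if e \<in> I' then v e else c e)" for I' :: "(int \<times> int) set" and v :: "int \<times> int \<Rightarrow> real"
  have ext_meas: "ext I' \<in> measurable (\<Pi>\<^sub>M e\<in>I' \<inter> edges l. D) N" for I'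
    unfolding ext_def[abs_def] N_def
  proof (rule measurable_restrict)
    fix e assume e: "e \<in> edges l"
    show "(\<lambda>v. if e \<in> I' then v e else c e) \<in> measurable (\<Pi>\<^sub>M e\<in>I' \<inter> edges l. D) D"
      using e by (cases "e \<in> I'") (auto simp: space_D)
  qed
  have ext_eq: "P (ext I' (restrict w (I' \<inter> edges l))) \<longleftrightarrow> P w" if "dep I' P" "w \<in> space N" for I' P w
  proof -
    have "ext I' (restrict w (I' \<inter> edges l)) \<in> space N"
      "\<forall>e\<in>I' \<inter> edges l. ext I' (restrict w (I' \<inter> edges l)) e = w e"
      by (auto simp: ext_def space_N)
    then show ?thesis using that unfolding dep_def by blast
  qed
  let ?FI = "{v\<in>space (\<Pi>\<^sub>M e\<in>I \<inter> edges l. D). F (ext I v)}"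
  let ?GJ = "{v\<in>space (\<Pi>\<^sub>M e\<in>J \<inter> edges l. D). G (ext J v)}"
  have FI: "?FI \<in> sets (\<Pi>\<^sub>M e\<in>I \<inter> edges l. D)"
    using measurable_sets_Collect[OF ext_meas, of F I] measurable_compose[OF ext_meas F, of I] by simp
  have GJ: "?GJ \<in> sets (\<Pi>\<^sub>M e\<in>J \<inter> edges l. D)"
    using measurable_compose[OF ext_meas G, of J] by simp
  have iv: "N.indep_var (\<Pi>\<^sub>M e\<in>I \<inter> edges l. D) (\<lambda>w. restrict (\<lambda>e. w e) (I \<inter> edges l))
      (\<Pi>\<^sub>M e\<in>J \<inter> edges l. D) (\<lambda>w. restrict (\<lambda>e. w e) (J \<inter> edges l))"
    by (rule N.indep_var_restrict[OF coord_indep]) (use IJ in auto)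
  have sp: "restrict w (I' \<inter> edges l) \<in> space (\<Pi>\<^sub>M e\<in>I' \<inter> edges l. D)" for w :: "int \<times> int \<Rightarrow> real" and I'
    by (auto simp: space_PiM space_D)
  have "N.prob ((\<lambda>w. (restrict w (I \<inter> edges l), restrict w (J \<inter> edges l))) -` (?FI \<times> ?GJ) \<inter> space N) =
      N.prob ((\<lambda>w. restrict w (I \<inter> edges l)) -` ?FI \<inter> space N) *
      N.prob ((\<lambda>w. restrict w (J \<inter> edges l)) -` ?GJ \<inter> space N)"
    by (rule N.indep_varD[OF iv FI GJ])
  also have "(\<lambda>w. (restrict w (I \<inter> edges l), restrict w (J \<inter> edges l))) -` (?FI \<times> ?GJ) \<inter> space N =
      {w\<in>space N. F w \<and> G w}"
    using ext_eq[OF dep(1)] ext_eq[OF dep(2)] sp by auto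
  also have "(\<lambda>w. restrict w (I \<inter> edges l)) -` ?FI \<inter> space N = {w\<in>space N. F w}"
    using ext_eq[OF dep(1)] sp by auto
  also have "(\<lambda>w. restrict w (J \<inter> edges l)) -` ?GJ \<inter> space N = {w\<in>space N. G w}"
    using ext_eq[OF dep(2)] sp by auto
  finally show ?thesis .
qed

section \<open>Translation invariance and measurability on the configuration space\<close>

definition shiftN :: "int \<Rightarrow> (int \<times> int \<Rightarrow> real) \<Rightarrow> int \<times> int \<Rightarrow> real" where
  "shiftN x w = restrict (shift_config x w) (edges l)"

lemma shiftN_eq: "shiftN x w = (\<lambda>e\<in>edges l. w (fst e + x, snd e + x))"
  by (simp add: shiftN_def shift_config_def split_def)

lemma distr_shiftN: "distr N N (shiftN x) = N"
proof -
  have "distr (\<Pi>\<^sub>M e\<in>edges l. D) (\<Pi>\<^sub>M e\<in>edges l. D) (\<lambda>w. \<lambda>e\<in>edges l. w (fst e + x, snd e + x)) = (\<Pi>\<^sub>M e\<in>edges l. D)"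
    by (rule distr_PiM_reindex) (auto simp: inj_on_def edges_def D.prob_space_axioms)
  then show ?thesis by (simp add: N_def shiftN_eq[abs_def])
qed

lemma shiftN_rv [measurable]: "shiftN x \<in> measurable N N"
proof -
  have "(\<lambda>w. \<lambda>e\<in>edges l. w (fst e + x, snd e + x)) \<in> measurable N (\<Pi>\<^sub>M e\<in>edges l. D)"
    unfolding N_def by (intro measurable_restrict measurable_component_singleton) (auto simp: edges_def)
  then show ?thesis by (simp add: N_def shiftN_eq[abs_def])
qed

lemma prob_shiftN:
  assumes [measurable]: "Measurable.pred N F"
  shows "N.prob {w\<in>space N. F (shiftN x w)} = N.prob {w\<in>space N. F w}"
proof -
  have "N.prob {w\<in>space N. F w} = measure (distr N N (shiftN x)) {w\<in>space N. F w}" by (simp only: distr_shiftN)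
  also have "\<dots> = N.prob (shiftN x -` {w\<in>space N. F w} \<inter> space N)" by (rule measure_distr) measurable
  also have "shiftN x -` {w\<in>space N. F w} \<inter> space N = {w\<in>space N. F (shiftN x w)}"
    using measurable_space[OF shiftN_rv] by auto
  finally show ?thesis ..
qed

lemma piv_cong: "(\<And>e. e \<in> edges l \<Longrightarrow> w e = w' e) \<Longrightarrow> piv w x \<longleftrightarrow> piv w' x"
proof -
  assume eq: "\<And>e. e \<in> edges l \<Longrightarrow> w e = w' e"
  have "w (p + x, q + x) = w' (p + x, q + x)" if "(p, q) \<in> A \<union> B" for p q
    by (rule eq) (use that A_edges B_edges in \<open>auto simp: edges_def\<close>)
  then show ?thesis unfolding pivot_at_def by (intro arg_cong2[of _ _ _ _ "(\<and>)"] ball_cong refl) auto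
qed

lemma piv_shiftN: "piv (shiftN x w) y \<longleftrightarrow> piv w (y + x)"
proof -
  have "piv (shiftN x w) y \<longleftrightarrow> piv (shift_config x w) y" by (rule piv_cong) (simp add: shiftN_def)
  also have "\<dots> \<longleftrightarrow> piv w (y + x)" by (simp add: pivot_at_def shift_config_def add.assoc)
  finally show ?thesis .
qed

lemma mhops_shiftN: "mhops l (shiftN x w) u v = mhops l w (u + x) (v + x)"
  using mhops_cong_edges[of l "shiftN x w" "shift_config x w"] by (simp add: shiftN_def mhops_shift)

lemma piv_rv [measurable]: "Measurable.pred N (\<lambda>w. piv w x)"
proof -
  have 1: "Measurable.pred N (\<lambda>w. w (p + x, q + x) \<in> Lt)" if "(p, q) \<in> A" for p q
  proof -
    have "(p + x, q + x) \<in> edges l" using A_edges that by (auto simp: edges_def)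
    then show ?thesis by measurable
  qed
  have 2: "Measurable.pred N (\<lambda>w. w (p + x, q + x) \<in> Hv)" if "(p, q) \<in> B" for p q
  proof -
    have "(p + x, q + x) \<in> edges l" using B_edges that by (auto simp: edges_def)
    then show ?thesis by measurable
  qed
  show ?thesis unfolding pivot_at_def split_def
    by (intro pred_intros_logic pred_intros_finite(3)[OF finite_A] pred_intros_finite(3)[OF finite_B])
      (use 1 2 in auto)
qed

lemma path_weight_rv: "is_path l u v p \<Longrightarrow> (\<lambda>w. path_weight w p) \<in> borel_measurable N"
proof (induction p arbitrary: u rule: induct_list012)
  case (3 a b zs)
  then have "adjacent l a b" "is_path l b v (b # zs)" by (auto simp: is_path_Cons)
  then show ?case using 3 adjacent_edge[of l a b] by (auto simp: edge_weight_def)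
qed auto

lemma minpath_rv [measurable]: "Measurable.pred N (\<lambda>w. minpath l w u v p)"
proof (cases "is_path l u v p")
  case True
  note p = path_weight_rv[OF True]
  have "Measurable.pred N (\<lambda>w. \<forall>q. is_path l u v q \<longrightarrow> path_weight w p \<le> path_weight w q)"
  proof (intro pred_intros_countable)
    fix q show "Measurable.pred N (\<lambda>w. is_path l u v q \<longrightarrow> path_weight w p \<le> path_weight w q)"
    proof (cases "is_path l u v q")
      case True
      show ?thesis using borel_measurable_le[OF p path_weight_rv[OF True]] by (simp add: True pred_def)
    qed simp
  qed
  then show ?thesis by (simp add: minpath_def True)
qed (simp add: minpath_def)

lemma mhops_rv [measurable]: "(\<lambda>w. mhops l w u v) \<in> measurable N (count_space UNIV)"
  unfolding mhops_def by (intro measurable_Least pred_intros_countable) measurable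

lemma AE_good: "AE w in N. good l m w"
proof -
  have c: "countable (edges l)" by simp
  have "AE w in N. \<forall>e\<in>edges l. m \<le> w e"
    unfolding AE_ball_countable[OF c]
  proof
    fix e assume "e \<in> edges l"
    then show "AE w in N. m \<le> w e"
      unfolding N_def using PP.AE_component[of e "\<lambda>t. m \<le> t"] D_ge by simp
  qed
  then show ?thesis by (simp add: good_def)
qed

lemma good_rv [measurable]: "Measurable.pred N (good l m)"
proof -
  have "Measurable.pred N (\<lambda>w. \<forall>e. e \<in> edges l \<longrightarrow> m \<le> w e)"
  proof (intro pred_intros_countable)
    fix e show "Measurable.pred N (\<lambda>w. e \<in> edges l \<longrightarrow> m \<le> w e)"
      by (cases "e \<in> edges l") auto
  qed
  then show ?thesis by (simp add: good_def[abs_def] Ball_def)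
qed

text \<open>A set of positive mass meets the half-line above the almost sure bound m. The two values
  complete half a configuration to a good one.\<close>

lemma witnesses: obtains tL tH where "tL \<in> Lt" "m \<le> tL" "tH \<in> Hv" "m \<le> tH"
proof -
  have *: "\<exists>t\<in>S. m \<le> t" if "S \<in> sets borel" "measure D S > 0" for S
  proof (rule ccontr)
    assume none: "\<not> (\<exists>t\<in>S. m \<le> t)"
    have "AE t in D. t \<notin> S" by (rule AE_mp[OF D_ge]) (use none in auto)
    then have "measure D S = 0" using that(1) by (subst D.prob_eq_0) (auto simp: sets_D)
    then show False using that by simp
  qed
  show ?thesis using *[OF Lt_meas Lt_pos] *[OF Hv_meas Hv_pos] that by blast
qed

lemma prescribed_pos:
  assumes "finite A'" "finite B'" "A' \<subseteq> edges l" "B' \<subseteq> edges l" "A' \<inter> B' = {}"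
  shows "N.prob {w\<in>space N. (\<forall>e\<in>A'. w e \<in> Lt) \<and> (\<forall>e\<in>B'. w e \<in> Hv)} > 0"
proof -
  let ?X = "\<lambda>e. if e \<in> A' then Lt else Hv"
  have "emeasure N {w\<in>space N. \<forall>e\<in>A' \<union> B'. w e \<in> ?X e} = (\<Prod>e\<in>A' \<union> B'. emeasure D (?X e))"
    unfolding N_def by (rule PP.emeasure_PiM_Collect) (use assms in \<open>auto simp: sets_D\<close>)
  also have "\<dots> = ennreal (\<Prod>e\<in>A' \<union> B'. measure D (?X e))"
    by (simp add: D.emeasure_eq_measure prod_ennreal)
  also have "{w\<in>space N. \<forall>e\<in>A' \<union> B'. w e \<in> ?X e} = {w\<in>space N. (\<forall>e\<in>A'. w e \<in> Lt) \<and> (\<forall>e\<in>B'. w e \<in> Hv)}"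
    using assms(5) by auto
  finally have "N.prob {w\<in>space N. (\<forall>e\<in>A'. w e \<in> Lt) \<and> (\<forall>e\<in>B'. w e \<in> Hv)} = (\<Prod>e\<in>A' \<union> B'. measure D (?X e))"
    by (simp add: N.emeasure_eq_measure prod_nonneg)
  moreover have "(\<Prod>e\<in>A' \<union> B'. measure D (?X e)) > 0"
    by (rule prod_pos) (use Lt_pos Hv_pos in auto)
  ultimately show ?thesis by simp
qed

definition piv_prob :: real where "piv_prob = N.prob {w\<in>space N. piv w 0}"

lemma prob_piv: "N.prob {w\<in>space N. piv w x} = piv_prob"
  using prob_shiftN[of "\<lambda>w. piv w 0" x] by (simp add: piv_prob_def piv_shiftN)

lemma piv_prob_pos: "piv_prob > 0"
proof -
  have "{w\<in>space N. piv w 0} = {w\<in>space N. (\<forall>e\<in>A. w e \<in> Lt) \<and> (\<forall>e\<in>B. w e \<in> Hv)}"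
    by (auto simp: pivot_at_def)
  then show ?thesis
    using prescribed_pos[OF finite_A finite_B A_edges B_edges AB_disjoint] by (simp add: piv_prob_def)
qed

text \<open>The edges split into those left of x, right of x and across x, and so do the
  requirements of a pivot at x. On the pivot event, by \<open>left\<close>, F may be evaluated after
  replacing all weights outside the left part by fixed ones for which x is still a pivot; likewise G
  on the right. The three parts are then independent. Multiplying by \<open>piv_prob\<close> avoids
  conditional probabilities.\<close>

lemma regeneration:
  assumes F [measurable]: "Measurable.pred N F" and G [measurable]: "Measurable.pred N G"
    and left: "\<And>w w'. good l m w \<Longrightarrow> good l m w' \<Longrightarrow> piv w x \<Longrightarrow> piv w' x \<Longrightarrow>
      (\<And>p q. (p, q) \<in> edges l \<Longrightarrow> q \<le> x \<Longrightarrow> w (p, q) = w' (p, q)) \<Longrightarrow> F w \<Longrightarrow> F w'"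
    and right: "\<And>w w'. good l m w \<Longrightarrow> good l m w' \<Longrightarrow> piv w x \<Longrightarrow> piv w' x \<Longrightarrow>
      (\<And>p q. (p, q) \<in> edges l \<Longrightarrow> x \<le> p \<Longrightarrow> w (p, q) = w' (p, q)) \<Longrightarrow> G w \<Longrightarrow> G w'"
  shows "N.prob {w\<in>space N. piv w x \<and> F w \<and> G w} * piv_prob =
    N.prob {w\<in>space N. piv w x \<and> F w} * N.prob {w\<in>space N. piv w x \<and> G w}"
proof -
  obtain tL tH where t: "tL \<in> Lt" "m \<le> tL" "tH \<in> Hv" "m \<le> tH" by (rule witnesses)
  \<comment> \<open>A good configuration in which x is a pivot; edges without a requirement receive
    tH as well.\<close>
  define w0 where "w0 = (\<lambda>e\<in>edges l. if (fst e - x, snd e - x) \<in> A then tL else tH)"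
  define L R Ov where "L = {e\<in>edges l. snd e \<le> x}" and "R = {e\<in>edges l. x \<le> fst e}"
    and "Ov = edges l - L - R"
  have LR: "L \<inter> R = {}" by (auto simp: L_def R_def edges_def)
  define con where "con I w \<longleftrightarrow> (\<forall>(p, q)\<in>A. (p + x, q + x) \<in> I \<longrightarrow> w (p + x, q + x) \<in> Lt) \<and>
      (\<forall>(p, q)\<in>B. (p + x, q + x) \<in> I \<longrightarrow> w (p + x, q + x) \<in> Hv)"
    for I and w :: "int \<times> int \<Rightarrow> real"
  \<comment> \<open>Keeps the weights on I and takes the rest from \<open>w0\<close>. The maximum
    with m makes the result good for every w and changes nothing if w is good.\<close>
  define sp where "sp I w = (\<lambda>e\<in>edges l. if e \<in> I then max m (w e) else w0 e)"
    for I and w :: "int \<times> int \<Rightarrow> real"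
  have piv_con: "piv w x \<longleftrightarrow> con L w \<and> con Ov w \<and> con R w" for w
    using AB_shift unfolding pivot_at_def con_def Ov_def by fast
  have w0: "w0 (p + x, q + x) \<in> Lt" if "(p, q) \<in> A" for p q
    using that AB_shift[of p q] t by (auto simp: w0_def)
  have w0': "w0 (p + x, q + x) \<in> Hv" if "(p, q) \<in> B" for p q
    using that AB_shift[of p q] t AB_disjoint by (auto simp: w0_def)
  have good_sp: "good l m (sp I w)" for I w
    using t by (auto simp: good_def sp_def w0_def)
  have piv_sp: "piv (sp I w) x" if "good l m w" "con I w" for I w
    unfolding pivot_at_def
  proof (intro conjI ballI; clarify)
    fix p q assume "(p, q) \<in> A"
    then show "sp I w (p + x, q + x) \<in> Lt"
      using AB_shift[of p q] w0[of p q] that by (force simp: sp_def con_def good_def max_def)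
  next
    fix p q assume "(p, q) \<in> B"
    then show "sp I w (p + x, q + x) \<in> Hv"
      using AB_shift[of p q] w0'[of p q] that by (force simp: sp_def con_def good_def max_def)
  qed
  have sp_rv [measurable]: "sp I \<in> measurable N N" for I
    unfolding sp_def[abs_def]
  proof (subst (2) N_def, rule measurable_restrict)
    fix e assume "e \<in> edges l"
    then have "(\<lambda>w. if e \<in> I then max m (w e) else w0 e) \<in> borel_measurable N" by measurable
    then show "(\<lambda>w. if e \<in> I then max m (w e) else w0 e) \<in> measurable N D"
      using measurable_cong_sets[OF refl sets_D, of N] by simp
  qed
  have con_rv [measurable]: "Measurable.pred N (con I)" for I
  proof -
    have 1: "Measurable.pred N (\<lambda>w. w (p + x, q + x) \<in> Lt)" if "(p, q) \<in> A" for p q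
    proof -
      have "(p + x, q + x) \<in> edges l" using AB_shift that by auto
      then show ?thesis by measurable
    qed
    have 2: "Measurable.pred N (\<lambda>w. w (p + x, q + x) \<in> Hv)" if "(p, q) \<in> B" for p q
    proof -
      have "(p + x, q + x) \<in> edges l" using AB_shift that by auto
      then show ?thesis by measurable
    qed
    show ?thesis unfolding con_def[abs_def] split_def
      by (intro pred_intros_logic pred_intros_finite(3)[OF finite_A] pred_intros_finite(3)[OF finite_B])
        (use 1 2 in auto)
  qed
  have con_dep: "dep I (con I)" for I
    unfolding dep_def con_def using AB_shift by (intro ballI impI arg_cong2[of _ _ _ _ "(\<and>)"] ball_cong refl) auto
  have sp_dep: "dep I (\<lambda>w. con I w \<and> P (sp I w))" for I P
  proof (intro dep_conj con_dep)
    have "sp I w = sp I w'" if "\<forall>e\<in>I \<inter> edges l. w e = w' e" for w w'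
      using that by (auto simp: sp_def)
    then show "dep I (\<lambda>w. P (sp I w))" unfolding dep_def by metis
  qed
  have F': "F w \<longleftrightarrow> F (sp L w)" if "good l m w" "piv w x" for w
  proof -
    have s: "piv (sp L w) x" using that piv_con piv_sp by blast
    have eq: "w (p, q) = sp L w (p, q)" if "(p, q) \<in> edges l" "q \<le> x" for p q
      using \<open>good l m w\<close> that by (auto simp: sp_def L_def good_def max_def)
    show ?thesis
    proof
      show "F (sp L w)" if "F w"
        by (rule left[OF _ good_sp _ s eq that]) (use \<open>good l m w\<close> \<open>piv w x\<close> in auto)
      show "F w" if "F (sp L w)"
        by (rule left[OF good_sp _ s _ eq[symmetric] that]) (use \<open>good l m w\<close> \<open>piv w x\<close> in auto)
    qed
  qed
  have G': "G w \<longleftrightarrow> G (sp R w)" if "good l m w" "piv w x" for w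
  proof -
    have s: "piv (sp R w) x" using that piv_con piv_sp by blast
    have eq: "w (p, q) = sp R w (p, q)" if "(p, q) \<in> edges l" "x \<le> p" for p q
      using \<open>good l m w\<close> that by (auto simp: sp_def R_def good_def max_def)
    show ?thesis
    proof
      show "G (sp R w)" if "G w"
        by (rule right[OF _ good_sp _ s eq that]) (use \<open>good l m w\<close> \<open>piv w x\<close> in auto)
      show "G w" if "G (sp R w)"
        by (rule right[OF good_sp _ s _ eq[symmetric] that]) (use \<open>good l m w\<close> \<open>piv w x\<close> in auto)
    qed
  qed
  have triple: "N.prob {w\<in>space N. (con L w \<and> P (sp L w)) \<and> con Ov w \<and> (con R w \<and> Q (sp R w))} =
      N.prob {w\<in>space N. con L w \<and> P (sp L w)} * N.prob {w\<in>space N. con Ov w} * N.prob {w\<in>space N. con R w \<and> Q (sp R w)}"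
    if [measurable]: "Measurable.pred N P" "Measurable.pred N Q" for P Q
  proof -
    have OR: "dep (Ov \<union> R) (\<lambda>w. con Ov w \<and> (con R w \<and> Q (sp R w)))"
      by (intro dep_conj[OF dep_mono[OF con_dep] dep_mono[OF sp_dep]]) auto
    have "N.prob {w\<in>space N. (con L w \<and> P (sp L w)) \<and> con Ov w \<and> (con R w \<and> Q (sp R w))} =
        N.prob {w\<in>space N. con L w \<and> P (sp L w)} * N.prob {w\<in>space N. con Ov w \<and> (con R w \<and> Q (sp R w))}"
      by (rule dep_indep[OF _ sp_dep OR]) (use LR in \<open>auto simp: Ov_def\<close>)
    also have "N.prob {w\<in>space N. con Ov w \<and> (con R w \<and> Q (sp R w))} =
        N.prob {w\<in>space N. con Ov w} * N.prob {w\<in>space N. con R w \<and> Q (sp R w)}"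
      by (rule dep_indep[OF _ con_dep sp_dep]) (auto simp: Ov_def)
    finally show ?thesis by simp
  qed
  have split: "N.prob {w\<in>space N. piv w x \<and> P w \<and> Q w} =
      N.prob {w\<in>space N. con L w \<and> P (sp L w)} * N.prob {w\<in>space N. con Ov w} * N.prob {w\<in>space N. con R w \<and> Q (sp R w)}"
    if [measurable]: "Measurable.pred N P" "Measurable.pred N Q"
      and PQ: "\<And>w. good l m w \<Longrightarrow> piv w x \<Longrightarrow> P w \<longleftrightarrow> P (sp L w)"
        "\<And>w. good l m w \<Longrightarrow> piv w x \<Longrightarrow> Q w \<longleftrightarrow> Q (sp R w)" for P Q
  proof -
    have "N.prob {w\<in>space N. piv w x \<and> P w \<and> Q w} =
        N.prob {w\<in>space N. (con L w \<and> P (sp L w)) \<and> con Ov w \<and> (con R w \<and> Q (sp R w))}"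
    proof (rule N.finite_measure_eq_AE)
      show "AE w in N. w \<in> {w\<in>space N. piv w x \<and> P w \<and> Q w} \<longleftrightarrow>
          w \<in> {w\<in>space N. (con L w \<and> P (sp L w)) \<and> con Ov w \<and> (con R w \<and> Q (sp R w))}"
        using AE_good
      proof eventually_elim
        case (elim w)
        then show ?case using piv_con[of w] PQ[of w] by auto
      qed
    qed measurable
    then show ?thesis using triple[of P Q] by simp
  qed
  \<comment> \<open>All four probabilities are products of a left, a crossing and a right factor,
    and both sides of the claim contain the same six.\<close>
  have T: "Measurable.pred N (\<lambda>_. True)" by simp
  have "N.prob {w\<in>space N. piv w x} = piv_prob" by (rule prob_piv)
  then show ?thesis
    using split[of F G, OF F G F' G'] split[of F "\<lambda>_. True", OF F T F' refl]
      split[of "\<lambda>_. True" G, OF T G refl G'] split[of "\<lambda>_. True" "\<lambda>_. True", OF T T refl refl]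
    by simp
qed

end

section \<open>The sequence of pivots\<close>

text \<open>Sums an identity between atoms over countably many histories or block values.\<close>

lemma (in prob_space) prob_UN_scale:
  fixes E E' :: "'i::countable \<Rightarrow> 'a set"
  assumes E: "\<And>i. i \<in> I \<Longrightarrow> E i \<in> events" "disjoint_family_on E I"
    and E': "\<And>i. i \<in> I \<Longrightarrow> E' i \<in> events" "disjoint_family_on E' I"
    and c: "0 \<le> c" and eq: "\<And>i. i \<in> I \<Longrightarrow> prob (E i) = c * prob (E' i)"
  shows "prob (\<Union>i\<in>I. E i) = c * prob (\<Union>i\<in>I. E' i)"
proof -
  have "emeasure M (\<Union>i\<in>I. E i) = (\<integral>\<^sup>+i. emeasure M (E i) \<partial>count_space I)"
    by (rule emeasure_UN_countable) (use E in auto)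
  also have "\<dots> = (\<integral>\<^sup>+i. ennreal c * emeasure M (E' i) \<partial>count_space I)"
    using c by (intro nn_integral_cong) (simp add: emeasure_eq_measure eq ennreal_mult)
  also have "\<dots> = ennreal c * (\<integral>\<^sup>+i. emeasure M (E' i) \<partial>count_space I)"
    by (rule nn_integral_cmult) simp
  also have "(\<integral>\<^sup>+i. emeasure M (E' i) \<partial>count_space I) = emeasure M (\<Union>i\<in>I. E' i)"
    by (rule emeasure_UN_countable[symmetric]) (use E' in auto)
  finally have "ennreal (prob (\<Union>i\<in>I. E i)) = ennreal (c * prob (\<Union>i\<in>I. E' i))"
    using c by (simp add: emeasure_eq_measure ennreal_mult)
  then show ?thesis using c by (simp add: ennreal_inj)
qed

text \<open>The bound on the fourth moment of a variable whose tail at k * L is at most r^k.\<close>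

definition tail4 :: "nat \<Rightarrow> real \<Rightarrow> real" where
  "tail4 L r = (\<Sum>k. (real ((k + 1) * L)) ^ 4 * r ^ k)"

lemma summable_tail4:
  assumes "0 \<le> r" "r < 1"
  shows "summable (\<lambda>k. (real ((k + 1) * L)) ^ 4 * r ^ k)"
proof (cases "r = 0 \<or> L = 0")
  case True
  then show ?thesis
  proof
    assume "r = 0"
    then have "(real ((k + 1) * L)) ^ 4 * r ^ k = (if k = 0 then real L ^ 4 else 0)" for k by simp
    then show ?thesis by (simp only:) (rule summable_single)
  qed simp
next
  case False
  then have r: "0 < r" "r < 1" "L > 0" using assms by auto
  \<comment> \<open>The quotient of successive terms tends to r < 1; (1 + r) / 2 is a bound strictly
    between.\<close>
  have lim: "(\<lambda>k. (1 + 1 / real (k + 1)) ^ 4 * r) \<longlonglongrightarrow> (1 + 0) ^ 4 * r"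
    using LIMSEQ_inverse_real_of_nat
    by (intro tendsto_intros) (simp add: inverse_eq_divide add.commute)
  have "\<forall>\<^sub>F k in sequentially. (1 + 1 / real (k + 1)) ^ 4 * r < (1 + r) / 2"
    by (rule order_tendstoD(2)[OF lim]) (use r in auto)
  then obtain n0 where n0: "\<And>k. k \<ge> n0 \<Longrightarrow> (1 + 1 / real (k + 1)) ^ 4 * r < (1 + r) / 2"
    by (auto simp: eventually_sequentially)
  show ?thesis
  proof (rule summable_ratio_test[of "(1 + r) / 2" n0])
    show "(1 + r) / 2 < 1" using r by simp
    fix k assume k: "n0 \<le> k"
    have nrm: "norm (real (j * L) ^ 4 * r ^ i) = (real j * real L) ^ 4 * r ^ i" for i j
    proof -
      have "0 \<le> real (j * L) ^ 4 * r ^ i" using r by simp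
      then show ?thesis by (simp only: real_norm_def abs_of_nonneg of_nat_mult)
    qed
    have e: "real (Suc k + 1) = (1 + 1 / real (k + 1)) * real (k + 1)" by (simp add: field_simps)
    have "norm (real ((Suc k + 1) * L) ^ 4 * r ^ Suc k) = (real (Suc k + 1) * real L) ^ 4 * r ^ Suc k"
      by (rule nrm)
    also have "\<dots> = ((1 + 1 / real (k + 1)) ^ 4 * r) * ((real (k + 1) * real L) ^ 4 * r ^ k)"
      unfolding e by (simp add: power_mult_distrib)
    also have "\<dots> \<le> (1 + r) / 2 * ((real (k + 1) * real L) ^ 4 * r ^ k)"
      using n0[OF k] r by (intro mult_right_mono) auto
    also have "(real (k + 1) * real L) ^ 4 * r ^ k = norm (real ((k + 1) * L) ^ 4 * r ^ k)"
      by (rule nrm[symmetric])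
    finally show "norm (real ((Suc k + 1) * L) ^ 4 * r ^ Suc k) \<le> (1 + r) / 2 * norm (real ((k + 1) * L) ^ 4 * r ^ k)" .
  qed
qed

text \<open>For k * L \<le> G < (k + 1) * L the term with index k alone dominates G^4; the series is
  then integrated term by term.\<close>

lemma (in prob_space) tail_fourth_moment:
  fixes G :: "'a \<Rightarrow> nat"
  assumes [measurable]: "G \<in> measurable M (count_space UNIV)" and L: "L > 0" and r: "0 \<le> r" "r < 1" and c: "0 \<le> c"
    and tail: "\<And>k. prob {\<omega>\<in>space M. k * L \<le> G \<omega>} \<le> c * r ^ k"
  shows "integrable M (\<lambda>\<omega>. real (G \<omega>) ^ 4)" "expectation (\<lambda>\<omega>. real (G \<omega>) ^ 4) \<le> c * tail4 L r"
proof -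
  have pt: "ennreal (real (G \<omega>) ^ 4) \<le> (\<Sum>k. ennreal ((real ((k + 1) * L)) ^ 4) * indicator {\<omega>\<in>space M. k * L \<le> G \<omega>} \<omega>)"
    (is "_ \<le> (\<Sum>k. ?f k)") if "\<omega> \<in> space M" for \<omega>
  proof -
    let ?k = "G \<omega> div L"
    define f where "f = ?f"
    have "G \<omega> < (?k + 1) * L" using dividend_less_div_times[OF L, of "G \<omega>"] by simp
    then have "real (G \<omega>) ^ 4 \<le> (real ((?k + 1) * L)) ^ 4" by (intro power_mono) (simp_all only: of_nat_le_iff less_imp_le of_nat_0_le_iff)
    then have "ennreal (real (G \<omega>) ^ 4) \<le> f ?k" unfolding f_def using that by (simp add: ennreal_leI)
    also have "\<dots> \<le> (\<Sum>k. f k)" using sum_le_suminf[of f "{?k}"] by simp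
    finally show ?thesis unfolding f_def .
  qed
  have "(\<integral>\<^sup>+\<omega>. ennreal (real (G \<omega>) ^ 4) \<partial>M) \<le>
      (\<integral>\<^sup>+\<omega>. (\<Sum>k. ennreal ((real ((k + 1) * L)) ^ 4) * indicator {\<omega>\<in>space M. k * L \<le> G \<omega>} \<omega>) \<partial>M)"
    by (intro nn_integral_mono pt)
  also have "\<dots> = (\<Sum>k. \<integral>\<^sup>+\<omega>. ennreal ((real ((k + 1) * L)) ^ 4) * indicator {\<omega>\<in>space M. k * L \<le> G \<omega>} \<omega> \<partial>M)"
    by (rule nn_integral_suminf) measurable
  also have "\<dots> = (\<Sum>k. ennreal ((real ((k + 1) * L)) ^ 4 * prob {\<omega>\<in>space M. k * L \<le> G \<omega>}))"
    by (intro suminf_cong, subst nn_integral_cmult_indicator) (auto simp: emeasure_eq_measure ennreal_mult)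
  also have "\<dots> \<le> (\<Sum>k. ennreal (c * ((real ((k + 1) * L)) ^ 4 * r ^ k)))"
  proof (intro suminf_le ennreal_leI)
    fix k
    have "(real ((k + 1) * L)) ^ 4 * prob {\<omega>\<in>space M. k * L \<le> G \<omega>} \<le> (real ((k + 1) * L)) ^ 4 * (c * r ^ k)"
      by (intro mult_left_mono tail) simp
    then show "(real ((k + 1) * L)) ^ 4 * prob {\<omega>\<in>space M. k * L \<le> G \<omega>} \<le> c * ((real ((k + 1) * L)) ^ 4 * r ^ k)"
      by (simp add: mult_ac)
  qed auto
  also have "\<dots> = ennreal (c * tail4 L r)"
    unfolding tail4_def suminf_mult[OF summable_tail4[OF r], symmetric]
    using r c summable_mult[OF summable_tail4[OF r]] by (intro suminf_ennreal2) auto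
  finally have nn: "(\<integral>\<^sup>+\<omega>. ennreal (real (G \<omega>) ^ 4) \<partial>M) \<le> ennreal (c * tail4 L r)" .
  have t0: "0 \<le> tail4 L r" unfolding tail4_def using r by (intro suminf_nonneg summable_tail4) auto
  show i: "integrable M (\<lambda>\<omega>. real (G \<omega>) ^ 4)"
    by (rule integrableI_bounded) (use nn in \<open>auto simp: le_less_trans[OF _ ennreal_less_top]\<close>)
  have "ennreal (expectation (\<lambda>\<omega>. real (G \<omega>) ^ 4)) = (\<integral>\<^sup>+\<omega>. ennreal (real (G \<omega>) ^ 4) \<partial>M)"
    by (rule nn_integral_eq_integral[symmetric, OF i]) simp
  then have "ennreal (expectation (\<lambda>\<omega>. real (G \<omega>) ^ 4)) \<le> ennreal (c * tail4 L r)"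
    using nn by simp
  then show "expectation (\<lambda>\<omega>. real (G \<omega>) ^ 4) \<le> c * tail4 L r"
    using c t0 ennreal_le_iff[of "c * tail4 L r"] by simp
qed

text \<open>\<open>enumerate\<close> removes the least element in each step, so measurability
  follows from that of \<open>LEAST\<close> by induction over all families P.\<close>

lemma (in prob_space) enumerate_rv:
  fixes P :: "'a \<Rightarrow> nat \<Rightarrow> bool"
  assumes "\<And>v. Measurable.pred M (\<lambda>w. P w v)"
  shows "(\<lambda>w. enumerate {v. P w v} i) \<in> measurable M (count_space UNIV)"
  using assms
proof (induction i arbitrary: P)
  case 0
  note [measurable] = 0
  show ?case unfolding enumerate_0 mem_Collect_eq by measurable
next
  case (Suc i)
  note [measurable] = Suc(2)
  have "{v. P w v} - {LEAST n. n \<in> {v. P w v}} = {v. P w v \<and> v \<noteq> (LEAST n. P w n)}" for w by auto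
  moreover have "(\<lambda>w. enumerate {v. P w v \<and> v \<noteq> (LEAST n. P w n)} i) \<in> measurable M (count_space UNIV)"
    by (rule Suc.IH) measurable
  ultimately show ?case by (simp add: enumerate_Suc)
qed

context percolation
begin

text \<open>All restricted edges lie within rad of the pivot, so vertices at distance W = 2 * rad +
  1 or more restrict disjoint sets of edges. The inserted 0 gives rad \<ge> 0 and covers empty
  lists.\<close>

definition rad :: int where "rad = Max (insert 0 ((\<lambda>(p, q). max (- p) q) ` (A \<union> B)))"
definition W :: nat where "W = nat (2 * rad + 1)"

lemma rad: "0 \<le> rad" "(p, q) \<in> A \<union> B \<Longrightarrow> - rad \<le> p \<and> q \<le> rad"
proof -
  have fin: "finite (insert 0 ((\<lambda>(p, q). max (- p) q) ` (A \<union> B)))" using finite_A finite_B by simp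
  show "0 \<le> rad" unfolding rad_def using fin by (intro Max_ge) auto
  show "- rad \<le> p \<and> q \<le> rad" if "(p, q) \<in> A \<union> B"
  proof -
    have "max (- p) q \<le> rad" unfolding rad_def using fin that by (intro Max_ge) force+
    then show ?thesis by linarith
  qed
qed

lemma W: "int W = 2 * rad + 1" "W > 0"
  using rad(1) by (auto simp: W_def)

lemma piv_dep:
  assumes "\<And>p q. (p, q) \<in> edges l \<Longrightarrow> x - rad \<le> p \<Longrightarrow> q \<le> x + rad \<Longrightarrow> (p, q) \<in> I"
  shows "dep I (\<lambda>w. piv w x)"
proof -
  have "(p + x, q + x) \<in> I \<inter> edges l" if "(p, q) \<in> A \<union> B" for p q
    using rad(2)[OF that] that A_edges B_edges assms[of "p + x" "q + x"] by (auto simp: edges_def)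
  then show ?thesis
    unfolding dep_def pivot_at_def by (intro ballI impI arg_cong2[of _ _ _ _ "(\<and>)"] ball_cong refl) auto
qed

text \<open>Candidates spaced by W inspect disjoint sets of edges, so their failures are
  independent.\<close>

lemma no_piv_spaced: "N.prob {w\<in>space N. \<forall>j<k. \<not> piv w (x + int j * int W)} = (1 - piv_prob) ^ k"
proof (induction k)
  case 0
  then show ?case by (simp add: N.prob_space)
next
  case (Suc k)
  have a: "dep {e\<in>edges l. snd e \<le> x + (int k - 1) * int W + rad} (\<lambda>w. \<forall>j\<in>{..<k}. \<not> piv w (x + int j * int W))"
  proof (intro dep_all dep_not piv_dep)
    fix j p q assume "j \<in> {..<k}" "(p, q) \<in> edges l" "q \<le> x + int j * int W + rad"
    moreover from this have "int j * int W \<le> (int k - 1) * int W" by (intro mult_right_mono) auto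
    ultimately show "(p, q) \<in> {e\<in>edges l. snd e \<le> x + (int k - 1) * int W + rad}" by auto
  qed
  have b: "dep {e\<in>edges l. x + int k * int W - rad \<le> fst e} (\<lambda>w. \<not> piv w (x + int k * int W))"
    by (intro dep_not piv_dep) auto
  have disj: "{e\<in>edges l. snd e \<le> x + (int k - 1) * int W + rad} \<inter> {e\<in>edges l. x + int k * int W - rad \<le> fst e} = {}"
    using W by (auto simp: edges_def algebra_simps)
  have "{w\<in>space N. \<forall>j<Suc k. \<not> piv w (x + int j * int W)} =
      {w\<in>space N. (\<forall>j\<in>{..<k}. \<not> piv w (x + int j * int W)) \<and> \<not> piv w (x + int k * int W)}"
    by (auto simp: less_Suc_eq)
  also have "N.prob \<dots> = N.prob {w\<in>space N. \<forall>j\<in>{..<k}. \<not> piv w (x + int j * int W)} *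
      N.prob {w\<in>space N. \<not> piv w (x + int k * int W)}"
    by (rule dep_indep[OF disj a b]) measurable
  also have "N.prob {w\<in>space N. \<not> piv w (x + int k * int W)} = 1 - piv_prob"
    using N.prob_neg[of "\<lambda>w. piv w (x + int k * int W)"] prob_piv[of "x + int k * int W"] piv_rv[of "x + int k * int W"]
    by (simp add: pred_def)
  finally show ?case using Suc by (simp add: Ball_def mult.commute)
qed

lemma piv_prob_le_1: "piv_prob \<le> 1" by (simp add: piv_prob_def)

lemma no_piv_forward: "N.prob {w\<in>space N. \<forall>j<k * W. \<not> piv w (x + int j)} \<le> (1 - piv_prob) ^ k"
proof -
  have "N.prob {w\<in>space N. \<forall>j<k * W. \<not> piv w (x + int j)} \<le> N.prob {w\<in>space N. \<forall>j<k. \<not> piv w (x + int j * int W)}"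
  proof (rule N.finite_measure_mono)
    show "{w\<in>space N. \<forall>j<k * W. \<not> piv w (x + int j)} \<subseteq> {w\<in>space N. \<forall>j<k. \<not> piv w (x + int j * int W)}"
    proof safe
      fix w j assume "\<forall>j<k * W. \<not> piv w (x + int j)" "j < k" "piv w (x + int j * int W)"
      moreover have "j * W < k * W" using \<open>j < k\<close> W by simp
      ultimately show False by (metis of_nat_mult)
    qed
  qed measurable
  then show ?thesis by (simp add: no_piv_spaced)
qed

lemma no_piv_backward: "N.prob {w\<in>space N. \<forall>j<k * W. \<not> piv w (x - int j)} \<le> (1 - piv_prob) ^ k"
proof -
  have "N.prob {w\<in>space N. \<forall>j<k * W. \<not> piv w (x - int j)} \<le>
      N.prob {w\<in>space N. \<forall>j<k. \<not> piv w ((x - (int k - 1) * int W) + int j * int W)}"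
  proof (rule N.finite_measure_mono)
    show "{w\<in>space N. \<forall>j<k * W. \<not> piv w (x - int j)} \<subseteq>
        {w\<in>space N. \<forall>j<k. \<not> piv w ((x - (int k - 1) * int W) + int j * int W)}"
    proof safe
      fix w j assume a: "\<forall>j<k * W. \<not> piv w (x - int j)" "j < k" "piv w (x - (int k - 1) * int W + int j * int W)"
      have "(k - 1 - j) * W < k * W" using \<open>j < k\<close> W by simp
      moreover have "x - int ((k - 1 - j) * W) = x - (int k - 1) * int W + int j * int W"
      proof -
        have "int (k - 1 - j) = int k - 1 - int j" using \<open>j < k\<close> by simp
        then show ?thesis by (simp only: of_nat_mult) (simp add: algebra_simps)
      qed
      ultimately show False using a by metis
    qed
  qed measurable
  then show ?thesis by (simp add: no_piv_spaced)
qed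

text \<open>Without a pivot on that side, a null event, these are junk; the tail bounds hold nevertheless.\<close>

definition gapR :: "int \<Rightarrow> (int \<times> int \<Rightarrow> real) \<Rightarrow> nat" where "gapR x w = (LEAST j. piv w (x + int j))"
definition gapL :: "int \<Rightarrow> (int \<times> int \<Rightarrow> real) \<Rightarrow> nat" where "gapL x w = (LEAST j. piv w (x - int j))"

lemma gap_rv [measurable]: "gapR x \<in> measurable N (count_space UNIV)" "gapL x \<in> measurable N (count_space UNIV)"
  unfolding gapR_def[abs_def] gapL_def[abs_def] by measurable

lemma gap_moment:
  "integrable N (\<lambda>w. real (gapR x w) ^ 4)" "N.expectation (\<lambda>w. real (gapR x w) ^ 4) \<le> 1 * tail4 W (1 - piv_prob)"
  "integrable N (\<lambda>w. real (gapL x w) ^ 4)" "N.expectation (\<lambda>w. real (gapL x w) ^ 4) \<le> 1 * tail4 W (1 - piv_prob)"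
proof -
  have r: "0 \<le> 1 - piv_prob" "1 - piv_prob < 1" using piv_prob_pos piv_prob_le_1 by auto
  have 1: "N.prob {w\<in>space N. k * W \<le> gapR x w} \<le> 1 * (1 - piv_prob) ^ k" for k
  proof -
    have "N.prob {w\<in>space N. k * W \<le> gapR x w} \<le> N.prob {w\<in>space N. \<forall>j<k * W. \<not> piv w (x + int j)}"
      by (rule N.finite_measure_mono) (auto simp: gapR_def dest: Least_le)
    then show ?thesis using no_piv_forward[of k x] by simp
  qed
  have 2: "N.prob {w\<in>space N. k * W \<le> gapL x w} \<le> 1 * (1 - piv_prob) ^ k" for k
  proof -
    have "N.prob {w\<in>space N. k * W \<le> gapL x w} \<le> N.prob {w\<in>space N. \<forall>j<k * W. \<not> piv w (x - int j)}"
      by (rule N.finite_measure_mono) (auto simp: gapL_def dest: Least_le)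
    then show ?thesis using no_piv_backward[of k x] by simp
  qed
  show "integrable N (\<lambda>w. real (gapR x w) ^ 4)" "N.expectation (\<lambda>w. real (gapR x w) ^ 4) \<le> 1 * tail4 W (1 - piv_prob)"
    by (rule N.tail_fourth_moment[OF gap_rv(1) W(2) r _ 1]; simp)+
  show "integrable N (\<lambda>w. real (gapL x w) ^ 4)" "N.expectation (\<lambda>w. real (gapL x w) ^ 4) \<le> 1 * tail4 W (1 - piv_prob)"
    by (rule N.tail_fourth_moment[OF gap_rv(2) W(2) r _ 2]; simp)+
qed

text \<open>The almost sure event on which the combinatorics of pivots and blocks holds
  deterministically.\<close>

definition typical :: "(int \<times> int \<Rightarrow> real) \<Rightarrow> bool" where
  "typical w \<longleftrightarrow> good l m w \<and> (\<forall>x. \<exists>j. piv w (x + int j)) \<and> (\<forall>x. \<exists>j. piv w (x - int j))"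

lemma typical_rv [measurable]: "Measurable.pred N typical"
  unfolding typical_def[abs_def] by measurable

lemma AE_typical: "AE w in N. typical w"
proof -
  have r: "\<bar>1 - piv_prob\<bar> < 1" using piv_prob_pos piv_prob_le_1 by auto
  have lim: "(\<lambda>k. (1 - piv_prob) ^ k) \<longlonglongrightarrow> 0" by (rule LIMSEQ_power_zero) (use r in simp)
  have "AE w in N. \<exists>j. piv w (x + int j)" for x
  proof -
    have "N.prob {w\<in>space N. \<forall>j. \<not> piv w (x + int j)} \<le> (1 - piv_prob) ^ k" for k
      by (rule order_trans[OF N.finite_measure_mono no_piv_forward[of k x]]) auto
    then have "N.prob {w\<in>space N. \<forall>j. \<not> piv w (x + int j)} \<le> 0"
      by (intro LIMSEQ_le_const[OF lim]) auto
    then have "N.prob {w\<in>space N. \<forall>j. \<not> piv w (x + int j)} = 0" by (simp add: order_antisym)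
    then show ?thesis by (subst (asm) N.prob_Collect_eq_0) auto
  qed
  moreover have "AE w in N. \<exists>j. piv w (x - int j)" for x
  proof -
    have "N.prob {w\<in>space N. \<forall>j. \<not> piv w (x - int j)} \<le> (1 - piv_prob) ^ k" for k
      by (rule order_trans[OF N.finite_measure_mono no_piv_backward[of k x]]) auto
    then have "N.prob {w\<in>space N. \<forall>j. \<not> piv w (x - int j)} \<le> 0"
      by (intro LIMSEQ_le_const[OF lim]) auto
    then have "N.prob {w\<in>space N. \<forall>j. \<not> piv w (x - int j)} = 0" by (simp add: order_antisym)
    then show ?thesis by (subst (asm) N.prob_Collect_eq_0) auto
  qed
  ultimately have "AE w in N. (\<forall>x. \<exists>j. piv w (x + int j))" "AE w in N. (\<forall>x. \<exists>j. piv w (x - int j))"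
    by (simp_all add: AE_all_countable)
  with AE_good show ?thesis
    by eventually_elim (simp add: typical_def)
qed

definition rho :: "nat \<Rightarrow> (int \<times> int \<Rightarrow> real) \<Rightarrow> nat" where
  "rho i w = enumerate {v. piv w (int v)} i"

text \<open>Block 0 carries the delay before the first pivot; its second component is a dummy.\<close>

definition block :: "nat \<Rightarrow> (int \<times> int \<Rightarrow> real) \<Rightarrow> nat \<times> nat" where
  "block i w = (case i of 0 \<Rightarrow> (rho 0 w, 0)
    | Suc j \<Rightarrow> (rho (Suc j) w - rho j w, mhops l w (int (rho j w)) (int (rho (Suc j) w))))"

lemma block_0: "block 0 w = (rho 0 w, 0)"
  and block_Suc: "block (Suc j) w = (rho (Suc j) w - rho j w, mhops l w (int (rho j w)) (int (rho (Suc j) w)))"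
  by (simp_all add: block_def)

lemma rho_rv [measurable]: "rho i \<in> measurable N (count_space UNIV)"
  unfolding rho_def[abs_def] by (rule N.enumerate_rv) measurable

lemma block_rv [measurable]: "block i \<in> measurable N (count_space UNIV)"
proof (cases i)
  case 0
  have "(\<lambda>w. (rho 0 w, 0::nat)) \<in> measurable N (count_space UNIV)"
    by (rule measurable_compose_countable[OF _ rho_rv]) simp
  then show ?thesis by (simp add: 0 block_0[abs_def])
next
  case (Suc j)
  have "(\<lambda>w. (b - a, mhops l w (int a) (int b))) \<in> measurable N (count_space UNIV)" for a b :: nat
    by (rule measurable_compose[OF mhops_rv]) simp
  then have "(\<lambda>w. (rho (Suc j) w - a, mhops l w (int a) (int (rho (Suc j) w)))) \<in> measurable N (count_space UNIV)" for a
    by (rule measurable_compose_countable[OF _ rho_rv])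
  then have "(\<lambda>w. (rho (Suc j) w - rho j w, mhops l w (int (rho j w)) (int (rho (Suc j) w)))) \<in> measurable N (count_space UNIV)"
    by (rule measurable_compose_countable[OF _ rho_rv])
  then show ?thesis by (simp add: Suc block_Suc[abs_def])
qed

section \<open>Blocks as events at fixed positions\<close>

definition nextp :: "(int \<times> int \<Rightarrow> real) \<Rightarrow> int \<Rightarrow> nat \<Rightarrow> bool" where
  "nextp w x d \<longleftrightarrow> 0 < d \<and> piv w (x + int d) \<and> (\<forall>j<d. 0 < j \<longrightarrow> \<not> piv w (x + int j))"

text \<open>Unlike \<open>block\<close>, whose position is random, this is anchored at a fixed
  vertex, as regeneration there requires.\<close>

fun chain :: "(int \<times> int \<Rightarrow> real) \<Rightarrow> int \<Rightarrow> (nat \<times> nat) list \<Rightarrow> bool" where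
  "chain w x [] \<longleftrightarrow> True"
| "chain w x (z # zs) \<longleftrightarrow> nextp w x (fst z) \<and> mhops l w x (x + int (fst z)) = snd z \<and> chain w (x + int (fst z)) zs"

definition endp :: "int \<Rightarrow> (nat \<times> nat) list \<Rightarrow> int" where "endp x zs = x + int (sum_list (map fst zs))"

lemma endp_simps [simp]: "endp x [] = x" "endp x (z # zs) = endp (x + int (fst z)) zs"
  "endp x (zs @ ys) = endp (endp x zs) ys"
  by (simp_all add: endp_def)

lemma endp_ge: "x \<le> endp x zs" by (simp add: endp_def)

lemma chain_append: "chain w x (zs @ ys) \<longleftrightarrow> chain w x zs \<and> chain w (endp x zs) ys"
  by (induction zs arbitrary: x) auto

lemma chain_end: "chain w x zs \<Longrightarrow> piv w x \<Longrightarrow> piv w (endp x zs)"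
  by (induction zs arbitrary: x) (auto simp: nextp_def)

lemma chain_rv [measurable]: "Measurable.pred N (\<lambda>w. chain w x zs)"
  by (induction zs arbitrary: x) (simp_all add: nextp_def)

lemma nextp_unique: "nextp w x d \<Longrightarrow> nextp w x d' \<Longrightarrow> d = d'"
  unfolding nextp_def by (metis linorder_neqE_nat)

lemma chain_unique: "chain w x zs \<Longrightarrow> chain w x zs' \<Longrightarrow> length zs = length zs' \<Longrightarrow> zs = zs'"
proof (induction zs arbitrary: x zs')
  case (Cons z zs)
  then obtain z' ys where "zs' = z' # ys" by (cases zs') auto
  with Cons show ?case using nextp_unique[of w x "fst z" "fst z'"] by (auto simp: prod_eq_iff)
qed simp

lemma typical_infinite: "typical w \<Longrightarrow> infinite {v. piv w (int v)}"
  unfolding infinite_nat_iff_unbounded_le typical_def by (metis le_add1 mem_Collect_eq of_nat_add)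

lemma rho_piv: "typical w \<Longrightarrow> piv w (int (rho i w))"
  using enumerate_in_set[OF typical_infinite, of w i] by (simp add: rho_def)

lemma rho_mono: "typical w \<Longrightarrow> i < j \<Longrightarrow> rho i w < rho j w"
  unfolding rho_def by (rule enumerate_mono[OF _ typical_infinite])

lemma rho_gap:
  assumes t: "typical w" and v: "rho i w < v" "v < rho (Suc i) w"
  shows "\<not> piv w (int v)"
proof
  assume "piv w (int v)"
  then obtain n where n: "rho n w = v"
    using enumerate_Ex[OF typical_infinite[OF t], of v] by (auto simp: rho_def)
  have "i < n" using rho_mono[OF t, of n i] v n by (metis less_asym' linorder_neqE_nat)
  moreover have "n < Suc i" using rho_mono[OF t, of "Suc i" n] v n by (metis less_asym' linorder_neqE_nat)
  ultimately show False by simp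
qed

lemma rho_first: assumes t: "typical w" and v: "v < rho 0 w" shows "\<not> piv w (int v)"
  using not_less_Least[of v "\<lambda>n. n \<in> {v. piv w (int v)}"] v by (simp add: rho_def enumerate_0)

lemma rho_nextp:
  assumes t: "typical w"
  shows "nextp w (int (rho i w)) (rho (Suc i) w - rho i w)"
proof -
  have lt: "rho i w < rho (Suc i) w" using rho_mono[OF t] by simp
  show ?thesis unfolding nextp_def
  proof (intro conjI allI impI)
    show "piv w (int (rho i w) + int (rho (Suc i) w - rho i w))" using rho_piv[OF t, of "Suc i"] lt by (simp add: of_nat_diff)
    fix j assume "j < rho (Suc i) w - rho i w" "0 < j"
    then show "\<not> piv w (int (rho i w) + int j)" using rho_gap[OF t, of i "rho i w + j"] by simp
  qed (use lt in simp)
qed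

lemma rho_chain:
  assumes t: "typical w"
  shows "chain w (int (rho 0 w)) (map (\<lambda>i. block (Suc i) w) [0..<n]) \<and>
    endp (int (rho 0 w)) (map (\<lambda>i. block (Suc i) w) [0..<n]) = int (rho n w)"
proof (induction n)
  case (Suc n)
  have lt: "rho n w < rho (Suc n) w" using rho_mono[OF t] by simp
  show ?case using Suc rho_nextp[OF t, of n] lt by (simp add: chain_append block_Suc of_nat_diff)
qed simp

definition begins :: "nat \<Rightarrow> (nat \<times> nat) list \<Rightarrow> (int \<times> int \<Rightarrow> real) \<Rightarrow> bool" where
  "begins x zs w \<longleftrightarrow> (\<forall>j<x. \<not> piv w (int j)) \<and> piv w (int x) \<and> chain w (int x) zs"

lemma begins_rv [measurable]: "Measurable.pred N (begins x zs)"
  unfolding begins_def[abs_def] by measurable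

lemma upt_Suc_map: "map f [0..<Suc n] = f 0 # map (\<lambda>i. f (Suc i)) [0..<n]"
  by (metis map_upt_Suc)

text \<open>Turns a statement about the history of blocks into an event at fixed positions. The
  dummy 0 of block 0 explains the first entry (x, 0).\<close>

lemma begins_iff:
  assumes t: "typical w"
  shows "map (\<lambda>i. block i w) [0..<Suc n] = (x, 0) # zs \<longleftrightarrow> length zs = n \<and> begins x zs w"
proof
  assume "map (\<lambda>i. block i w) [0..<Suc n] = (x, 0) # zs"
  then have e: "rho 0 w = x" "map (\<lambda>i. block (Suc i) w) [0..<n] = zs"
    by (simp_all add: upt_Suc_map block_0 del: upt_Suc)
  then show "length zs = n \<and> begins x zs w"
    using rho_chain[OF t, of n] rho_first[OF t] rho_piv[OF t, of 0] by (auto simp: begins_def)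
next
  assume b: "length zs = n \<and> begins x zs w"
  have x: "rho 0 w = x"
    using b rho_first[OF t, of x] rho_piv[OF t, of 0] by (auto simp: begins_def) (metis linorder_neqE_nat)
  have "map (\<lambda>i. block (Suc i) w) [0..<n] = zs"
    using chain_unique[of w "int x" "map (\<lambda>i. block (Suc i) w) [0..<n]" zs] rho_chain[OF t, of n] b
    by (simp add: x begins_def)
  then show "map (\<lambda>i. block i w) [0..<Suc n] = (x, 0) # zs"
    by (simp add: upt_Suc_map block_0 x del: upt_Suc)
qed

text \<open>A chain is decided by the pivots in the interval it covers and by the hop numbers
  between them.\<close>

lemma chain_transfer:
  assumes piv: "\<And>u. lo \<le> u \<Longrightarrow> u \<le> hi \<Longrightarrow> piv w u \<longleftrightarrow> piv w' u"
    and hops: "\<And>a b. lo \<le> a \<Longrightarrow> a < b \<Longrightarrow> b \<le> hi \<Longrightarrow> piv w a \<Longrightarrow> piv w b \<Longrightarrow> mhops l w a b = mhops l w' a b"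
  shows "lo \<le> x \<Longrightarrow> endp x zs \<le> hi \<Longrightarrow> piv w x \<Longrightarrow> chain w x zs \<Longrightarrow> chain w' x zs"
proof (induction zs arbitrary: x)
  case (Cons z zs)
  have hi: "x + int (fst z) \<le> hi" using Cons(3) endp_ge[of "x + int (fst z)" zs] by simp
  have n: "nextp w x (fst z)" using Cons by simp
  then have "nextp w' x (fst z)" using piv Cons(2) hi by (auto simp: nextp_def)
  moreover have "mhops l w' x (x + int (fst z)) = snd z"
    using hops[of x "x + int (fst z)"] n Cons hi by (auto simp: nextp_def)
  moreover have "chain w' (x + int (fst z)) zs"
    by (rule Cons.IH) (use Cons n in \<open>auto simp: nextp_def\<close>)
  ultimately show ?case by simp
qed simp

text \<open>Pivots up to y transfer in both directions, y being a pivot of both configurations. Hop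
  numbers between them agree because their ends are cut points in both.\<close>

lemma pivots_agree_left:
  assumes g: "good l m w" "good l m w'" and x: "piv w y" "piv w' y"
    and eq: "\<And>p q. (p, q) \<in> edges l \<Longrightarrow> q \<le> y \<Longrightarrow> w (p, q) = w' (p, q)"
  shows "u \<le> y \<Longrightarrow> piv w u \<longleftrightarrow> piv w' u"
    and "a < b \<Longrightarrow> b \<le> y \<Longrightarrow> piv w a \<Longrightarrow> piv w b \<Longrightarrow> mhops l w a b = mhops l w' a b"
proof -
  show p: "u \<le> y \<Longrightarrow> piv w u \<longleftrightarrow> piv w' u" for u
    using pivot_transfer_left[OF x, of u] pivot_transfer_left[OF x(2,1), of u] x eq by (metis order_le_less)
  show "mhops l w a b = mhops l w' a b" if "a < b" "b \<le> y" "piv w a" "piv w b"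
  proof (rule mhops_cong[of l w w' a b])
    show "cutp l w a" "cutp l w b" "cutp l w' a" "cutp l w' b"
      using that g p[of a] p[of b] by (auto intro!: pivot_cutp)
    show "w (p, q) = w' (p, q)" if "(p, q) \<in> edges l" "a \<le> p" "q \<le> b" for p q
      using eq that \<open>b \<le> y\<close> by auto
  qed (use that g l2 good_nonneg in auto)
qed

lemma pivots_agree_right:
  assumes g: "good l m w" "good l m w'" and x: "piv w y" "piv w' y"
    and eq: "\<And>p q. (p, q) \<in> edges l \<Longrightarrow> y \<le> p \<Longrightarrow> w (p, q) = w' (p, q)"
  shows "y \<le> u \<Longrightarrow> piv w u \<longleftrightarrow> piv w' u"
    and "y \<le> a \<Longrightarrow> a < b \<Longrightarrow> piv w a \<Longrightarrow> piv w b \<Longrightarrow> mhops l w a b = mhops l w' a b"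
proof -
  show p: "y \<le> u \<Longrightarrow> piv w u \<longleftrightarrow> piv w' u" for u
    using pivot_transfer_right[OF x, of u] pivot_transfer_right[OF x(2,1), of u] x eq by (metis order_le_less)
  show "mhops l w a b = mhops l w' a b" if "y \<le> a" "a < b" "piv w a" "piv w b"
  proof (rule mhops_cong[of l w w' a b])
    show "cutp l w a" "cutp l w b" "cutp l w' a" "cutp l w' b"
      using that g p[of a] p[of b] by (auto intro!: pivot_cutp)
    show "w (p, q) = w' (p, q)" if "(p, q) \<in> edges l" "a \<le> p" "q \<le> b" for p q
      using eq that \<open>y \<le> a\<close> by auto
  qed (use that g l2 good_nonneg in auto)
qed

lemma chain_shiftN: "chain (shiftN y w) x zs \<longleftrightarrow> chain w (x + y) zs"
proof (induction zs arbitrary: x)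
  case (Cons z zs)
  have "nextp (shiftN y w) x (fst z) \<longleftrightarrow> nextp w (x + y) (fst z)"
    by (simp add: nextp_def piv_shiftN algebra_simps)
  then show ?case using Cons[of "x + int (fst z)"] by (simp add: mhops_shiftN algebra_simps)
qed simp

text \<open>The law of the block starting at 0 given a pivot at 0, that is, the Palm law of a
  block.\<close>

definition nu :: "nat \<times> nat \<Rightarrow> real" where
  "nu z = N.prob {w\<in>space N. piv w 0 \<and> chain w 0 [z]} / piv_prob"

lemma nu_nonneg: "0 \<le> nu z" using piv_prob_pos by (simp add: nu_def)

text \<open>Regeneration at the fixed vertex y where zs ends: \<open>begins x zs\<close> is decided
  to the left of y, the next block to the right, and translation moves y to 0.\<close>

lemma begins_step:
  "N.prob {w\<in>space N. begins x (zs @ [z]) w} = N.prob {w\<in>space N. begins x zs w} * nu z"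
proof -
  define y where "y = endp (int x) zs"
  have xy: "int x \<le> y" unfolding y_def by (rule endp_ge)
  have "N.prob {w\<in>space N. piv w y \<and> begins x zs w \<and> chain w y [z]} * piv_prob =
      N.prob {w\<in>space N. piv w y \<and> begins x zs w} * N.prob {w\<in>space N. piv w y \<and> chain w y [z]}"
  proof (rule regeneration)
    fix w w' assume h: "good l m w" "good l m w'" "piv w y" "piv w' y"
      and eq: "\<And>p q. (p, q) \<in> edges l \<Longrightarrow> q \<le> y \<Longrightarrow> w (p, q) = w' (p, q)" and b: "begins x zs w"
    note agree = pivots_agree_left[OF h eq]
    have "chain w' (int x) zs"
      by (rule chain_transfer[where lo = "int x" and hi = y and w = w])
        (use agree b in \<open>auto simp: begins_def y_def\<close>)
    moreover have "\<forall>j<x. \<not> piv w' (int j)" "piv w' (int x)"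
      using agree(1)[of "int x"] agree(1)[of "int j" for j] b xy by (auto simp: begins_def)
    ultimately show "begins x zs w'" by (simp add: begins_def)
  next
    fix w w' assume h: "good l m w" "good l m w'" "piv w y" "piv w' y"
      and eq: "\<And>p q. (p, q) \<in> edges l \<Longrightarrow> y \<le> p \<Longrightarrow> w (p, q) = w' (p, q)" and b: "chain w y [z]"
    note agree = pivots_agree_right[OF h eq]
    show "chain w' y [z]"
      by (rule chain_transfer[where lo = y and hi = "endp y [z]" and w = w])
        (use agree b h in auto)
  qed measurable
  moreover have "{w\<in>space N. piv w y \<and> begins x zs w \<and> chain w y [z]} = {w\<in>space N. begins x (zs @ [z]) w}"
    "{w\<in>space N. piv w y \<and> begins x zs w} = {w\<in>space N. begins x zs w}"
    using chain_end by (auto simp: begins_def chain_append y_def simp del: chain.simps)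
  moreover have "N.prob {w\<in>space N. piv w y \<and> chain w y [z]} = N.prob {w\<in>space N. piv w 0 \<and> chain w 0 [z]}"
    using prob_shiftN[of "\<lambda>w. piv w 0 \<and> chain w 0 [z]" y] by (simp add: piv_shiftN chain_shiftN del: chain.simps)
  ultimately show ?thesis using piv_prob_pos by (simp add: nu_def field_simps)
qed

lemma hist_meas [measurable]: "(\<lambda>w. map (\<lambda>i. block i w) [0..<k]) \<in> measurable N (count_space UNIV)"
proof (induction k)
  case (Suc k)
  have "(\<lambda>w. map (\<lambda>i. block i w) [0..<k] @ [block k w]) \<in> measurable N (count_space UNIV)"
    by (rule measurable_compose_countable[OF measurable_compose_countable[OF _ block_rv] Suc]) simp
  then show ?case by simp
qed simp

lemma block_atom:
  "N.prob {w\<in>space N. map (\<lambda>i. block i w) [0..<Suc n] = v \<and> block (Suc n) w = z} =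
    N.prob {w\<in>space N. map (\<lambda>i. block i w) [0..<Suc n] = v} * nu z"
proof (cases "\<exists>x zs. v = (x, 0) # zs \<and> length zs = n")
  case True
  then obtain x zs where v: "v = (x, 0) # zs" "length zs = n" by blast
  have e1: "N.prob {w\<in>space N. map (\<lambda>i. block i w) [0..<Suc n] = v} = N.prob {w\<in>space N. begins x zs w}"
  proof (rule N.finite_measure_eq_AE)
    show "AE w in N. w \<in> {w\<in>space N. map (\<lambda>i. block i w) [0..<Suc n] = v} \<longleftrightarrow> w \<in> {w\<in>space N. begins x zs w}"
      using AE_typical by eventually_elim (simp add: v begins_iff del: upt_Suc)
  qed measurable
  have e2: "N.prob {w\<in>space N. map (\<lambda>i. block i w) [0..<Suc n] = v \<and> block (Suc n) w = z} =
      N.prob {w\<in>space N. begins x (zs @ [z]) w}"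
  proof (rule N.finite_measure_eq_AE)
    show "AE w in N. w \<in> {w\<in>space N. map (\<lambda>i. block i w) [0..<Suc n] = v \<and> block (Suc n) w = z} \<longleftrightarrow>
        w \<in> {w\<in>space N. begins x (zs @ [z]) w}"
      using AE_typical
    proof eventually_elim
      case (elim w)
      have "map (\<lambda>i. block i w) [0..<Suc n] = v \<and> block (Suc n) w = z \<longleftrightarrow>
          map (\<lambda>i. block i w) [0..<Suc (Suc n)] = v @ [z]" by simp
      also have "\<dots> \<longleftrightarrow> begins x (zs @ [z]) w"
        using begins_iff[OF elim, of "Suc n" x "zs @ [z]"] v by (simp del: upt_Suc)
      finally show ?case by simp
    qed
  qed measurable
  show ?thesis unfolding e1 e2 by (rule begins_step)
next
  case False
  \<comment> \<open>Every history has n + 1 entries and starts with the dummy second component 0;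
    for any other list both sides vanish.\<close>
  have "map (\<lambda>i. block i w) [0..<Suc n] \<noteq> v" for w
  proof
    assume "map (\<lambda>i. block i w) [0..<Suc n] = v"
    then have "v = (rho 0 w, 0) # map (\<lambda>i. block (Suc i) w) [0..<n]"
      by (simp add: upt_Suc_map block_0 del: upt_Suc)
    then show False using False by auto
  qed
  then show ?thesis by (simp del: upt_Suc)
qed

lemma block_law: "N.prob {w\<in>space N. block (Suc n) w = z} = nu z"
proof -
  let ?h = "\<lambda>w. map (\<lambda>i. block i w) [0..<Suc n]"
  have "N.prob (\<Union>v\<in>UNIV. {w\<in>space N. ?h w = v \<and> block (Suc n) w = z}) =
      nu z * N.prob (\<Union>v\<in>UNIV. {w\<in>space N. ?h w = v})"
    by (rule N.prob_UN_scale) (auto simp: disjoint_family_on_def nu_nonneg block_atom simp del: upt_Suc)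
  moreover have "(\<Union>v\<in>UNIV. {w\<in>space N. ?h w = v \<and> block (Suc n) w = z}) = {w\<in>space N. block (Suc n) w = z}"
    "(\<Union>v\<in>UNIV. {w\<in>space N. ?h w = v}) = space N" by auto
  ultimately show ?thesis by (simp add: N.prob_space)
qed

sublocale BS: discrete_sequence N block
proof
  fix n v z
  show "N.prob {w\<in>space N. map (\<lambda>i. block i w) [0..<n] = v \<and> block n w = z} =
      N.prob {w\<in>space N. map (\<lambda>i. block i w) [0..<n] = v} * N.prob {w\<in>space N. block n w = z}"
  proof (cases n)
    case 0
    then show ?thesis by (cases "v = []") (auto simp: N.prob_space)
  next
    case (Suc k)
    show ?thesis unfolding Suc block_law by (rule block_atom)
  qed
  show "N.prob {w\<in>space N. block (Suc n) w = z} = N.prob {w\<in>space N. block 1 w = z}"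
    using block_law[of n z] block_law[of 0 z] by simp
qed (rule block_rv)

text \<open>A block has the law of the block at 0 given a pivot there; dropping the condition costs
  the factor 1 / \<open>piv_prob\<close>. The search for the next pivot starts at 1, hence the gap
  minus 1.\<close>

lemma gap_tail: "N.prob {w\<in>space N. k * W \<le> fst (block 1 w) - 1} \<le> (1 / piv_prob) * (1 - piv_prob) ^ k"
proof -
  let ?Z = "{z. k * W \<le> fst z - (1::nat)} :: (nat \<times> nat) set"
  have "N.prob (\<Union>z\<in>?Z. {w\<in>space N. block 1 w = z}) = (1 / piv_prob) * N.prob (\<Union>z\<in>?Z. {w\<in>space N. piv w 0 \<and> chain w 0 [z]})"
  proof (rule N.prob_UN_scale)
    show "disjoint_family_on (\<lambda>z. {w\<in>space N. piv w 0 \<and> chain w 0 [z]}) ?Z"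
      unfolding disjoint_family_on_def
    proof (intro ballI impI)
      fix y z :: "nat \<times> nat" assume "y \<noteq> z"
      then have "\<not> (chain w 0 [y] \<and> chain w 0 [z])" for w
        using chain_unique[of w 0 "[y]" "[z]"] by auto
      then show "{w\<in>space N. piv w 0 \<and> chain w 0 [y]} \<inter> {w\<in>space N. piv w 0 \<and> chain w 0 [z]} = {}" by blast
    qed
    show "N.prob {w\<in>space N. block 1 w = z} = (1 / piv_prob) * N.prob {w\<in>space N. piv w 0 \<and> chain w 0 [z]}" for z
      using block_law[of 0 z] by (simp add: nu_def)
  qed (use piv_prob_pos in \<open>auto simp: disjoint_family_on_def simp del: chain.simps\<close>)
  also have "(\<Union>z\<in>?Z. {w\<in>space N. block 1 w = z}) = {w\<in>space N. k * W \<le> fst (block 1 w) - 1}" by auto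
  also have "N.prob (\<Union>z\<in>?Z. {w\<in>space N. piv w 0 \<and> chain w 0 [z]}) \<le> N.prob {w\<in>space N. \<forall>j<k * W. \<not> piv w (1 + int j)}"
  proof (rule N.finite_measure_mono)
    show "(\<Union>z\<in>?Z. {w\<in>space N. piv w 0 \<and> chain w 0 [z]}) \<subseteq> {w\<in>space N. \<forall>j<k * W. \<not> piv w (1 + int j)}"
    proof safe
      fix w a b j assume a: "k * W \<le> fst (a, b) - (1::nat)" "chain w 0 [(a, b)]" "j < k * W" "piv w (1 + int j)"
      then have "\<forall>i<a. 0 < i \<longrightarrow> \<not> piv w (int i)" "Suc j < a" by (simp_all add: nextp_def)
      then have "\<not> piv w (int (Suc j))" by blast
      then show False using a(4) by simp
    qed
  qed measurable
  also have "\<dots> \<le> (1 - piv_prob) ^ k" by (rule no_piv_forward)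
  finally show ?thesis using piv_prob_pos by (simp add: divide_right_mono)
qed

end

section \<open>Hop numbers as a renewal reward process\<close>

text \<open>512 = 8^3: the first four terms pass through three applications of
  \<open>power4_add_le\<close>, e through one.\<close>

lemma power4_sum5_le:
  fixes a b c d e :: real
  shows "(((a + b) + (c + d)) + e) ^ 4 \<le> 512 * (a ^ 4 + b ^ 4 + c ^ 4 + d ^ 4) + 8 * e ^ 4"
proof -
  have "(((a + b) + (c + d)) + e) ^ 4 \<le> 8 * ((a + b) + (c + d)) ^ 4 + 8 * e ^ 4" by (rule power4_add_le)
  also have "\<dots> \<le> 8 * (8 * (a + b) ^ 4 + 8 * (c + d) ^ 4) + 8 * e ^ 4"
    by (intro add_right_mono mult_left_mono power4_add_le) simp
  also have "\<dots> \<le> 8 * (8 * (8 * a ^ 4 + 8 * b ^ 4) + 8 * (8 * c ^ 4 + 8 * d ^ 4)) + 8 * e ^ 4"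
    by (intro add_right_mono mult_left_mono add_mono power4_add_le) simp_all
  also have "\<dots> = 512 * (a ^ 4 + b ^ 4 + c ^ 4 + d ^ 4) + 8 * e ^ 4" by simp
  finally show ?thesis .
qed

lemma four_term_bound:
  fixes a b c d e t :: real
  assumes "a \<le> 1 * t" "b \<le> 1 * t" "c \<le> 1 * t" "d \<le> 1 * t"
  shows "512 * (a + b + c + d) + e \<le> 2048 * t + e"
  using assms by simp

context percolation
begin

lemma block_bounds:
  assumes t: "typical w"
  shows "1 \<le> fst (block (Suc i) w)" "1 \<le> snd (block (Suc i) w)" "snd (block (Suc i) w) \<le> fst (block (Suc i) w)"
proof -
  have lt: "rho i w < rho (Suc i) w" using rho_mono[OF t] by simp
  have g: "good l m w" using t by (simp add: typical_def)
  note p = rho_piv[OF t, of i] rho_piv[OF t, of "Suc i"]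
  show "1 \<le> fst (block (Suc i) w)" using lt by (simp add: block_Suc)
  show "1 \<le> snd (block (Suc i) w)" using mhops_pivots_pos[OF g p] lt by (simp add: block_Suc)
  show "snd (block (Suc i) w) \<le> fst (block (Suc i) w)"
    using mhops_le_pivots[OF g p, of "int (rho i w)" "int (rho (Suc i) w)"] lt by (simp add: block_Suc)
qed

lemma block_real_rv [measurable]:
  "(\<lambda>w. real (fst (block i w))) \<in> borel_measurable N" "(\<lambda>w. real (snd (block i w))) \<in> borel_measurable N"
  by (rule measurable_compose[OF block_rv]; simp)+

lemma gap_fourth: "integrable N (\<lambda>w. real (fst (block 1 w)) ^ 4)"
proof -
  have r: "0 \<le> 1 - piv_prob" "1 - piv_prob < 1" using piv_prob_pos piv_prob_le_1 by auto
  have [measurable]: "(\<lambda>w. fst (block 1 w) - 1) \<in> measurable N (count_space UNIV)"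
    by (rule measurable_compose[OF block_rv]) simp
  have "integrable N (\<lambda>w. real (fst (block 1 w) - 1) ^ 4)"
    by (rule N.tail_fourth_moment(1)[OF _ W(2) r _ gap_tail]) (use piv_prob_pos in auto)
  then have i: "integrable N (\<lambda>w. 8 * real (fst (block 1 w) - 1) ^ 4 + 8)" by simp
  show ?thesis
  proof (rule Bochner_Integration.integrable_bound[OF i])
    show "AE w in N. norm (real (fst (block 1 w)) ^ 4) \<le> norm (8 * real (fst (block 1 w) - 1) ^ 4 + 8)"
    proof (rule AE_I2)
      fix w
      have "real (fst (block 1 w)) \<le> real (fst (block 1 w) - 1) + 1" by simp
      then have "real (fst (block 1 w)) ^ 4 \<le> (real (fst (block 1 w) - 1) + 1) ^ 4" by (rule power_mono) simp
      also have "\<dots> \<le> 8 * real (fst (block 1 w) - 1) ^ 4 + 8" using power4_add_le[of _ 1] by simp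
      finally show "norm (real (fst (block 1 w)) ^ 4) \<le> norm (8 * real (fst (block 1 w) - 1) ^ 4 + 8)" by simp
    qed
  qed measurable
qed

lemma reward_fourth: "integrable N (\<lambda>w. real (snd (block 1 w)) ^ 4)"
proof (rule Bochner_Integration.integrable_bound[OF gap_fourth])
  show "AE w in N. norm (real (snd (block 1 w)) ^ 4) \<le> norm (real (fst (block 1 w)) ^ 4)"
    using AE_typical
  proof eventually_elim
    case (elim w)
    then show ?case using block_bounds(3)[OF elim, of 0] by (simp add: power_mono)
  qed
qed measurable

lemma gap_mean_ge: "N.expectation (\<lambda>w. real (fst (block 1 w))) \<ge> 1"
  and reward_mean_ge: "N.expectation (\<lambda>w. real (snd (block 1 w))) \<ge> 1"
proof -
  have i: "integrable N (\<lambda>w. real (fst (block 1 w)))" "integrable N (\<lambda>w. real (snd (block 1 w)))"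
    using N.integrable_power_le4(1)[OF block_real_rv(1) gap_fourth, of 1]
      N.integrable_power_le4(1)[OF block_real_rv(2) reward_fourth, of 1] by simp_all
  have "AE w in N. 1 \<le> real (fst (block 1 w))" "AE w in N. 1 \<le> real (snd (block 1 w))"
    using AE_typical by (eventually_elim, use block_bounds[of _ 0] in fastforce)+
  then have "N.expectation (\<lambda>_. 1) \<le> N.expectation (\<lambda>w. real (fst (block 1 w)))"
    "N.expectation (\<lambda>_. 1) \<le> N.expectation (\<lambda>w. real (snd (block 1 w)))"
    using i by (intro integral_mono_AE; simp)+
  then show "N.expectation (\<lambda>w. real (fst (block 1 w))) \<ge> 1" "N.expectation (\<lambda>w. real (snd (block 1 w))) \<ge> 1"
    by (simp_all add: N.prob_space)
qed

text \<open>The distances from 0 and n to the pivots around them. To the left of n the search starts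
  at n - K, as a pivot is known to cut n off only from distance K on.\<close>

definition remainder :: "nat \<Rightarrow> (int \<times> int \<Rightarrow> real) \<Rightarrow> real" where
  "remainder n w = ((real (gapR 0 w) + real (gapL 0 w)) + (real (gapR (int n) w) + real (gapL (int n - K) w))) + real_of_int K"

definition rem_bound :: real where "rem_bound = 2048 * tail4 W (1 - piv_prob) + 8 * real_of_int K ^ 4"

lemma gap_real_rv [measurable]:
  "(\<lambda>w. real (gapR x w)) \<in> borel_measurable N" "(\<lambda>w. real (gapL x w)) \<in> borel_measurable N"
  by (rule measurable_compose[OF gap_rv(1)] measurable_compose[OF gap_rv(2)]; simp)+

lemma remainder_rv [measurable]: "remainder n \<in> borel_measurable N"
  unfolding remainder_def[abs_def] by measurable

lemma remainder_moment: "integrable N (\<lambda>w. remainder n w ^ 4)" "N.expectation (\<lambda>w. remainder n w ^ 4) \<le> rem_bound"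
proof -
  let ?B = "\<lambda>w. 512 * (real (gapR 0 w) ^ 4 + real (gapL 0 w) ^ 4 + real (gapR (int n) w) ^ 4 + real (gapL (int n - K) w) ^ 4)
      + 8 * real_of_int K ^ 4"
  have pt: "remainder n w ^ 4 \<le> ?B w" for w
    unfolding remainder_def by (rule power4_sum5_le)
  have iB: "integrable N ?B" using gap_moment by simp
  show i: "integrable N (\<lambda>w. remainder n w ^ 4)"
  proof (rule Bochner_Integration.integrable_bound[OF iB])
    show "AE w in N. norm (remainder n w ^ 4) \<le> norm (?B w)"
    proof (rule AE_I2)
      fix w
      have z: "0 \<le> remainder n w ^ 4" by simp
      show "norm (remainder n w ^ 4) \<le> norm (?B w)"
        unfolding real_norm_def abs_of_nonneg[OF z] by (rule order_trans[OF pt abs_ge_self])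
    qed
  qed measurable
  have "N.expectation (\<lambda>w. remainder n w ^ 4) \<le> N.expectation ?B" by (intro integral_mono i iB pt)
  also have "\<dots> = 512 * (N.expectation (\<lambda>w. real (gapR 0 w) ^ 4) + N.expectation (\<lambda>w. real (gapL 0 w) ^ 4) +
      N.expectation (\<lambda>w. real (gapR (int n) w) ^ 4) + N.expectation (\<lambda>w. real (gapL (int n - K) w) ^ 4)) + 8 * real_of_int K ^ 4"
    using gap_moment by (simp add: N.prob_space)
  also have "\<dots> \<le> rem_bound"
    unfolding rem_bound_def by (rule four_term_bound; rule gap_moment)
  finally show "N.expectation (\<lambda>w. remainder n w ^ 4) \<le> rem_bound" .
qed

lemma hist_position:
  assumes t: "typical w"
  shows "sum_list (map fst (BS.hist (Suc i) w)) = rho i w"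
proof -
  have "BS.hist (Suc i) w = (rho 0 w, 0) # map (\<lambda>i. block (Suc i) w) [0..<i]"
    by (simp add: BS.hist_def upt_Suc_map block_0 del: upt_Suc)
  moreover have "int (rho 0 w) + int (sum_list (map fst (map (\<lambda>i. block (Suc i) w) [0..<i]))) = int (rho i w)"
    using rho_chain[OF t, of i] by (simp only: endp_def)
  ultimately show ?thesis by (simp del: map_map)
qed

lemma rho_ge: "typical w \<Longrightarrow> i \<le> rho i w"
  unfolding rho_def by (rule le_enumerate[OF typical_infinite])

text \<open>\<open>rho i w \<ge> i\<close> allows at most n pivots before n, so truncating the
  renewal sums at n loses nothing.\<close>

lemma passage_index:
  assumes t: "typical w"
  obtains k where "k \<le> n" "\<And>i. rho i w < n \<longleftrightarrow> i < k" "rho k w = n + gapR (int n) w"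
proof -
  define k where "k = (LEAST i. n \<le> rho i w)"
  have kn: "k \<le> n" unfolding k_def by (rule Least_le) (rule rho_ge[OF t])
  have nk: "n \<le> rho k w" unfolding k_def by (rule LeastI_ex) (use rho_ge[OF t] in blast)
  have lt: "rho i w < n \<longleftrightarrow> i < k" for i
  proof
    assume "rho i w < n"
    then show "i < k" using nk rho_mono[OF t, of k i] by (metis less_trans linorder_neqE_nat not_le)
  next
    assume "i < k"
    then show "rho i w < n" using not_less_Least[of i "\<lambda>i. n \<le> rho i w"] by (simp add: k_def)
  qed
  have "gapR (int n) w = rho k w - n" unfolding gapR_def
  proof (rule Least_equality)
    show "piv w (int n + int (rho k w - n))" using rho_piv[OF t, of k] nk by (simp add: of_nat_diff)
    fix j assume "piv w (int n + int j)"
    then obtain i where i: "rho i w = n + j"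
      using enumerate_Ex[OF typical_infinite[OF t], of "n + j"] by (auto simp: rho_def)
    then have "\<not> i < k" using lt[of i] by simp
    then have "rho k w \<le> rho i w" using rho_mono[OF t, of k i] by (cases "i = k") auto
    then show "rho k w - n \<le> j" using i by simp
  qed
  then show ?thesis using that[of k] kn lt nk by simp
qed

text \<open>Every pivot between the two ends is a cut vertex, so hop numbers add up along the
  blocks.\<close>

lemma block_sums:
  assumes t: "typical w" and ij: "i \<le> j"
  shows "(\<Sum>n=i..<j. fst (block (Suc n) w)) = rho j w - rho i w"
    and "(\<Sum>n=i..<j. snd (block (Suc n) w)) = mhops l w (int (rho i w)) (int (rho j w))"
proof -
  have g: "good l m w" using t by (simp add: typical_def)
  have le: "rho i w \<le> rho n w" if "i \<le> n" for n
    using rho_mono[OF t, of i n] that by (cases "i = n") auto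
  have "(\<Sum>n=i..<j. fst (block (Suc n) w)) = rho j w - rho i w \<and>
    (\<Sum>n=i..<j. snd (block (Suc n) w)) = mhops l w (int (rho i w)) (int (rho j w))"
    using ij
  proof (induction j rule: dec_induct)
    case base
    show ?case by (simp add: mhops_same[OF g])
  next
    case (step n)
    have lt: "rho n w < rho (Suc n) w" using rho_mono[OF t] by simp
    have "mhops l w (int (rho i w)) (int (rho (Suc n) w)) =
        mhops l w (int (rho i w)) (int (rho n w)) + mhops l w (int (rho n w)) (int (rho (Suc n) w))"
      by (rule mhops_split[OF g rho_piv[OF t, of i] rho_piv[OF t, of n] rho_piv[OF t, of "Suc n"]])
        (use le[of n] lt step rho_piv[OF t, of "Suc n"] in auto)
    then show ?case using step le[of n] lt by (simp add: block_Suc)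
  qed
  then show "(\<Sum>n=i..<j. fst (block (Suc n) w)) = rho j w - rho i w"
    "(\<Sum>n=i..<j. snd (block (Suc n) w)) = mhops l w (int (rho i w)) (int (rho j w))" by auto
qed

text \<open>Let x be the first pivot from 0 on, y the last up to n - K and y' the first from n on.
  If x \<le> y, both hop numbers split at x and y and share the middle piece; the pieces left over
  are bounded by distances of pivots.\<close>

lemma boundary_hops:
  assumes t: "typical w"
  shows "\<bar>real (mhops l w 0 (int n)) - real (mhops l w (int (gapR 0 w)) (int n + int (gapR (int n) w)))\<bar> \<le> remainder n w"
proof -
  have g: "good l m w" and exr: "\<And>x. \<exists>j. piv w (x + int j)" and exl: "\<And>x. \<exists>j. piv w (x - int j)"
    using t by (auto simp: typical_def)
  define x xm y y' where "x = int (gapR 0 w)" and "xm = - int (gapL 0 w)" and "y = int n - K - int (gapL (int n - K) w)"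
    and "y' = int n + int (gapR (int n) w)"
  have pR: "piv w (z + int (gapR z w))" for z unfolding gapR_def by (rule LeastI_ex[OF exr])
  have pL: "piv w (z - int (gapL z w))" for z unfolding gapL_def by (rule LeastI_ex[OF exl])
  have p: "piv w x" "piv w xm" "piv w y" "piv w y'"
    using pR[of 0] pL[of 0] pL[of "int n - K"] pR[of "int n"] by (simp_all add: x_def xm_def y_def y'_def)
  have xy': "x \<le> y'"
  proof -
    have "gapR 0 w \<le> n + gapR (int n) w" unfolding gapR_def[of 0] by (rule Least_le) (use p(4) in \<open>simp add: y'_def\<close>)
    then show ?thesis by (simp add: x_def y'_def)
  qed
  have ord: "xm \<le> 0" "0 \<le> x" "y + K \<le> int n" "int n \<le> y'" "y \<le> int n" using K_nonneg by (auto simp: xm_def x_def y_def y'_def)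
  have R: "remainder n w = real_of_int ((x - xm) + (y' - y))"
    by (simp add: remainder_def x_def xm_def y_def y'_def)
  have "\<bar>int (mhops l w 0 (int n)) - int (mhops l w x y')\<bar> \<le> (x - xm) + (y' - y)"
  proof (cases "x \<le> y")
    case True
    have s1: "mhops l w 0 (int n) = mhops l w 0 x + mhops l w x (int n)"
      by (rule mhops_split[OF g p(2,1,4)]) (use ord True K_nonneg in auto)
    have s2: "mhops l w x (int n) = mhops l w x y + mhops l w y (int n)"
      by (rule mhops_split[OF g p(1,3,4)]) (use ord True K_nonneg in auto)
    have s3: "mhops l w x y' = mhops l w x y + mhops l w y y'"
      by (rule mhops_split[OF g p(1,3,4)]) (use ord True K_nonneg in auto)
    have "int (mhops l w 0 x) \<le> x - xm" by (rule mhops_le_pivots[OF g p(2,1)]) (use ord in auto)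
    moreover have "int (mhops l w y (int n)) \<le> y' - y" "int (mhops l w y y') \<le> y' - y"
      by (rule mhops_le_pivots[OF g p(3,4)]; use ord in auto)+
    ultimately show ?thesis using s1 s2 s3 ord by linarith
  next
    case False
    \<comment> \<open>Now y < x, so the two intervals measured by \<open>remainder\<close> cover the
      whole span from xm to y'.\<close>
    have "int (mhops l w 0 (int n)) \<le> y' - xm" by (rule mhops_le_pivots[OF g p(2,4)]) (use ord in auto)
    moreover have "int (mhops l w x y') \<le> y' - x" by (rule mhops_le_pivots[OF g p(1,4)]) (use ord xy' in auto)
    ultimately show ?thesis using False ord xy' by linarith
  qed
  then have "real_of_int \<bar>int (mhops l w 0 (int n)) - int (mhops l w x y')\<bar> \<le> remainder n w"
    unfolding R of_int_le_iff .
  then show ?thesis by (simp add: x_def y'_def)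
qed

sublocale RR: renewal_reward N block "\<lambda>n w. real (mhops l w 0 (int n))" remainder rem_bound
proof
  fix n
  show "integrable N (\<lambda>w. real (fst (block 1 w)) ^ 4)" by (rule gap_fourth)
  show "integrable N (\<lambda>w. real (snd (block 1 w)) ^ 4)" by (rule reward_fourth)
  show "N.expectation (\<lambda>w. real (fst (block 1 w))) \<ge> 1" by (rule gap_mean_ge)
  show "(\<lambda>w. real (mhops l w 0 (int n))) \<in> borel_measurable N"
    by (rule measurable_compose[OF mhops_rv]) simp
  show "remainder n \<in> borel_measurable N" by (rule remainder_rv)
  show "integrable N (\<lambda>w. remainder n w ^ 4)" "N.expectation (\<lambda>w. remainder n w ^ 4) \<le> rem_bound" by (rule remainder_moment)+
  have sum: "(\<Sum>i<n. of_bool (sum_list (map fst (BS.hist (Suc i) w)) < n) * real (f (block (Suc i) w))) =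
      real (\<Sum>i=0..<k. f (block (Suc i) w))"
    if "typical w" "k \<le> n" "\<And>i. rho i w < n \<longleftrightarrow> i < k" for w k and f :: "nat \<times> nat \<Rightarrow> nat"
    unfolding hist_position[OF that(1)] that(3) of_nat_sum
    using that(2) by (intro sum.mono_neutral_cong_right) auto
  show "AE w in N. \<bar>real (mhops l w 0 (int n)) -
      (\<Sum>i<n. of_bool (sum_list (map fst (BS.hist (Suc i) w)) < n) * real (snd (block (Suc i) w)))\<bar> \<le> remainder n w"
    using AE_typical
  proof eventually_elim
    case (elim w)
    obtain k where k: "k \<le> n" "\<And>i. rho i w < n \<longleftrightarrow> i < k" "rho k w = n + gapR (int n) w"
      using passage_index[OF elim] by metis
    have "rho 0 w = gapR 0 w" by (simp add: rho_def gapR_def enumerate_0)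
    then show ?case
      unfolding sum[OF elim k(1,2)] using block_sums(2)[OF elim, of 0 k] boundary_hops[OF elim, of n] k(3) by simp
  qed
  show "AE w in N. \<bar>real n -
      (\<Sum>i<n. of_bool (sum_list (map fst (BS.hist (Suc i) w)) < n) * real (fst (block (Suc i) w)))\<bar> \<le> remainder n w"
    using AE_typical
  proof eventually_elim
    case (elim w)
    obtain k where k: "k \<le> n" "\<And>i. rho i w < n \<longleftrightarrow> i < k" "rho k w = n + gapR (int n) w"
      using passage_index[OF elim] by metis
    have r0: "rho 0 w = gapR 0 w" by (simp add: rho_def gapR_def enumerate_0)
    have "rho 0 w \<le> rho k w" using rho_mono[OF elim, of 0 k] by (cases "k = 0") auto
    then have "real (rho k w - rho 0 w) = real n + real (gapR (int n) w) - real (gapR 0 w)"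
      using k(3) r0 by (simp add: of_nat_diff)
    then show ?case
      unfolding sum[OF elim k(1,2)] using block_sums(1)[OF elim, of 0 k] K_nonneg by (simp add: remainder_def)
  qed
qed

lemma mu_pos: "0 < RR.\<mu>"
  using gap_mean_ge reward_mean_ge by (simp add: RR.\<mu>_def RR.EH_def RR.EP_def)

lemma AE_positive_witness:
  assumes "AE w in N. P w" "N.prob {w\<in>space N. Q w} > 0"
  shows "\<exists>w. P w \<and> Q w"
proof (rule ccontr)
  assume none: "\<not> (\<exists>w. P w \<and> Q w)"
  have "AE w in N. \<not> Q w" by (rule AE_mp[OF assms(1)]) (use none in auto)
  then have "N.prob {w\<in>space N. Q w} = 0"
    by (cases "{w\<in>space N. Q w} \<in> N.events") (auto simp: N.prob_Collect_eq_0 measure_notin_sets)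
  then show False using assms(2) by simp
qed

lemma sig2_pos: "0 < RR.sig2"
proof (rule ccontr)
  assume "\<not> 0 < RR.sig2"
  then have s0: "RR.sig2 = 0" using RR.G.s2_nonneg by simp
  have "AE w in N. RR.g (block (Suc i) w) = 0" for i
  proof -
    have "N.expectation (\<lambda>w. (RR.g (block (Suc i) w))\<^sup>2) = 0"
      using BS.X_expectation[of "\<lambda>z. (RR.g z)\<^sup>2" i] s0 by (simp add: RR.G.s2_def)
    then have "AE w in N. (RR.g (block (Suc i) w))\<^sup>2 = 0"
      by (subst (asm) integral_nonneg_eq_0_iff_AE) (use RR.G.g_power_integrable[of 2 i] in auto)
    then show ?thesis by simp
  qed
  then have "AE w in N. \<forall>i. RR.g (block (Suc i) w) = 0" by (simp add: AE_all_countable)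
  \<comment> \<open>Summation over blocks extends the proportionality from consecutive pivots to any
    two. The restriction u \<ge> 0 is there because blocks enumerate the pivots from 0 on.\<close>
  with AE_typical have rigid: "AE w in N. good l m w \<and>
      (\<forall>u v. 0 \<le> u \<and> u < v \<and> piv w u \<and> piv w v \<longrightarrow> real (mhops l w u v) = RR.\<mu> * real_of_int (v - u))"
  proof eventually_elim
    case (elim w)
    note t = elim(1)
    have "real (mhops l w u v) = RR.\<mu> * real_of_int (v - u)" if uv: "0 \<le> u" "u < v" "piv w u" "piv w v" for u v
    proof -
      obtain i where i: "rho i w = nat u"
        using enumerate_Ex[OF typical_infinite[OF t], of "nat u"] uv by (auto simp: rho_def)
      obtain j where j: "rho j w = nat v"
        using enumerate_Ex[OF typical_infinite[OF t], of "nat v"] uv by (auto simp: rho_def)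
      have "\<not> j \<le> i" using rho_mono[OF t, of j i] i j uv by (cases "i = j") auto
      then have ij: "i \<le> j" by simp
      have "real (\<Sum>n=i..<j. snd (block (Suc n) w)) = (\<Sum>n=i..<j. RR.\<mu> * real (fst (block (Suc n) w)))"
        unfolding of_nat_sum using elim(2) by (intro sum.cong refl) (simp add: RR.g_def)
      also have "\<dots> = RR.\<mu> * real (\<Sum>n=i..<j. fst (block (Suc n) w))" by (simp add: sum_distrib_left)
      finally show ?thesis unfolding block_sums[OF t ij] using i j uv by (simp add: of_nat_diff)
    qed
    moreover have "good l m w" using t by (simp add: typical_def)
    ultimately show ?case by blast
  qed
  have far: "N.prob {w\<in>space N. piv w 0 \<and> piv w v} > 0" if "v \<ge> int W" for v
  proof -
    have a: "dep {e\<in>edges l. snd e \<le> rad} (\<lambda>w. piv w 0)" by (rule piv_dep) auto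
    have b: "dep {e\<in>edges l. v - rad \<le> fst e} (\<lambda>w. piv w v)" by (rule piv_dep) auto
    have "{e\<in>edges l. snd e \<le> rad} \<inter> {e\<in>edges l. v - rad \<le> fst e} = {}"
      using W that by (auto simp: edges_def)
    from dep_indep[OF this a b] have "N.prob {w\<in>space N. piv w 0 \<and> piv w v} = piv_prob * piv_prob"
      by (simp add: prob_piv)
    then show ?thesis using piv_prob_pos by simp
  qed
  have int: "\<exists>h::nat. real h = RR.\<mu> * real_of_int v" if v: "v \<ge> int W" for v
  proof -
    obtain w where "good l m w \<and> (\<forall>u v. 0 \<le> u \<and> u < v \<and> piv w u \<and> piv w v \<longrightarrow>
        real (mhops l w u v) = RR.\<mu> * real_of_int (v - u))" "piv w 0 \<and> piv w v"
      using AE_positive_witness[OF rigid far[OF v]] by blast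
    moreover have "0 < v" using v W by simp
    ultimately have "real (mhops l w 0 v) = RR.\<mu> * real_of_int v" by force
    then show ?thesis by blast
  qed
  \<comment> \<open>W and W + 1 are the two least distances covered by \<open>far\<close>;
    subtracting the integers belonging to them gives \<mu>.\<close>
  obtain h1 h2 :: nat where "real h1 = RR.\<mu> * real_of_int (int W)" "real h2 = RR.\<mu> * real_of_int (int W + 1)"
    using int[of "int W"] int[of "int W + 1"] by auto
  then have "RR.\<mu> = real_of_int (int h2 - int h1)" by (simp add: algebra_simps)
  moreover from this have "int h2 - int h1 \<ge> 1" using mu_pos by simp
  ultimately have mu1: "RR.\<mu> \<ge> 1" by simp
  obtain v A' B' where v: "v > 0" and AB: "finite A'" "finite B'" "A' \<subseteq> edges l" "B' \<subseteq> edges l" "A' \<inter> B' = {}"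
    and short: "\<And>w. good l m w \<Longrightarrow> \<forall>e\<in>A'. w e \<in> Lt \<Longrightarrow> \<forall>e\<in>B'. w e \<in> Hv \<Longrightarrow>
        piv w 0 \<and> piv w v \<and> int (mhops l w 0 v) < v"
    using short_block by metis
  obtain w where w: "good l m w \<and> (\<forall>u v. 0 \<le> u \<and> u < v \<and> piv w u \<and> piv w v \<longrightarrow>
      real (mhops l w u v) = RR.\<mu> * real_of_int (v - u))" "(\<forall>e\<in>A'. w e \<in> Lt) \<and> (\<forall>e\<in>B'. w e \<in> Hv)"
    using AE_positive_witness[OF rigid prescribed_pos[OF AB]] by blast
  have s: "piv w 0" "piv w v" "int (mhops l w 0 v) < v" using short[of w] w by auto
  then have "real (mhops l w 0 v) = RR.\<mu> * real_of_int v" using w(1) v by force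
  moreover have "real_of_int v \<le> RR.\<mu> * real_of_int v" using mu1 v by simp
  ultimately show False using s(3) by linarith
qed

end

section \<open>The limit laws\<close>

text \<open>The weights, restricted to the edges, have law N on the canonical space, so everything
  proved there is pulled back along \<Phi>. As the weights are nonnegative, \<open>hops\<close>
  equals \<open>mhops\<close>.\<close>

lemma (in percolation) limit_laws:
  fixes M :: "'a measure" and Wt :: "int \<times> int \<Rightarrow> 'a \<Rightarrow> real"
  assumes M: "prob_space M"
    and ind: "prob_space.indep_vars M (\<lambda>_. borel) Wt (edges l)"
    and law: "\<forall>e\<in>edges l. distr M borel (Wt e) = D"
    and nn: "\<forall>e\<in>edges l. \<forall>\<xi>\<in>space M. Wt e \<xi> \<ge> 0"
  defines "H \<equiv> \<lambda>n \<xi>. real (hops l (\<lambda>e. Wt e \<xi>) 0 (int n))"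
  defines "P1 \<equiv> \<lambda>\<xi>. pivot_gap piv (\<lambda>e. Wt e \<xi>)"
  defines "H1 \<equiv> \<lambda>\<xi>. pivot_hops l piv (\<lambda>e. Wt e \<xi>)"
  defines "\<mu>P \<equiv> (\<integral>\<xi>. P1 \<xi> \<partial>M)"
  defines "\<mu>H \<equiv> (\<integral>\<xi>. H1 \<xi> \<partial>M)"
  defines "\<sigma>2 \<equiv> 1 / \<mu>P * prob_space.variance M (\<lambda>\<xi>. H1 \<xi> - \<mu>H / \<mu>P * P1 \<xi>)"
  shows "AE \<xi> in M. (\<lambda>n. H n \<xi> / real n) \<longlonglongrightarrow> RR.\<mu>"
    and "\<forall>n. integrable M (H n)"
    and "(\<lambda>n. (\<integral>\<xi>. H n \<xi> \<partial>M) / real n) \<longlonglongrightarrow> RR.\<mu>"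
    and "integrable M P1" and "integrable M H1"
    and "integrable M (\<lambda>\<xi>. (H1 \<xi> - \<mu>H / \<mu>P * P1 \<xi>)\<^sup>2)"
    and "\<sigma>2 > 0"
    and "weak_conv_m (\<lambda>n. distr M borel (\<lambda>\<xi>. (H n \<xi> - real n * RR.\<mu>) / sqrt (real n)))
            (density lborel (\<lambda>t. ennreal (normal_density 0 (sqrt \<sigma>2) t)))"
proof -
  interpret M: prob_space M by (rule M)
  define \<Phi> where "\<Phi> \<xi> = (\<lambda>e\<in>edges l. Wt e \<xi>)" for \<xi>
  have ne: "edges l \<noteq> {}"
  proof -
    have "(0, 1) \<in> edges l" using l2 by (simp add: edges_def)
    then show ?thesis by blast
  qed
  have rv: "Wt e \<in> borel_measurable M" if "e \<in> edges l" for e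
    using ind that unfolding M.indep_vars_def by auto
  have sets_N: "sets N = sets (\<Pi>\<^sub>M e\<in>edges l. borel)"
    unfolding N_def by (intro sets_PiM_cong refl sets_D)
  have \<Phi>_rv [measurable]: "\<Phi> \<in> measurable M N"
  proof -
    have "\<Phi> \<in> measurable M (\<Pi>\<^sub>M e\<in>edges l. borel)"
      unfolding \<Phi>_def[abs_def] by (intro measurable_restrict rv)
    then show ?thesis using measurable_cong_sets[OF refl sets_N, of M] by simp
  qed
  \<comment> \<open>Independence with common law D says precisely that the joint law is the product
    measure.\<close>
  have "distr M (\<Pi>\<^sub>M e\<in>edges l. borel) \<Phi> = (\<Pi>\<^sub>M e\<in>edges l. distr M borel (Wt e))"
    using M.indep_vars_iff_distr_eq_PiM'[where M' = "\<lambda>_. borel" and X = Wt, OF ne] rv ind by (simp add: \<Phi>_def[abs_def])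
  also have "\<dots> = N" unfolding N_def by (intro PiM_cong refl) (use law in auto)
  also have "distr M (\<Pi>\<^sub>M e\<in>edges l. borel) \<Phi> = distr M N \<Phi>"
    by (intro distr_cong refl sets_N[symmetric])
  finally have dN: "distr M N \<Phi> = N" .
  have tr_AE: "AE \<xi> in M. P (\<Phi> \<xi>)" if "AE w in N. P w" for P
    by (rule AE_distrD[OF \<Phi>_rv, of P, unfolded dN, OF that])
  have tr_int: "(\<integral>\<xi>. f (\<Phi> \<xi>) \<partial>M) = (\<integral>w. f w \<partial>N)" if "f \<in> borel_measurable N" for f :: "_ \<Rightarrow> real"
    using integral_distr[OF \<Phi>_rv that] by (simp add: dN)
  have tr_integrable: "integrable M (\<lambda>\<xi>. f (\<Phi> \<xi>))" if "integrable N f" for f :: "_ \<Rightarrow> real"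
    using integrable_distr[OF \<Phi>_rv, of f] that by (simp add: dN)
  have eqw: "\<forall>e\<in>edges l. Wt e \<xi> = \<Phi> \<xi> e" for \<xi> by (simp add: \<Phi>_def)
  have hops: "hops l (\<lambda>e. Wt e \<xi>) u v = mhops l (\<Phi> \<xi>) u v" if "\<xi> \<in> space M" for \<xi> u v
    using hops_eq_mhops[of l "\<lambda>e. Wt e \<xi>" u v] nn that mhops_cong_edges[of l "\<lambda>e. Wt e \<xi>" "\<Phi> \<xi>" u v] eqw by auto
  have pivs: "piv (\<lambda>e. Wt e \<xi>) x \<longleftrightarrow> piv (\<Phi> \<xi>) x" for \<xi> x
    by (rule piv_cong) (use eqw in auto)
  have H: "H n \<xi> = real (mhops l (\<Phi> \<xi>) 0 (int n))" if "\<xi> \<in> space M" for n \<xi>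
    using hops[OF that] by (simp add: H_def)
  have npiv: "nth_pivot piv (\<lambda>e. Wt e \<xi>) i = int (rho i (\<Phi> \<xi>))" for i \<xi>
    by (simp add: nth_pivot_def rho_def pivs)
  have H1: "H1 \<xi> = real (snd (block 1 (\<Phi> \<xi>)))" if "\<xi> \<in> space M" for \<xi>
    using hops[OF that] by (simp add: H1_def pivot_hops_def npiv block_Suc)
  \<comment> \<open>\<open>pivot_gap\<close> subtracts integers, \<open>block\<close> natural
    numbers; they agree where the pivots increase, hence almost surely.\<close>
  define p1 where "p1 w = real (rho 1 w) - real (rho 0 w)" for w
  have P1: "P1 \<xi> = p1 (\<Phi> \<xi>)" for \<xi>
    by (simp add: P1_def pivot_gap_def npiv p1_def)
  have p1_rv [measurable]: "p1 \<in> borel_measurable N"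
  proof -
    have "(\<lambda>w. real (rho i w)) \<in> borel_measurable N" for i
      by (rule measurable_compose[OF rho_rv]) simp
    then show ?thesis unfolding p1_def[abs_def] by (intro borel_measurable_diff)
  qed
  have p1_AE: "AE w in N. p1 w = real (fst (block 1 w))"
    using AE_typical
  proof eventually_elim
    case (elim w)
    show ?case using rho_mono[OF elim, of 0 1] by (simp add: p1_def block_Suc of_nat_diff)
  qed
  have mh_rv [measurable]: "(\<lambda>w. real (mhops l w u v)) \<in> borel_measurable N" for u v
    by (rule measurable_compose[OF mhops_rv]) simp
  show "AE \<xi> in M. (\<lambda>n. H n \<xi> / real n) \<longlonglongrightarrow> RR.\<mu>"
    using tr_AE[OF RR.LLN_AE] AE_space
  proof eventually_elim
    case (elim \<xi>)
    then show ?case by (simp add: H)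
  qed
  have Hint: "integrable M (H n)" for n
  proof -
    have "integrable M (H n) \<longleftrightarrow> integrable M (\<lambda>\<xi>. real (mhops l (\<Phi> \<xi>) 0 (int n)))"
      by (intro Bochner_Integration.integrable_cong refl H)
    then show ?thesis using tr_integrable[OF RR.H_integrable[of n]] by simp
  qed
  then show "\<forall>n. integrable M (H n)" by blast
  have "(\<integral>\<xi>. H n \<xi> \<partial>M) = N.expectation (\<lambda>w. real (mhops l w 0 (int n)))" for n
  proof -
    have "(\<integral>\<xi>. H n \<xi> \<partial>M) = (\<integral>\<xi>. real (mhops l (\<Phi> \<xi>) 0 (int n)) \<partial>M)"
      by (intro Bochner_Integration.integral_cong refl H)
    then show ?thesis using tr_int[OF mh_rv[of 0 "int n"]] by simp
  qed
  then show "(\<lambda>n. (\<integral>\<xi>. H n \<xi> \<partial>M) / real n) \<longlonglongrightarrow> RR.\<mu>" using RR.LLN_mean by simp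
  have p1_int: "integrable N p1"
    using integrable_cong_AE[OF p1_rv block_real_rv(1)[of 1] p1_AE] RR.fst_int by simp
  show P1_int: "integrable M P1" using tr_integrable[OF p1_int] by (simp add: P1[abs_def])
  show "integrable M H1"
  proof -
    have "integrable M H1 \<longleftrightarrow> integrable M (\<lambda>\<xi>. real (snd (block 1 (\<Phi> \<xi>))))"
      by (intro Bochner_Integration.integrable_cong refl H1)
    then show ?thesis using tr_integrable[OF RR.snd_int] by simp
  qed
  have \<mu>P: "\<mu>P = RR.EP"
    using tr_int[OF p1_rv] integral_cong_AE[OF p1_rv block_real_rv(1)[of 1] p1_AE]
    by (simp add: \<mu>P_def P1[abs_def] RR.EP_def)
  have \<mu>H: "\<mu>H = RR.EH"
  proof -
    have "(\<integral>\<xi>. H1 \<xi> \<partial>M) = (\<integral>\<xi>. real (snd (block 1 (\<Phi> \<xi>))) \<partial>M)"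
      by (intro Bochner_Integration.integral_cong refl H1)
    then show ?thesis using tr_int[OF block_real_rv(2)[of 1]] by (simp add: \<mu>H_def RR.EH_def)
  qed
  define h where "h w = real (snd (block 1 w)) - RR.\<mu> * p1 w" for w
  have h_rv [measurable]: "h \<in> borel_measurable N"
    unfolding h_def[abs_def] by measurable
  have h: "H1 \<xi> - \<mu>H / \<mu>P * P1 \<xi> = h (\<Phi> \<xi>)" if "\<xi> \<in> space M" for \<xi>
    using H1[OF that] by (simp add: h_def P1 \<mu>P \<mu>H RR.\<mu>_def)
  have h_AE: "AE w in N. h w = RR.g (block 1 w)"
    using p1_AE by eventually_elim (simp add: h_def RR.g_def)
  have g_rv [measurable]: "(\<lambda>w. RR.g (block 1 w)) \<in> borel_measurable N"
    by (rule measurable_compose[OF block_rv]) simp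
  have h2_AE: "AE w in N. (h w)\<^sup>2 = (RR.g (block 1 w))\<^sup>2" using h_AE by eventually_elim simp
  have h2_int: "integrable N (\<lambda>w. (h w)\<^sup>2)"
    using integrable_cong_AE[OF _ _ h2_AE] RR.G.g_power_integrable[of 2 0] by simp
  show "integrable M (\<lambda>\<xi>. (H1 \<xi> - \<mu>H / \<mu>P * P1 \<xi>)\<^sup>2)"
  proof -
    have "integrable M (\<lambda>\<xi>. (H1 \<xi> - \<mu>H / \<mu>P * P1 \<xi>)\<^sup>2) \<longleftrightarrow> integrable M (\<lambda>\<xi>. (h (\<Phi> \<xi>))\<^sup>2)"
      by (intro Bochner_Integration.integrable_cong refl) (simp only: h)
    then show ?thesis using tr_integrable[OF h2_int] by simp
  qed
  have Eh: "(\<integral>\<xi>. H1 \<xi> - \<mu>H / \<mu>P * P1 \<xi> \<partial>M) = 0"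
  proof -
    have "(\<integral>\<xi>. H1 \<xi> - \<mu>H / \<mu>P * P1 \<xi> \<partial>M) = (\<integral>\<xi>. h (\<Phi> \<xi>) \<partial>M)"
      by (intro Bochner_Integration.integral_cong refl h)
    also have "\<dots> = (\<integral>w. RR.g (block 1 w) \<partial>N)"
      using tr_int[OF h_rv] integral_cong_AE[OF h_rv g_rv h_AE] by simp
    finally show ?thesis using RR.G.g_mean by simp
  qed
  have "(\<integral>\<xi>. (H1 \<xi> - \<mu>H / \<mu>P * P1 \<xi>)\<^sup>2 \<partial>M) = (\<integral>\<xi>. (h (\<Phi> \<xi>))\<^sup>2 \<partial>M)"
    by (intro Bochner_Integration.integral_cong refl) (simp only: h)
  also have "\<dots> = (\<integral>w. (h w)\<^sup>2 \<partial>N)" by (rule tr_int) measurable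
  also have "\<dots> = (\<integral>w. (RR.g (block 1 w))\<^sup>2 \<partial>N)" by (rule integral_cong_AE[OF _ _ h2_AE]) measurable
  also have "\<dots> = RR.sig2" by (simp add: RR.G.s2_def)
  finally have var: "prob_space.variance M (\<lambda>\<xi>. H1 \<xi> - \<mu>H / \<mu>P * P1 \<xi>) = RR.sig2" unfolding Eh by simp
  have \<sigma>: "\<sigma>2 = 1 / RR.EP * RR.sig2" unfolding \<sigma>2_def var by (simp only: \<mu>P)
  show "\<sigma>2 > 0" unfolding \<sigma> using sig2_pos RR.EP1 by simp
  have "distr M borel (\<lambda>\<xi>. (H n \<xi> - real n * RR.\<mu>) / sqrt (real n)) =
      distr N borel (\<lambda>w. (real (mhops l w 0 (int n)) - real n * RR.\<mu>) / sqrt (real n))" for n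
  proof -
    let ?f = "\<lambda>w. (real (mhops l w 0 (int n)) - real n * RR.\<mu>) / sqrt (real n)"
    have "distr N borel ?f = distr (distr M N \<Phi>) borel ?f" by (simp only: dN)
    also have "\<dots> = distr M borel (?f \<circ> \<Phi>)" by (rule distr_distr) measurable
    also have "\<dots> = distr M borel (\<lambda>\<xi>. (H n \<xi> - real n * RR.\<mu>) / sqrt (real n))"
      by (intro distr_cong refl) (simp add: H)
    finally show ?thesis ..
  qed
  then show "weak_conv_m (\<lambda>n. distr M borel (\<lambda>\<xi>. (H n \<xi> - real n * RR.\<mu>) / sqrt (real n)))
            (density lborel (\<lambda>t. ennreal (normal_density 0 (sqrt \<sigma>2) t)))"
    unfolding \<sigma> using RR.CLT[OF sig2_pos] by simp
qed

section \<open>The support of the weight law and the choice of a pivot notion\<close>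

locale weight_law = prob_space D for D :: "real measure" +
  assumes sets_D [measurable_cong]: "sets D = sets borel" and nonneg: "AE t in D. 0 \<le> t"
begin

text \<open>The complement of the support is a union of open null sets, and by the Lindelof property
  countably many of them cover it.\<close>

lemma AE_support: "AE t in D. t \<in> law_support D"
proof -
  define F where "F = {U :: real set. open U \<and> measure D U = 0}"
  obtain F' where F': "F' \<subseteq> F" "countable F'" "\<Union>F' = \<Union>F"
    using Lindelof[of F] by (auto simp: F_def)
  have "AE t in D. \<forall>U\<in>F'. t \<notin> U"
    unfolding AE_ball_countable[OF F'(2)]
  proof
    fix U assume "U \<in> F'"
    then have "open U" "measure D U = 0" using F' by (auto simp: F_def)
    then show "AE t in D. t \<notin> U" using prob_eq_0[of U] by (simp add: sets_D)
  qed
  then show ?thesis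
  proof (rule AE_mp, intro AE_I2 impI)
    fix t assume "\<forall>U\<in>F'. t \<notin> U"
    then have "t \<notin> \<Union>F" using F'(3) by blast
    then show "t \<in> law_support D"
      by (auto simp: F_def law_support_def zero_less_measure_iff)
  qed
qed

lemma support_nonempty: "law_support D \<noteq> {}"
proof
  assume "law_support D = {}"
  then have "AE t in D. False" using AE_support by simp
  then show False by simp
qed

lemma support_ge:
  assumes "AE t in D. c \<le> t" "x \<in> law_support D"
  shows "c \<le> x"
proof (rule ccontr)
  assume "\<not> c \<le> x"
  then have "measure D {..<c} > 0" using assms(2) by (auto simp: law_support_def)
  moreover have "measure D {..<c} = 0"
    by (subst prob_eq_0) (use assms(1) in \<open>auto simp: sets_D not_less\<close>)
  ultimately show False by simp
qed

definition ess_inf :: real where "ess_inf = Inf (law_support D)"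

lemma ess_inf_ge: "AE t in D. c \<le> t \<Longrightarrow> c \<le> ess_inf"
  unfolding ess_inf_def by (intro cInf_greatest support_nonempty support_ge)

lemma support_bdd: "bdd_below (law_support D)"
  using support_ge[OF nonneg] by (intro bdd_belowI[of _ 0])

lemma AE_ess_inf: "AE t in D. ess_inf \<le> t"
  by (rule AE_mp[OF AE_support]) (auto simp: ess_inf_def intro!: cInf_lower support_bdd)

lemma below_pos:
  assumes "ess_inf < b"
  shows "measure D {t. t < b} > 0"
proof -
  obtain s where "s \<in> law_support D" "s < b"
    using assms cInf_less_iff[OF support_nonempty support_bdd] by (auto simp: ess_inf_def)
  then have "measure D {..<b} > 0" by (auto simp: law_support_def)
  then show ?thesis by (simp add: lessThan_def)
qed

lemma countable_pos:
  fixes S :: "nat \<Rightarrow> real set"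
  assumes "measure D (\<Union>n. S n) > 0" and S: "\<And>n. S n \<in> sets borel"
  shows "\<exists>n. measure D (S n) > 0"
proof (rule ccontr)
  assume "\<not> (\<exists>n. measure D (S n) > 0)"
  then have z: "measure D (S n) = 0" for n by (simp add: zero_less_measure_iff)
  have "AE t in D. t \<notin> S n" for n using z[of n] prob_eq_0[of "S n"] S by (simp add: sets_D)
  then have "AE t in D. \<forall>n. t \<notin> S n" by (simp add: AE_all_countable)
  then have "measure D (\<Union>n. S n) = 0" by (subst prob_eq_0) (use S in \<open>auto simp: sets_D\<close>)
  then show False using assms by simp
qed

text \<open>\<open>{t. a < t}\<close> is the countable union of its versions with slack
  \<bar>b\<bar> / (n + 1), so one of these has positive mass.\<close>

lemma above_pos:
  assumes "measure D {t. a < t} > 0"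
  shows "\<exists>n::nat. measure D {t. a + b / real (n + 1) < t} > 0"
proof -
  have "(\<Union>n. {t. a + \<bar>b\<bar> / real (n + 1) < t}) = {t. a < t}"
  proof (intro equalityI subsetI)
    fix t assume "t \<in> {t. a < t}"
    then have "0 < t - a" by simp
    obtain n :: nat where n: "\<bar>b\<bar> / (t - a) < real n" using reals_Archimedean2 by blast
    then have "\<bar>b\<bar> < real (n + 1) * (t - a)"
      using \<open>0 < t - a\<close> by (simp add: pos_divide_less_eq algebra_simps)
    then have "\<bar>b\<bar> / real (n + 1) < t - a" by (simp add: pos_divide_less_eq mult.commute)
    then have "a + \<bar>b\<bar> / real (n + 1) < t" by simp
    then show "t \<in> (\<Union>n. {t. a + \<bar>b\<bar> / real (n + 1) < t})" by blast
  next
    fix t assume "t \<in> (\<Union>n. {t. a + \<bar>b\<bar> / real (n + 1) < t})"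
    then obtain n :: nat where "a + \<bar>b\<bar> / real (n + 1) < t" by auto
    moreover have "0 \<le> \<bar>b\<bar> / real (n + 1)" by simp
    ultimately have "a < t" by linarith
    then show "t \<in> {t. a < t}" by simp
  qed
  then obtain n :: nat where n: "measure D {t. a + \<bar>b\<bar> / real (n + 1) < t} > 0"
    using countable_pos[of "\<lambda>n. {t. a + \<bar>b\<bar> / real (n + 1) < t}"] assms by auto
  have "b / real (n + 1) \<le> \<bar>b\<bar> / real (n + 1)" by (intro divide_right_mono) auto
  then have "measure D {t. a + \<bar>b\<bar> / real (n + 1) < t} \<le> measure D {t. a + b / real (n + 1) < t}"
    by (intro finite_measure_mono) (auto simp: sets_D)
  then show ?thesis using n by (intro exI[of _ n]) linarith
qed

text \<open>If the weights exceed twice their essential infimum with positive probability, B.1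
  applies; otherwise they lie between the infimum and its double, which leads to B.2.\<close>

lemma notion_exists:
  assumes nondet: "\<not> (\<exists>c. AE t in D. t = c)"
  shows "\<exists>piv. pivot_notion l D piv"
proof (cases "measure D {t. 2 * ess_inf < t} > 0")
  case True
  obtain n :: nat where n: "measure D {t. 2 * ess_inf + 2 / real (n + 1) < t} > 0"
    using above_pos[OF True] by blast
  \<comment> \<open>Twice a is the level found above, and a itself exceeds the infimum, so lighter
    weights have positive probability.\<close>
  define a where "a = ess_inf + 1 / real (n + 1)"
  have "pivot_notion l D (pivot1 l a)"
  proof (rule B1)
    show "a > 0" using ess_inf_ge[OF nonneg] by (simp add: a_def add_nonneg_pos)
    show "measure D {t. t > 2 * a} > 0" using n by (simp add: a_def algebra_simps)
    show "measure D {t. t < a} > 0" by (rule below_pos) (simp add: a_def)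
  qed
  then show ?thesis by blast
next
  case False
  then have "measure D {2 * ess_inf<..} = 0" by (simp add: zero_less_measure_iff greaterThan_def)
  then have "AE t in D. t \<notin> {2 * ess_inf<..}" using prob_eq_0[of "{2 * ess_inf<..}"] by (simp add: sets_D)
  then have up: "AE t in D. t \<le> 2 * ess_inf" by (simp add: not_less)
  \<comment> \<open>With infimum 0 the weights would be at most 0, hence deterministic.\<close>
  have m0: "0 < ess_inf"
  proof (rule ccontr)
    assume "\<not> 0 < ess_inf"
    then have z: "ess_inf = 0" using ess_inf_ge[OF nonneg] by simp
    have "AE t in D. t = 0" using up nonneg by eventually_elim (simp add: z)
    then show False using nondet by blast
  qed
  have "measure D {t. ess_inf < t} > 0"
  proof (rule ccontr)
    assume "\<not> measure D {t. ess_inf < t} > 0"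
    then have "measure D {ess_inf<..} = 0" by (simp add: zero_less_measure_iff greaterThan_def)
    then have "AE t in D. t \<notin> {ess_inf<..}" using prob_eq_0[of "{ess_inf<..}"] by (simp add: sets_D)
    then have "AE t in D. t = ess_inf" using AE_ess_inf by eventually_elim auto
    then show False using nondet by blast
  qed
  then obtain n :: nat where n: "measure D {t. ess_inf + 2 * ess_inf / real (n + 1) < t} > 0"
    using above_pos by blast
  \<comment> \<open>Gives k \<ge> 2 and 2 / k \<le> 2 / (n + 1), so the level found above is at
    least the threshold for heavy edges.\<close>
  define k where "k = int n + 2"
  have "pivot_notion l D (\<lambda>w. pivot2 l k (\<lambda>e. w e / ess_inf))"
  proof (rule B2)
    have "AE t in D. t \<in> {ess_inf..2 * ess_inf}" using AE_ess_inf up by eventually_elim auto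
    then have "measure D {ess_inf..2 * ess_inf} = 1" by (subst prob_eq_1) (auto simp: sets_D)
    then show "\<exists>c>0. measure D {c..2 * c} = 1" using m0 by blast
    show "ess_inf = Inf (law_support D)" by (simp add: ess_inf_def)
    show "2 \<le> k" by (simp add: k_def)
    show "0 < measure D {t. heavy k (t / ess_inf)}"
    proof -
      have "2 * ess_inf / real_of_int k \<le> 2 * ess_inf / real (n + 1)"
        using m0 by (intro divide_left_mono) (auto simp: k_def)
      then have "{t. ess_inf + 2 * ess_inf / real (n + 1) < t} \<subseteq> {t. heavy k (t / ess_inf)}"
        using m0 by (auto simp: heavy_def pos_less_divide_eq algebra_simps)
      moreover have "{t. heavy k (t / ess_inf)} \<in> sets D"
        unfolding heavy_def using m0 by (auto simp: sets_D)
      ultimately have "measure D {t. ess_inf + 2 * ess_inf / real (n + 1) < t} \<le> measure D {t. heavy k (t / ess_inf)}"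
        by (intro finite_measure_mono)
      then show ?thesis using n by linarith
    qed
    show "0 < measure D {t. light k (t / ess_inf)}"
    proof -
      define b where "b = ess_inf * (1 + 1 / (real_of_int k + 1))"
      have "ess_inf < b" using m0 by (simp add: b_def k_def algebra_simps)
      \<comment> \<open>Being light also asks for a normalised weight of at least 1, which holds
        almost surely.\<close>
      have "measure D {t. light k (t / ess_inf)} = measure D {t. t < b}"
      proof (rule finite_measure_eq_AE)
        show "AE t in D. t \<in> {t. light k (t / ess_inf)} \<longleftrightarrow> t \<in> {t. t < b}"
          using AE_ess_inf by eventually_elim
            (use m0 in \<open>auto simp: light_def b_def pos_le_divide_eq pos_divide_less_eq mult.commute\<close>)
        show "{t. light k (t / ess_inf)} \<in> events" unfolding light_def by (auto simp: sets_D)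
        show "{t. t < b} \<in> events" by (auto simp: sets_D)
      qed
      then show ?thesis using below_pos[OF \<open>ess_inf < b\<close>] by simp
    qed
  qed
  then show ?thesis by blast
qed

lemma notion_percolation:
  assumes l: "l \<ge> 2" and "pivot_notion l D piv"
  shows "\<exists>A B Lt Hv m K. piv = pivot_at A B Lt Hv \<and> percolation l A B Lt Hv m K D"
  using assms(2)
proof cases
  case (B1 a)
  interpret cut_structure l "light1 l" "heavy1 l" "{..<a}" "{2 * a<..}" 0 0
    by (rule pivot1_structure[OF l B1(2)])
  have "percolation l (light1 l) (heavy1 l) {..<a} {2 * a<..} 0 0 D"
  proof
    show "sets D = sets borel" by (rule sets_D)
    show "measure D {..<a} > 0" "measure D {2 * a<..} > 0"
      using B1 by (simp_all add: lessThan_def greaterThan_def)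
    show "AE t in D. 0 \<le> t" by (rule nonneg)
  qed
  moreover have "piv = pivot_at (light1 l) (heavy1 l) {..<a} {2 * a<..}"
    using pivot1_iff[OF l] by (auto simp: B1(1) fun_eq_iff)
  ultimately show ?thesis by blast
next
  case (B2 m k)
  obtain c where c: "c > 0" "measure D {c..2 * c} = 1" using B2(2) by blast
  have "AE t in D. t \<in> {c..2 * c}" using c(2) by (subst (asm) prob_eq_1) (auto simp: sets_D)
  then have "AE t in D. c \<le> t" by eventually_elim simp
  then have "c \<le> m" using ess_inf_ge by (simp add: B2(3) ess_inf_def)
  then have m: "m > 0" using c by simp
  interpret cut_structure l "light2 l k" "heavy2 l k" "{t. light k (t / m)}" "{t. heavy k (t / m)}" m "k * l"
    by (rule pivot2_structure[OF l B2(4) m])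
  have "percolation l (light2 l k) (heavy2 l k) {t. light k (t / m)} {t. heavy k (t / m)} m (k * l) D"
  proof
    show "sets D = sets borel" by (rule sets_D)
    show "measure D {t. light k (t / m)} > 0" "measure D {t. heavy k (t / m)} > 0"
      by (rule B2)+
    show "AE t in D. m \<le> t" using AE_ess_inf by (simp add: B2(3) ess_inf_def)
  qed
  moreover have "piv = pivot_at (light2 l k) (heavy2 l k) {t. light k (t / m)} {t. heavy k (t / m)}"
    using pivot2_iff[of l k _ m] by (auto simp: B2(1) fun_eq_iff)
  ultimately show ?thesis by blast
qed

end

theorem theorem1p2:
  fixes M :: "'a measure" and W :: "int \<times> int \<Rightarrow> 'a \<Rightarrow> real" and D :: "real measure" and l :: int
  assumes "prob_space M"
    and "l \<ge> 2"
    and "prob_space.indep_vars M (\<lambda>_. borel) W (edges l)"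
    and "\<forall>e\<in>edges l. distr M borel (W e) = D"
    and "\<forall>e\<in>edges l. \<forall>\<xi>\<in>space M. W e \<xi> \<ge> 0"
    and "\<not> (\<exists>c. AE t in D. t = c)"
  defines "H \<equiv> \<lambda>n \<xi>. real (hops l (\<lambda>e. W e \<xi>) 0 (int n))"
  shows "\<exists>\<mu>>0.
    (AE \<xi> in M. (\<lambda>n. H n \<xi> / real n) \<longlonglongrightarrow> \<mu>) \<and>
    (\<forall>n. integrable M (H n)) \<and>
    (\<lambda>n. (\<integral>\<xi>. H n \<xi> \<partial>M) / real n) \<longlonglongrightarrow> \<mu> \<and>
    (\<forall>piv. pivot_notion l D piv \<longrightarrow>
      (let P1 = (\<lambda>\<xi>. pivot_gap piv (\<lambda>e. W e \<xi>));
           H1 = (\<lambda>\<xi>. pivot_hops l piv (\<lambda>e. W e \<xi>));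
           \<mu>P = (\<integral>\<xi>. P1 \<xi> \<partial>M);
           \<mu>H = (\<integral>\<xi>. H1 \<xi> \<partial>M);
           \<sigma>2 = 1 / \<mu>P * prob_space.variance M (\<lambda>\<xi>. H1 \<xi> - \<mu>H / \<mu>P * P1 \<xi>)
       in integrable M P1 \<and> integrable M H1 \<and>
          integrable M (\<lambda>\<xi>. (H1 \<xi> - \<mu>H / \<mu>P * P1 \<xi>)\<^sup>2) \<and>
          \<sigma>2 > 0 \<and>
          weak_conv_m (\<lambda>n. distr M borel (\<lambda>\<xi>. (H n \<xi> - real n * \<mu>) / sqrt (real n)))
            (density lborel (\<lambda>t. ennreal (normal_density 0 (sqrt \<sigma>2) t)))))"
proof -
  interpret M: prob_space M by (rule assms(1))
  have e01: "(0, 1) \<in> edges l" using assms(2) by (simp add: edges_def)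
  have rv: "W e \<in> borel_measurable M" if "e \<in> edges l" for e
    using assms(3) that unfolding M.indep_vars_def by auto
  have D01: "D = distr M borel (W (0, 1))" using assms(4) e01 by simp
  interpret weight_law D
  proof -
    interpret D: prob_space D unfolding D01 by (rule M.prob_space_distr[OF rv[OF e01]])
    show "weight_law D"
    proof
      show "sets D = sets borel" by (simp add: D01)
      show "AE t in D. 0 \<le> t" unfolding D01
        by (subst AE_distr_iff[OF rv[OF e01]]) (use assms(5) e01 in \<open>auto intro!: AE_I2\<close>)
    qed
  qed
  note laws = percolation.limit_laws[OF _ assms(1,3,4,5)]
  \<comment> \<open>The laws of large numbers mention no pivots; any admissible notion yields
    \<mu>.\<close>
  obtain piv0 where "pivot_notion l D piv0" using notion_exists[OF assms(6)] by blast
  then obtain A B Lt Hv m K where P0: "percolation l A B Lt Hv m K D"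
    using notion_percolation[OF assms(2)] by blast
  interpret P0: percolation l A B Lt Hv m K D by (rule P0)
  note laws0 = laws[OF P0]
  show ?thesis
  proof (intro exI[of _ "P0.RR.\<mu>"] conjI allI impI)
    show "0 < P0.RR.\<mu>" by (rule P0.mu_pos)
    show "AE \<xi> in M. (\<lambda>n. H n \<xi> / real n) \<longlonglongrightarrow> P0.RR.\<mu>" unfolding H_def by (rule laws0(1))
    show "integrable M (H n)" for n using laws0(2) unfolding H_def by blast
    show "(\<lambda>n. (\<integral>\<xi>. H n \<xi> \<partial>M) / real n) \<longlonglongrightarrow> P0.RR.\<mu>" unfolding H_def by (rule laws0(3))
    fix piv assume "pivot_notion l D piv"
    then obtain A' B' Lt' Hv' m' K' where piv: "piv = pivot_at A' B' Lt' Hv'"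
      and P': "percolation l A' B' Lt' Hv' m' K' D"
      using notion_percolation[OF assms(2)] by blast
    interpret P': percolation l A' B' Lt' Hv' m' K' D by (rule P')
    note laws' = laws[OF P']
    \<comment> \<open>Both constants are the limit of the same normalised expectation, so \<mu> does
      not depend on the notion of pivot.\<close>
    have \<mu>: "P0.RR.\<mu> = P'.RR.\<mu>" by (rule LIMSEQ_unique[OF laws0(3) laws'(3)])
    show "let P1 = (\<lambda>\<xi>. pivot_gap piv (\<lambda>e. W e \<xi>));
           H1 = (\<lambda>\<xi>. pivot_hops l piv (\<lambda>e. W e \<xi>));
           \<mu>P = (\<integral>\<xi>. P1 \<xi> \<partial>M);
           \<mu>H = (\<integral>\<xi>. H1 \<xi> \<partial>M);
           \<sigma>2 = 1 / \<mu>P * prob_space.variance M (\<lambda>\<xi>. H1 \<xi> - \<mu>H / \<mu>P * P1 \<xi>)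
       in integrable M P1 \<and> integrable M H1 \<and>
          integrable M (\<lambda>\<xi>. (H1 \<xi> - \<mu>H / \<mu>P * P1 \<xi>)\<^sup>2) \<and>
          \<sigma>2 > 0 \<and>
          weak_conv_m (\<lambda>n. distr M borel (\<lambda>\<xi>. (H n \<xi> - real n * P0.RR.\<mu>) / sqrt (real n)))
            (density lborel (\<lambda>t. ennreal (normal_density 0 (sqrt \<sigma>2) t)))"
      unfolding Let_def \<mu> piv H_def by (intro conjI laws'(4-8))
  qed
qed

end
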